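(* Let $(n_k)_{k\ge0}$ be a strictly increasing sequence of positive integers. The following are equivalent: (1) there exists a continuous Borel probability measure $\sigma$ on $\mathbb{T}$ such that $\hat\sigma(n_k)\to1$ as $k\to\infty$; (2) there exists a bounded linear operator $T$ on a separable complex infinite-dimensional Hilbert space $H$ which admits a non-degenerate $T$-invariant Gaussian probability measure $m$ with respect to which $T$ is a weakly mixing measure-preserving transformation that is rigid with respect to $(n_k)$.
   Context: For a Borel measure $\sigma$ on $\mathbb{T}$, $\hat\sigma(n)=\int_{\mathbb{T}}\lambda^n\,d\sigma(\lambda)$. A measure is continuous if it has no atoms. A Borel probability measure $m$ on $H$ is non-degenerate if $m(U)>0$ for every non-empty open $U$. A measure-preserving transformation $\varphi$ of a probability space $(X,\mathcal{F},\mu)$ is weakly mixing if $\frac1N\sum_{n=1}^N|\mu(\varphi^{-n}(A)\cap B)-\mu(A)\mu(B)|\to0$ for all $A,B\in\mathcal{F}$, and rigid with respect to $(n_k)$ if $\mu(\varphi^{-n_k}(A)\triangle A)\to0$ as $k\to\infty$ for every $A\in\mathcal{F}$. *)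

theory Defs
  imports "HOL-Analysis.Analysis" "HOL-Probability.Probability"
begin

text \<open>HOL-Analysis only provides real inner product spaces, so we introduce complex
inner product spaces as a type class: a real normed vector space with a compatible
complex scalar multiplication and a complex inner product (conjugate-linear in the
first argument, linear in the second) inducing the norm.\<close>

class complex_inner = real_normed_vector +
  fixes scaleC :: "complex \<Rightarrow> 'a \<Rightarrow> 'a"
    and cinner :: "'a \<Rightarrow> 'a \<Rightarrow> complex"
  assumes scaleC_add_right: "scaleC a (x + y) = scaleC a x + scaleC a y"
    and scaleC_add_left: "scaleC (a + b) x = scaleC a x + scaleC b x"
    and scaleC_scaleC: "scaleC a (scaleC b x) = scaleC (a * b) x"
    and scaleC_one: "scaleC 1 x = x"
    and scaleR_scaleC: "scaleR r x = scaleC (complex_of_real r) x"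
    and cinner_add_left: "cinner (x + y) z = cinner x z + cinner y z"
    and cinner_scaleC_left: "cinner (scaleC a x) y = cnj a * cinner x y"
    and cinner_commute: "cinner x y = cnj (cinner y x)"
    and cinner_self_norm: "cinner x x = complex_of_real ((norm x)\<^sup>2)"

class complex_hilbert = complex_inner + complete_space

definition clinear :: "('a::complex_inner \<Rightarrow> 'b::complex_inner) \<Rightarrow> bool" where
  "clinear f \<longleftrightarrow> (\<forall>x y. f (x + y) = f x + f y) \<and> (\<forall>c x. f (scaleC c x) = scaleC c (f x))"

definition bounded_clinear :: "('a::complex_inner \<Rightarrow> 'b::complex_inner) \<Rightarrow> bool" where
  "bounded_clinear f \<longleftrightarrow> clinear f \<and> (\<exists>K. \<forall>x. norm (f x) \<le> K * norm x)"

definition bounded_cfunctional :: "('a::complex_inner \<Rightarrow> complex) \<Rightarrow> bool" where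
  "bounded_cfunctional f \<longleftrightarrow>
     (\<forall>x y. f (x + y) = f x + f y) \<and> (\<forall>c x. f (scaleC c x) = c * f x) \<and>
     (\<exists>K. \<forall>x. norm (f x) \<le> K * norm x)"

definition cspan :: "'a::complex_inner set \<Rightarrow> 'a set" where
  "cspan S = {x. \<exists>F c. finite F \<and> F \<subseteq> S \<and> x = (\<Sum>v\<in>F. scaleC (c v) v)}"

definition cinfinite_dim :: "'a::complex_inner itself \<Rightarrow> bool" where
  "cinfinite_dim _ \<longleftrightarrow> (\<nexists>S::'a set. finite S \<and> cspan S = UNIV)"

definition separable_type :: "'a::topological_space itself \<Rightarrow> bool" where
  "separable_type _ \<longleftrightarrow> (\<exists>D::'a set. countable D \<and> closure D = UNIV)"

definition borel_prob :: "'a::topological_space measure \<Rightarrow> bool" where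
  "borel_prob m \<longleftrightarrow> sets m = sets borel \<and> prob_space m"

definition non_degenerate :: "'a::topological_space measure \<Rightarrow> bool" where
  "non_degenerate m \<longleftrightarrow> (\<forall>U. open U \<and> U \<noteq> {} \<longrightarrow> emeasure m U > 0)"

text \<open>Symmetric (circular) complex Gaussian distribution with parameter \<open>s \<ge> 0\<close>,
viewed as a distribution on \<open>\<real>\<^sup>2\<close> (real part, imaginary part): real and imaginary
parts are independent centred Gaussians with the same standard deviation \<open>s\<close>;
\<open>s = 0\<close> gives the degenerate Gaussian (Dirac mass at 0).\<close>
definition complex_gaussian_distr :: "real \<Rightarrow> (real \<times> real) measure" where
  "complex_gaussian_distr s =
     (if s = 0 then return borel (0, 0)
      else density lborel (normal_density 0 s) \<Otimes>\<^sub>M density lborel (normal_density 0 s))"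

definition gaussian_measure :: "'a::complex_hilbert measure \<Rightarrow> bool" where
  "gaussian_measure m \<longleftrightarrow> borel_prob m \<and>
     (\<forall>f. bounded_cfunctional f \<longrightarrow>
        (\<exists>s\<ge>0. distr m borel (\<lambda>x. (Re (f x), Im (f x))) = complex_gaussian_distr s))"

definition measure_preserving_map :: "'a measure \<Rightarrow> ('a \<Rightarrow> 'a) \<Rightarrow> bool" where
  "measure_preserving_map m T \<longleftrightarrow> T \<in> measurable m m \<and> distr m m T = m"

definition weakly_mixing :: "'a measure \<Rightarrow> ('a \<Rightarrow> 'a) \<Rightarrow> bool" where
  "weakly_mixing m T \<longleftrightarrow> measure_preserving_map m T \<and>
     (\<forall>A\<in>sets m. \<forall>B\<in>sets m.
        (\<lambda>N. (1 / real N) * (\<Sum>n=1..N.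
            \<bar>measure m ((T ^^ n) -` A \<inter> space m \<inter> B) - measure m A * measure m B\<bar>))
        \<longlonglongrightarrow> 0)"

definition rigid_wrt :: "'a measure \<Rightarrow> ('a \<Rightarrow> 'a) \<Rightarrow> (nat \<Rightarrow> nat) \<Rightarrow> bool" where
  "rigid_wrt m T nk \<longleftrightarrow> measure_preserving_map m T \<and>
     (\<forall>A\<in>sets m.
        (\<lambda>k. measure m ((((T ^^ nk k) -` A \<inter> space m) - A) \<union> (A - (T ^^ nk k) -` A)))
        \<longlonglongrightarrow> 0)"

abbreviation circle :: "complex set" where "circle \<equiv> sphere 0 1"

definition borel_prob_circle :: "complex measure \<Rightarrow> bool" where
  "borel_prob_circle \<sigma> \<longleftrightarrow> sets \<sigma> = sets (restrict_space borel circle) \<and> prob_space \<sigma>"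

definition continuous_measure :: "'a measure \<Rightarrow> bool" where
  "continuous_measure \<sigma> \<longleftrightarrow> (\<forall>z. emeasure \<sigma> {z} = 0)"

definition fourier_coeff :: "complex measure \<Rightarrow> nat \<Rightarrow> complex" where
  "fourier_coeff \<sigma> n = (\<integral>z. z ^ n \<partial>\<sigma>)"

end

theory Submission
  imports Defs "HOL-Complex_Analysis.Complex_Analysis"
begin

text \<open>
  From the operator to the measure: for a ball \<open>A\<close> with \<open>0 < m(A) < 1\<close> the correlations
  \<open>m(T\<^sup>-\<^sup>n A \<inter> A) - m(A)\<^sup>2\<close> are positive definite, hence by Herglotz' theorem the Fourier coefficients
  of a measure on the circle. Weak mixing kills its atoms, rigidity sends the normalised coefficients to 1.

  From the measure to the operator: let \<open>X\<^sub>n\<close> be a stationary complex Gaussian sequence with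
  covariance \<open>E X\<^sub>n cnj X\<^sub>m = 2 \<integral> z\<^sup>n cnj z\<^sup>m d\<sigma>\<close>, \<open>m\<close> the law of \<open>\<Sum> 2\<^sup>-\<^sup>n\<^sup>/\<^sup>2 X\<^sub>n e\<^sub>n\<close> and
  \<open>T\<close> the backward shift with weight \<open>\<surd>2\<close>. A functional \<open>f\<close> has the symbol
  \<open>\<Phi>\<^sub>f(z) = \<Sum> f(e\<^sub>n) 2\<^sup>-\<^sup>n\<^sup>/\<^sup>2 z\<^sup>n\<close>, with \<open>\<Phi>\<close> of \<open>f \<circ> T\<close> equal to \<open>z \<Phi>\<^sub>f\<close> and
  \<open>\<integral> exp(i Re f) dm = exp(-\<parallel>\<Phi>\<^sub>f\<parallel>\<^sup>2/2)\<close>, the norm being that of \<open>L\<^sup>2(\<sigma>)\<close>. Indicators of Borel sets are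
  \<open>L\<^sup>1(m)\<close>-limits of trigonometric polynomials in functionals, so invariance, mixing (through Wiener's lemma)
  and rigidity reduce to this formula. Since \<open>\<Phi>\<^sub>f\<close> is holomorphic beyond the circle and \<open>\<sigma>\<close> has
  no atoms, \<open>\<Phi>\<^sub>f = 0\<close> in \<open>L\<^sup>2(\<sigma>)\<close> only for \<open>f = 0\<close>; thus the directions along which \<open>m\<close> is quasi-invariant
  span a dense subspace and \<open>m\<close> charges every open set.
\<close>

subsection \<open>Approximation of indicators by algebras of bounded functions\<close>

text \<open>All \<open>X n\<close> have the same variance, so the undamped series
  \<open>\<Sum> X n e n\<close> has infinite expected squared norm. Damping by 2^(-n/2) repairs
  this, and the weight of the shift undoes it, because sqrt 2 * 2^(-(n+1)/2) = 2^(-n/2): in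
  coordinates \<open>T\<close> replaces \<open>X n\<close> by \<open>X (n+1)\<close>, and
  stationarity becomes invariance. The operator does not depend on \<open>\<sigma>\<close>, which
  enters only through the law. The base 2 is arbitrary, but geometric decay matters twice: it pushes
  the radius of convergence of the symbols beyond 1, and it beats a linear factor N in the density
  argument for the quasi-invariant directions.

  All Gaussian facts are read off from integrals of exp(i Re f). The obstacle is to pass from these
  functions to sets. This is settled once, by an approximation result valid for finitely many
  measures at once: with two measures it gives uniqueness of characteristic functionals, with one
  measure it transfers mixing and rigidity to Borel sets.\<close>

locale bounded_function_algebra =
  fixes Ms :: "'a measure set" and N :: "'a measure" and A :: "('a \<Rightarrow> complex) set"
  assumes finite_Ms: "finite Ms"
    and prob_Ms: "\<And>M. M \<in> Ms \<Longrightarrow> prob_space M"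
    and sets_Ms: "\<And>M. M \<in> Ms \<Longrightarrow> sets M = sets N"
    and meas_A: "\<And>f. f \<in> A \<Longrightarrow> f \<in> borel_measurable N"
    and bounded_A: "\<And>f. f \<in> A \<Longrightarrow> \<exists>K. \<forall>x. cmod (f x) \<le> K"
    and const_A: "\<And>c. (\<lambda>_. c) \<in> A"
    and add_A: "\<And>f g. f \<in> A \<Longrightarrow> g \<in> A \<Longrightarrow> (\<lambda>x. f x + g x) \<in> A"
    and mult_A: "\<And>f g. f \<in> A \<Longrightarrow> g \<in> A \<Longrightarrow> (\<lambda>x. f x * g x) \<in> A"
begin

text \<open>One approximant has to serve every measure in \<open>Ms\<close>; this is what later
  allows two measures to be compared. The uniform bound is part of the definition because without it
  the closure would not be stable under products.\<close>

definition L1_closure :: "('a \<Rightarrow> complex) set" where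
  "L1_closure = {h \<in> borel_measurable N. (\<exists>K. \<forall>x. cmod (h x) \<le> K) \<and>
     (\<forall>e>0. \<exists>f\<in>A. \<forall>M\<in>Ms. (\<integral>x. cmod (h x - f x) \<partial>M) < e)}"

lemma borel_measurable_Ms:
  assumes "M \<in> Ms" "h \<in> borel_measurable N" shows "h \<in> borel_measurable M"
  using assms(2) measurable_cong_sets[OF sets_Ms[OF assms(1)] refl] by blast

lemma integrable_bounded:
  fixes h :: "'a \<Rightarrow> complex"
  assumes "M \<in> Ms" "h \<in> borel_measurable N" "\<forall>x. cmod (h x) \<le> K"
  shows "integrable M h"
proof -
  interpret prob_space M using prob_Ms assms(1) .
  show ?thesis
    by (rule integrable_const_bound[of _ K]) (use assms borel_measurable_Ms in auto)
qed

lemma L1_closureE: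
  assumes "h \<in> L1_closure"
  obtains K where "h \<in> borel_measurable N" "\<forall>x. cmod (h x) \<le> K" "K > 0"
proof -
  obtain K where "h \<in> borel_measurable N" "\<forall>x. cmod (h x) \<le> K"
    using assms by (auto simp: L1_closure_def)
  then show ?thesis
    using that[of "max K 1"] by (auto simp: le_max_iff_disj)
qed

lemma A_boundE:
  assumes "f \<in> A" obtains K where "\<forall>x. cmod (f x) \<le> K" "K > 0"
proof -
  obtain K where "\<forall>x. cmod (f x) \<le> K"
    using bounded_A[OF assms] by auto
  then show ?thesis
    using that[of "max K 1"] by (auto simp: le_max_iff_disj)
qed

lemma L1_closure_approx:
  assumes "h \<in> L1_closure" "e > 0"
  obtains f where "f \<in> A" "\<And>M. M \<in> Ms \<Longrightarrow> (\<integral>x. cmod (h x - f x) \<partial>M) < e"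
  using assms by (force simp: L1_closure_def)

lemma A_subset_closure: "f \<in> A \<Longrightarrow> f \<in> L1_closure"
  using meas_A bounded_A by (force simp: L1_closure_def)

lemma integrable_diff_A:
  assumes "h \<in> L1_closure" "f \<in> A" "M \<in> Ms"
  shows "integrable M (\<lambda>x. cmod (h x - f x))"
proof -
  obtain K where K: "h \<in> borel_measurable N" "\<forall>x. cmod (h x) \<le> K" "K > 0"
    using L1_closureE[OF assms(1)] .
  obtain K' where K': "\<forall>x. cmod (f x) \<le> K'" "K' > 0" using A_boundE[OF assms(2)] .
  show ?thesis
    by (intro integrable_norm Bochner_Integration.integrable_diff)
       (rule integrable_bounded[OF assms(3) K(1,2)], rule integrable_bounded[OF assms(3) meas_A[OF assms(2)] K'(1)])
qed

lemma L1_closure_add: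
  assumes "h \<in> L1_closure" "k \<in> L1_closure" shows "(\<lambda>x. h x + k x) \<in> L1_closure"
proof -
  obtain K where K: "h \<in> borel_measurable N" "\<forall>x. cmod (h x) \<le> K" "K > 0"
    using L1_closureE[OF assms(1)] .
  obtain L where L: "k \<in> borel_measurable N" "\<forall>x. cmod (k x) \<le> L" "L > 0"
    using L1_closureE[OF assms(2)] .
  have "\<exists>f\<in>A. \<forall>M\<in>Ms. (\<integral>x. cmod (h x + k x - f x) \<partial>M) < e" if "e > 0" for e
  proof -
    obtain f where f: "f \<in> A" "\<And>M. M \<in> Ms \<Longrightarrow> (\<integral>x. cmod (h x - f x) \<partial>M) < e/2"
      using L1_closure_approx[OF assms(1), of "e/2"] \<open>e > 0\<close> by (metis half_gt_zero)
    obtain g where g: "g \<in> A" "\<And>M. M \<in> Ms \<Longrightarrow> (\<integral>x. cmod (k x - g x) \<partial>M) < e/2"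
      using L1_closure_approx[OF assms(2), of "e/2"] \<open>e > 0\<close> by (metis half_gt_zero)
    show ?thesis
    proof (intro bexI ballI)
      show "(\<lambda>x. f x + g x) \<in> A" using add_A f g by blast
      fix M assume M: "M \<in> Ms"
      have "(\<integral>x. cmod (h x + k x - (f x + g x)) \<partial>M) \<le> (\<integral>x. cmod (h x - f x) + cmod (k x - g x) \<partial>M)"
      proof (rule integral_mono')
        fix x
        have "h x + k x - (f x + g x) = (h x - f x) + (k x - g x)" by simp
        then show "cmod (h x + k x - (f x + g x)) \<le> cmod (h x - f x) + cmod (k x - g x)"
          using norm_triangle_ineq by metis
      qed (use integrable_diff_A[OF assms(1) f(1) M] integrable_diff_A[OF assms(2) g(1) M] in auto)
      also have "\<dots> = (\<integral>x. cmod (h x - f x) \<partial>M) + (\<integral>x. cmod (k x - g x) \<partial>M)"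
        by (rule Bochner_Integration.integral_add) (use integrable_diff_A[OF assms(1) f(1) M] integrable_diff_A[OF assms(2) g(1) M] in auto)
      also have "\<dots> < e" using f(2)[OF M] g(2)[OF M] by simp
      finally show "(\<integral>x. cmod (h x + k x - (f x + g x)) \<partial>M) < e" .
    qed
  qed
  moreover have "\<forall>x. cmod (h x + k x) \<le> K + L"
    using K L by (metis add_mono norm_triangle_le)
  ultimately show ?thesis using K(1) L(1) unfolding L1_closure_def by (auto intro!: exI)
qed

text \<open>Rests on \<open>h k - f g = k (h - f) + f (k - g)\<close>. The second term is controlled
  by a bound on the approximant \<open>f\<close> rather than on \<open>h\<close>, so
  \<open>f\<close> has to be fixed before the tolerance for \<open>g\<close> is chosen.\<close>

lemma L1_closure_mult:
  assumes "h \<in> L1_closure" "k \<in> L1_closure" shows "(\<lambda>x. h x * k x) \<in> L1_closure"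
proof -
  obtain K where K: "h \<in> borel_measurable N" "\<forall>x. cmod (h x) \<le> K" "K > 0"
    using L1_closureE[OF assms(1)] .
  obtain L where L: "k \<in> borel_measurable N" "\<forall>x. cmod (k x) \<le> L" "L > 0"
    using L1_closureE[OF assms(2)] .
  have "\<exists>f\<in>A. \<forall>M\<in>Ms. (\<integral>x. cmod (h x * k x - f x) \<partial>M) < e" if "e > 0" for e
  proof -
    obtain f where f: "f \<in> A" "\<And>M. M \<in> Ms \<Longrightarrow> (\<integral>x. cmod (h x - f x) \<partial>M) < e/2/L"
      using L1_closure_approx[OF assms(1), of "e/2/L"] \<open>e > 0\<close> \<open>L > 0\<close>
      by (metis half_gt_zero divide_pos_pos)
    obtain K' where K': "\<forall>x. cmod (f x) \<le> K'" "K' > 0" using A_boundE[OF f(1)] .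
    obtain g where g: "g \<in> A" "\<And>M. M \<in> Ms \<Longrightarrow> (\<integral>x. cmod (k x - g x) \<partial>M) < e/2/K'"
      using L1_closure_approx[OF assms(2), of "e/2/K'"] \<open>e > 0\<close> K' by (metis half_gt_zero divide_pos_pos)
    show ?thesis
    proof (intro bexI ballI)
      show "(\<lambda>x. f x * g x) \<in> A" using mult_A f g by blast
      fix M assume M: "M \<in> Ms"
      have "(\<integral>x. cmod (h x * k x - f x * g x) \<partial>M) \<le> (\<integral>x. L * cmod (h x - f x) + K' * cmod (k x - g x) \<partial>M)"
      proof (rule integral_mono')
        fix x
        have "h x * k x - f x * g x = k x * (h x - f x) + f x * (k x - g x)"
          by (simp add: algebra_simps)
        then have "cmod (h x * k x - f x * g x) \<le> cmod (k x) * cmod (h x - f x) + cmod (f x) * cmod (k x - g x)"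
          by (metis norm_mult norm_triangle_ineq)
        also have "\<dots> \<le> L * cmod (h x - f x) + K' * cmod (k x - g x)"
          using L K' by (intro add_mono mult_right_mono) auto
        finally show "cmod (h x * k x - f x * g x) \<le> L * cmod (h x - f x) + K' * cmod (k x - g x)" .
      qed (use integrable_diff_A[OF assms(1) f(1) M] integrable_diff_A[OF assms(2) g(1) M] L K' in auto)
      also have "\<dots> = L * (\<integral>x. cmod (h x - f x) \<partial>M) + K' * (\<integral>x. cmod (k x - g x) \<partial>M)"
        using integrable_diff_A[OF assms(1) f(1) M] integrable_diff_A[OF assms(2) g(1) M] by (subst Bochner_Integration.integral_add) auto
      also have "\<dots> < L * (e/2/L) + K' * (e/2/K')"
        using f(2)[OF M] g(2)[OF M] L K' by (intro add_strict_mono mult_strict_left_mono) auto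
      also have "\<dots> = e" using L K' by simp
      finally show "(\<integral>x. cmod (h x * k x - f x * g x) \<partial>M) < e" .
    qed
  qed
  moreover have "\<forall>x. cmod (h x * k x) \<le> K * L"
    using K L by (auto simp: norm_mult intro!: mult_mono)
  ultimately show ?thesis using K(1) L(1) unfolding L1_closure_def by (auto intro!: exI)
qed

text \<open>Dominated convergence for each measure; since \<open>Ms\<close> is finite, a single
  index \<open>n\<close> is good for all of them.\<close>

lemma L1_closure_lim:
  assumes h: "\<And>n. h n \<in> L1_closure" and K: "\<And>n x. cmod (h n x) \<le> K"
    and lim: "\<And>x. (\<lambda>n. h n x) \<longlonglongrightarrow> k x"
  shows "k \<in> L1_closure"
proof -
  have hm: "h n \<in> borel_measurable N" for n using h by (auto simp: L1_closure_def)
  have km: "k \<in> borel_measurable N"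
    by (rule borel_measurable_LIMSEQ_metric[OF hm lim])
  have kK: "cmod (k x) \<le> K" for x
    by (rule LIMSEQ_le_const2[OF tendsto_norm[OF lim[of x]]]) (use K in auto)
  have "\<exists>f\<in>A. \<forall>M\<in>Ms. (\<integral>x. cmod (k x - f x) \<partial>M) < e" if "e > 0" for e
  proof -
    have "\<forall>M\<in>Ms. \<forall>\<^sub>F n in sequentially. (\<integral>x. cmod (k x - h n x) \<partial>M) < e/2"
    proof
      fix M assume M: "M \<in> Ms"
      interpret prob_space M using prob_Ms M .
      have [measurable]: "h n \<in> borel_measurable M" "k \<in> borel_measurable M" for n
        using borel_measurable_Ms[OF M] hm km by auto
      have "(\<lambda>n. \<integral>x. cmod (k x - h n x) \<partial>M) \<longlonglongrightarrow> (\<integral>x. 0 \<partial>M)"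
      proof (rule integral_dominated_convergence[where w="\<lambda>_. 2*K"])
        show "AE x in M. (\<lambda>n. cmod (k x - h n x)) \<longlonglongrightarrow> 0"
        proof (rule AE_I2)
          fix x
          have "(\<lambda>n. cmod (k x - h n x)) \<longlonglongrightarrow> cmod (k x - k x)"
            by (intro tendsto_intros lim)
          then show "(\<lambda>n. cmod (k x - h n x)) \<longlonglongrightarrow> 0" by simp
        qed
        show "AE x in M. norm (cmod (k x - h n x)) \<le> 2*K" for n
        proof (rule AE_I2)
          fix x
          have "cmod (k x - h n x) \<le> cmod (k x) + cmod (h n x)" by (rule norm_triangle_ineq4)
          then show "norm (cmod (k x - h n x)) \<le> 2*K" using K[of n x] kK[of x] by simp
        qed
      qed auto
      then show "\<forall>\<^sub>F n in sequentially. (\<integral>x. cmod (k x - h n x) \<partial>M) < e/2"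
        using \<open>e > 0\<close> by (intro order_tendstoD(2)) auto
    qed
    then have "\<forall>\<^sub>F n in sequentially. \<forall>M\<in>Ms. (\<integral>x. cmod (k x - h n x) \<partial>M) < e/2"
      by (simp add: eventually_ball_finite finite_Ms)
    then obtain n where n: "\<forall>M\<in>Ms. (\<integral>x. cmod (k x - h n x) \<partial>M) < e/2"
      by (auto simp: eventually_sequentially)
    obtain f where f: "f \<in> A" "\<And>M. M \<in> Ms \<Longrightarrow> (\<integral>x. cmod (h n x - f x) \<partial>M) < e/2"
      using L1_closure_approx[OF h[of n], of "e/2"] \<open>e > 0\<close> by (metis half_gt_zero)
    show ?thesis
    proof (intro bexI ballI)
      fix M assume M: "M \<in> Ms"
      have int: "integrable M (\<lambda>x. cmod (k x - h n x))"
        by (intro integrable_norm Bochner_Integration.integrable_diff)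
           (rule integrable_bounded[where K=K], use M km hm K kK in auto)+
      have "(\<integral>x. cmod (k x - f x) \<partial>M) \<le> (\<integral>x. cmod (k x - h n x) + cmod (h n x - f x) \<partial>M)"
      proof (rule integral_mono')
        fix x
        have "k x - f x = (k x - h n x) + (h n x - f x)" by simp
        then show "cmod (k x - f x) \<le> cmod (k x - h n x) + cmod (h n x - f x)"
          using norm_triangle_ineq by metis
      qed (use int integrable_diff_A[OF h f(1) M] in auto)
      also have "\<dots> = (\<integral>x. cmod (k x - h n x) \<partial>M) + (\<integral>x. cmod (h n x - f x) \<partial>M)"
        by (rule Bochner_Integration.integral_add) (use int integrable_diff_A[OF h f(1) M] in auto)
      also have "\<dots> < e" using n M f(2)[OF M] by force
      finally show "(\<integral>x. cmod (k x - f x) \<partial>M) < e" .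
    qed (rule f)
  qed
  then show ?thesis using km kK unfolding L1_closure_def by blast
qed

lemma L1_closure_const: "(\<lambda>_. c) \<in> L1_closure"
  by (rule A_subset_closure[OF const_A])

lemma L1_closure_polynomial:
  assumes "real_polynomial_function p" "(\<lambda>x. complex_of_real (h x)) \<in> L1_closure"
  shows "(\<lambda>x. complex_of_real (p (h x))) \<in> L1_closure"
  using assms
proof (induction p rule: real_polynomial_function.induct)
  case (linear f)
  have "f r = f 1 * r" for r
    using linear.hyps linear_cmul[OF bounded_linear.linear[OF linear.hyps], of r 1] by simp
  then have "(\<lambda>x. complex_of_real (f (h x))) = (\<lambda>x. of_real (f 1) * of_real (h x))"
    by (metis of_real_mult)
  then show ?case using L1_closure_mult[OF L1_closure_const linear.prems] by metis
next
  case (const c) then show ?case using L1_closure_const by simp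
next
  case (add f g) then show ?case using L1_closure_add by simp
next
  case (mult f g) then show ?case using L1_closure_mult by simp
qed

text \<open>Weierstrass approximation on the compact interval [-K, K] containing the range of
  \<open>h\<close>. Polynomials in \<open>h\<close> are in the closure because it is an
  algebra.\<close>

lemma L1_closure_continuous:
  assumes h: "(\<lambda>x. complex_of_real (h x)) \<in> L1_closure" and f: "continuous_on UNIV f"
  shows "(\<lambda>x. complex_of_real (f (h x))) \<in> L1_closure"
proof -
  obtain K where K: "\<forall>x. cmod (complex_of_real (h x)) \<le> K" using L1_closureE[OF h] by metis
  have hK: "h x \<in> {-K..K}" for x using K[rule_format, of x] by auto
  have "\<exists>p. real_polynomial_function p \<and> (\<forall>t\<in>{-K..K}. \<bar>f t - p t\<bar> < 1 / real (Suc n))" for n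
  proof -
    obtain p where "real_polynomial_function p" "\<And>t. t \<in> {-K..K} \<Longrightarrow> \<bar>f t - p t\<bar> < 1 / real (Suc n)"
      by (rule Stone_Weierstrass_real_polynomial_function[of "{-K..K}" f "1 / real (Suc n)"])
         (use continuous_on_subset[OF f] in auto)
    then show ?thesis by auto
  qed
  then obtain p where p: "\<And>n. real_polynomial_function (p n)"
    "\<And>n t. t \<in> {-K..K} \<Longrightarrow> \<bar>f t - p n t\<bar> < 1 / real (Suc n)" by metis
  have "bounded (f ` {-K..K})"
    using continuous_on_subset[OF f] by (intro compact_imp_bounded compact_continuous_image) auto
  then obtain L where L: "\<And>t. t \<in> {-K..K} \<Longrightarrow> \<bar>f t\<bar> \<le> L" unfolding bounded_real by blast
  show ?thesis
  proof (rule L1_closure_lim[where h="\<lambda>n x. complex_of_real (p n (h x))" and K="L+1"])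
    show "(\<lambda>x. complex_of_real (p n (h x))) \<in> L1_closure" for n
      by (rule L1_closure_polynomial[OF p(1) h])
    show "cmod (complex_of_real (p n (h x))) \<le> L + 1" for n x
    proof -
      have "1 / real (Suc n) \<le> 1" by simp
      then show ?thesis using p(2)[OF hK, of x n] L[OF hK, of x] by (simp only: norm_of_real)
    qed
    show "(\<lambda>n. complex_of_real (p n (h x))) \<longlonglongrightarrow> complex_of_real (f (h x))" for x
    proof (rule tendsto_of_real, rule LIMSEQ_I)
      fix r :: real assume "r > 0"
      then obtain n0 where n0: "1 / real (Suc n0) < r" using nat_approx_posE by blast
      show "\<exists>no. \<forall>n\<ge>no. norm (p n (h x) - f (h x)) < r"
      proof (intro exI allI impI)
        fix n assume "n0 \<le> n"
        then have "1 / real (Suc n) \<le> 1 / real (Suc n0)" by (simp add: frac_le)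
        then show "norm (p n (h x) - f (h x)) < r" using p(2)[OF hK, of x n] n0 by simp
      qed
    qed
  qed
qed

definition approximable :: "'a set set" where
  "approximable = {B \<in> sets N. (indicator B :: 'a \<Rightarrow> complex) \<in> L1_closure}"

text \<open>Intersections come from products, complements from differences, and countable unions
  from bounded pointwise limits of indicators. This takes the place of a monotone class
  argument.\<close>

lemma sigma_algebra_approximable: "sigma_algebra (space N) approximable"
proof (rule sigma_algebra.intro)
  have diff: "space N - a \<in> approximable" if "a \<in> approximable" for a
  proof -
    have "indicator (space N) \<in> L1_closure" 
    proof (rule L1_closure_lim[where h="\<lambda>n. indicator (space N)" and K=1])
      show "(indicator (space N) :: 'a \<Rightarrow> complex) \<in> L1_closure"
      proof -
        \<comment> \<open>Off \<open>space N\<close> the indicator and the constant 1 differ as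
          functions on the whole type, but no integral sees that.\<close>
        have "(\<integral>x. cmod (indicator (space N) x - 1) \<partial>M) = 0" if "M \<in> Ms" for M
        proof -
          have "(\<integral>x. cmod (indicator (space N) x - 1) \<partial>M) = (\<integral>x. 0 \<partial>M)"
            by (rule Bochner_Integration.integral_cong) (use sets_eq_imp_space_eq[OF sets_Ms[OF that]] in auto)
          then show ?thesis by simp
        qed
        moreover have "\<forall>x. cmod (indicator (space N) x) \<le> 1" by (auto simp: indicator_def)
        ultimately show ?thesis
          unfolding L1_closure_def using const_A[of 1] by (auto intro!: bexI[of _ "\<lambda>_. 1"])
      qed
    qed (auto simp: indicator_def)
    moreover have "(\<lambda>x. - 1 * indicator a x) \<in> L1_closure"
      by (rule L1_closure_mult[OF L1_closure_const]) (use that in \<open>auto simp: approximable_def\<close>)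
    ultimately have "(\<lambda>x. indicator (space N) x + - 1 * indicator a x) \<in> L1_closure"
      by (rule L1_closure_add)
    moreover have "(\<lambda>x. indicator (space N) x + - 1 * indicator a x) = (indicator (space N - a) :: 'a \<Rightarrow> complex)"
      using that sets.sets_into_space by (fastforce simp: approximable_def indicator_def)
    ultimately show ?thesis using that by (auto simp: approximable_def)
  qed
  have empty: "{} \<in> approximable"
  proof -
    have "(indicator {} :: 'a \<Rightarrow> complex) = (\<lambda>_. 0)" by auto
    then show ?thesis using L1_closure_const[of 0] by (simp add: approximable_def)
  qed
  have int: "a \<inter> b \<in> approximable" if "a \<in> approximable" "b \<in> approximable" for a b
  proof -
    have "indicator (a \<inter> b) = (\<lambda>x. indicator a x * indicator b x :: complex)"
      by (auto simp: indicator_def)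
    then show ?thesis using that L1_closure_mult by (auto simp: approximable_def)
  qed
  show alg: "algebra (space N) approximable"
    unfolding algebra_iff_Int using empty diff int
    by (auto simp: approximable_def sets.sets_into_space dest: sets.sets_into_space)
  show "sigma_algebra_axioms approximable"
  proof
    fix B :: "nat \<Rightarrow> 'a set" assume B: "range B \<subseteq> approximable"
    define C where "C n = (\<Union>i<n. B i)" for n
    have C: "C n \<in> approximable" for n
      unfolding C_def using B by (intro ring_of_sets.finite_UN[OF algebra.axioms(1)[OF alg]]) auto
    have "(indicator (\<Union>i. B i) :: 'a \<Rightarrow> complex) \<in> L1_closure"
    proof (rule L1_closure_lim[where h="\<lambda>n. indicator (C n)" and K=1])
      show "indicator (C n) \<in> L1_closure" for n using C by (simp add: approximable_def)
      show "(\<lambda>n. indicator (C n) x) \<longlonglongrightarrow> (indicator (\<Union>i. B i) x :: complex)" for x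
        unfolding C_def by (rule LIMSEQ_indicator_UN)
    qed (auto simp: indicator_def)
    then show "(\<Union>i. B i) \<in> approximable" using B by (auto simp: approximable_def)
  qed
qed

definition approximable_algebra :: "'a measure" where
  "approximable_algebra = sigma (space N) approximable"

lemma sets_approximable_algebra [simp]: "sets approximable_algebra = approximable"
  and space_approximable_algebra [simp]: "space approximable_algebra = space N"
proof -
  interpret sigma_algebra "space N" approximable by (rule sigma_algebra_approximable)
  show "sets approximable_algebra = approximable" unfolding approximable_algebra_def
    by (rule sets_measure_of_eq)
  show "space approximable_algebra = space N" unfolding approximable_algebra_def
    using space_closed by (simp add: space_measure_of)
qed

text \<open>The indicator of \<open>{x. a < h x}\<close> is the bounded limit of the ramps
  \<open>min 1 (n * max 0 (h x - a))\<close>, which are continuous functions of \<open>h\<close>.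
  Measurability over the approximable sets is the form in which a generating family can be
  exploited.\<close>

lemma borel_measurable_approximable:
  fixes h :: "'a \<Rightarrow> real"
  assumes "(\<lambda>x. complex_of_real (h x)) \<in> L1_closure"
  shows "h \<in> borel_measurable approximable_algebra"
  unfolding borel_measurable_iff_greater
proof
  fix a :: real
  have "(\<lambda>x. Re (complex_of_real (h x))) \<in> borel_measurable N"
    using L1_closureE[OF assms] by (metis borel_measurable_Re measurable_compose)
  then have [measurable]: "h \<in> borel_measurable N" by simp
  define B where "B = {x \<in> space N. a < h x}"
  have cl: "(\<lambda>x. complex_of_real (min 1 (real n * max 0 (h x - a)))) \<in> L1_closure" for n
    by (rule L1_closure_continuous[OF assms]) (intro continuous_intros)
  have lim: "(\<lambda>n. complex_of_real (min 1 (real n * max 0 (h x - a)))) \<longlonglongrightarrow> indicator {x. a < h x} x" for x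
  proof (cases "a < h x")
    case True
    obtain n0 where n0: "real n0 * (h x - a) > 1" using reals_Archimedean3 True by (metis diff_gt_0_iff_gt)
    have "eventually (\<lambda>n. min 1 (real n * max 0 (h x - a)) = 1) sequentially"
      using eventually_ge_at_top[of n0]
    proof eventually_elim
      case (elim n)
      have "real n0 * (h x - a) \<le> real n * (h x - a)" using elim True by (intro mult_right_mono) auto
      then have "1 \<le> real n * (h x - a)" using n0 by linarith
      then show ?case using True by (simp add: min_def)
    qed
    then have "eventually (\<lambda>n. complex_of_real (min 1 (real n * max 0 (h x - a))) = 1) sequentially"
      by eventually_elim simp
    then show ?thesis using True by (simp add: tendsto_eventually)
  qed auto
  have *: "(indicator {x. a < h x} :: 'a \<Rightarrow> complex) \<in> L1_closure"
    by (rule L1_closure_lim[where h="\<lambda>n x. complex_of_real (min 1 (real n * max 0 (h x - a)))" and K=1, OF cl _ lim])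
       (simp only: norm_of_real, auto simp: min_def max_def)
  have "space N \<in> approximable"
    using sets.top[of approximable_algebra] by simp
  then have "(\<lambda>x. indicator (space N) x * indicator {x. a < h x} x) \<in> L1_closure"
    using L1_closure_mult[OF _ *] by (auto simp: approximable_def)
  moreover have "(\<lambda>x. indicator (space N) x * indicator {x. a < h x} x) = (indicator B :: 'a \<Rightarrow> complex)"
    by (auto simp: B_def indicator_def)
  ultimately show "{x \<in> space approximable_algebra. a < h x} \<in> sets approximable_algebra"
    by (auto simp: approximable_def B_def)
qed

end

lemma (in prob_space) indicator_integral_complex:
  assumes "A \<in> sets M" shows "(\<integral>x. indicator A x \<partial>M) = complex_of_real (prob A)"
proof -
  have "(\<integral>x. indicator A x \<partial>M) = (\<integral>x. complex_of_real (indicator A x) \<partial>M)"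
    by (rule Bochner_Integration.integral_cong) (auto simp: indicator_def)
  also have "\<dots> = of_real (prob A)" using assms by (simp add: integral_complex_of_real)
  finally show ?thesis .
qed

lemma (in prob_space) integrable_bounded_complex:
  fixes f :: "'a \<Rightarrow> complex"
  assumes "f \<in> borel_measurable M" "\<And>x. x \<in> space M \<Longrightarrow> cmod (f x) \<le> K" shows "integrable M f"
  by (rule integrable_const_bound[of _ K]) (use assms in auto)

section \<open>Trigonometric polynomials over a generating family of real functions\<close>

inductive_set trig :: "('a \<Rightarrow> real) set \<Rightarrow> ('a \<Rightarrow> complex) set" for L where
  monomial: "l \<in> L \<Longrightarrow> (\<lambda>x. c * cis (l x)) \<in> trig L"
| add: "f \<in> trig L \<Longrightarrow> g \<in> trig L \<Longrightarrow> (\<lambda>x. f x + g x) \<in> trig L"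

text \<open>Sums of frequencies make \<open>trig L\<close> stable under products, and real multiples
  are needed to shrink a frequency to 0. The assumption \<open>gen\<close> says that
  \<open>L\<close> generates the sigma-algebra, phrased through arbitrary competitors
  \<open>S\<close> so that the approximable sets can be inserted. The locale is used for functionals
  on the Hilbert space and for linear forms on the plane.\<close>

locale trig_system =
  fixes N :: "'a measure" and L :: "('a \<Rightarrow> real) set"
  assumes meas: "\<And>l. l \<in> L \<Longrightarrow> l \<in> borel_measurable N"
    and plus: "\<And>l l'. l \<in> L \<Longrightarrow> l' \<in> L \<Longrightarrow> (\<lambda>x. l x + l' x) \<in> L"
    and scale: "\<And>l t. l \<in> L \<Longrightarrow> (\<lambda>x. t * l x) \<in> L"
    and nonempty: "L \<noteq> {}"
    and gen: "\<And>S. space S = space N \<Longrightarrow> (\<And>l. l \<in> L \<Longrightarrow> l \<in> borel_measurable S) \<Longrightarrow> sets N \<subseteq> sets S"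
begin

lemma zero_mem: "(\<lambda>x. 0) \<in> L"
  using nonempty scale[of _ 0] by auto

lemma trig_measurable: "f \<in> trig L \<Longrightarrow> f \<in> borel_measurable N"
proof (induction rule: trig.induct)
  case (monomial l c)
  have [measurable]: "l \<in> borel_measurable N" using meas monomial .
  have "continuous_on UNIV cis" by (intro continuous_on_cis continuous_on_id)
  then have [measurable]: "cis \<in> borel_measurable borel" by (rule borel_measurable_continuous_onI)
  show ?case by measurable
qed simp

lemma trig_bounded: "f \<in> trig L \<Longrightarrow> \<exists>K. \<forall>x. cmod (f x) \<le> K"
proof (induction rule: trig.induct)
  case (monomial l c)
  show ?case by (rule exI[of _ "cmod c"]) (simp add: norm_mult)
next
  case (add f g)
  then obtain K K' where "\<forall>x. cmod (f x) \<le> K" "\<forall>x. cmod (g x) \<le> K'" by auto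
  then have "\<forall>x. cmod (f x + g x) \<le> K + K'" by (metis add_mono norm_triangle_le)
  then show ?case by blast
qed

lemma trig_mult: "f \<in> trig L \<Longrightarrow> g \<in> trig L \<Longrightarrow> (\<lambda>x. f x * g x) \<in> trig L"
proof (induction rule: trig.induct)
  case (monomial l c)
  note l = \<open>l \<in> L\<close>
  show ?case using \<open>g \<in> trig L\<close>
  proof (induction rule: trig.induct)
    case (monomial l' c')
    have "(\<lambda>x. c * cis (l x) * (c' * cis (l' x))) = (\<lambda>x. (c * c') * cis (l x + l' x))"
      by (simp add: cis_mult[symmetric] ac_simps)
    then show ?case using trig.monomial[OF plus[OF l \<open>l' \<in> L\<close>], of "c * c'"] by simp
  next
    case (add f g)
    then show ?case using trig.add by (fastforce simp: distrib_left)
  qed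
next
  case (add f f')
  then show ?case using trig.add by (fastforce simp: distrib_right)
qed

text \<open>The functions in \<open>L\<close> are unbounded and so lie outside the closure. They are
  recovered as pointwise limits of (n+1) sin(l/(n+1)), whose sine factors are trigonometric
  polynomials. Hence each \<open>l\<close> is measurable over the approximable sets, and
  \<open>gen\<close> puts every set of \<open>N\<close> among them.\<close>

lemma trig_approx:
  assumes "finite Ms" "\<And>M. M \<in> Ms \<Longrightarrow> prob_space M" "\<And>M. M \<in> Ms \<Longrightarrow> sets M = sets N"
    and B: "B \<in> sets N" and "e > 0"
  obtains f where "f \<in> trig L" "\<And>M. M \<in> Ms \<Longrightarrow> (\<integral>x. cmod (indicator B x - f x) \<partial>M) < e"
proof -
  interpret bounded_function_algebra Ms N "trig L"
  proof (rule bounded_function_algebra.intro)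
    show "(\<lambda>_. c) \<in> trig L" for c
      using trig.monomial[OF zero_mem, of c] by simp
  qed (use assms(1) in \<open>auto simp: assms(3) intro: assms(2) trig_measurable trig_bounded trig_mult trig.add\<close>)
  have "l \<in> borel_measurable approximable_algebra" if l: "l \<in> L" for l
  proof -
    have "(\<lambda>x. complex_of_real (sin (l x / real (Suc n)))) \<in> L1_closure" for n
    proof -
      have a: "(\<lambda>x. (1/(2*\<i>)) * cis ((1/real (Suc n)) * l x)) \<in> trig L"
        by (rule trig.monomial[OF scale[OF l]])
      have b: "(\<lambda>x. (-1/(2*\<i>)) * cis ((-1/real (Suc n)) * l x)) \<in> trig L"
        by (rule trig.monomial[OF scale[OF l]])
      have "(\<lambda>x. (1/(2*\<i>)) * cis ((1/real (Suc n)) * l x) + (-1/(2*\<i>)) * cis ((-1/real (Suc n)) * l x))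
         = (\<lambda>x. complex_of_real (sin (l x / real (Suc n))))"
        by (rule ext) (simp add: complex_eq_iff)
      then show ?thesis using A_subset_closure[OF trig.add[OF a b]] by simp
    qed
    then have m: "(\<lambda>x. real (Suc n) * sin (l x / real (Suc n))) \<in> borel_measurable approximable_algebra" for n
      using borel_measurable_approximable by (intro borel_measurable_times) auto
    show ?thesis
    proof (rule borel_measurable_LIMSEQ_real[OF _ m])
      fix x
      have "((\<lambda>n. n * sin (l x / n)) \<longlongrightarrow> l x) at_top"
      proof (cases "l x = 0")
        case False
        have "((\<lambda>y::real. sin y / y) \<longlongrightarrow> 1) (at 0)"
          using DERIV_sin[of "0::real"] by (simp add: has_field_derivative_iff)
        moreover have "filterlim (\<lambda>n. l x / n) (at 0) at_top"
          unfolding filterlim_at using False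
          by (auto intro!: tendsto_divide_0[OF tendsto_const] filterlim_at_top_imp_at_infinity filterlim_ident
              simp: eventually_at_top_dense intro: exI[of _ 0])
        ultimately have "((\<lambda>n. sin (l x / n) / (l x / n)) \<longlongrightarrow> 1) at_top"
          by (rule filterlim_compose)
        then have "((\<lambda>n. l x * (sin (l x / n) / (l x / n))) \<longlongrightarrow> l x * 1) at_top"
          by (intro tendsto_intros)
        then show ?thesis using False by (simp add: mult.commute)
      qed simp
      then show "(\<lambda>n. real (Suc n) * sin (l x / real (Suc n))) \<longlonglongrightarrow> l x"
        using filterlim_compose[of "\<lambda>n. n * sin (l x / n)" _ _ "\<lambda>n. real (Suc n)" sequentially]
          filterlim_compose[OF filterlim_real_sequentially filterlim_Suc] by blast
    qed
  qed
  then have "sets N \<subseteq> sets approximable_algebra"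
    by (intro gen) auto
  then have "indicator B \<in> L1_closure" using B by (auto simp: approximable_def)
  then show thesis using L1_closure_approx[OF _ \<open>e > 0\<close>] that by blast
qed

text \<open>Uniqueness of characteristic functionals. Integrals of trigonometric polynomials agree
  by linearity, and one polynomial approximates the indicator of \<open>B\<close> under both
  measures simultaneously.\<close>

lemma measure_eqI_cis:
  assumes "prob_space M1" "prob_space M2" "sets M1 = sets N" "sets M2 = sets N"
    and eq: "\<And>l. l \<in> L \<Longrightarrow> (\<integral>x. cis (l x) \<partial>M1) = (\<integral>x. cis (l x) \<partial>M2)"
  shows "M1 = M2"
proof -
  interpret M1: prob_space M1 by fact
  interpret M2: prob_space M2 by fact
  have int: "integrable M f" if f: "f \<in> trig L" and M: "M = M1 \<or> M = M2" for f M
  proof -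
    interpret prob_space M using M assms by auto
    obtain K where "\<forall>x. cmod (f x) \<le> K" using trig_bounded[OF f] by auto
    moreover have "f \<in> borel_measurable M"
      using trig_measurable[OF f] M assms measurable_cong_sets[OF _ refl, of M N] by auto
    ultimately show ?thesis by (intro integrable_const_bound[of _ K]) auto
  qed
  have trig: "(\<integral>x. f x \<partial>M1) = (\<integral>x. f x \<partial>M2)" if "f \<in> trig L" for f
    using that
  proof (induction rule: trig.induct)
    case (add f g)
    then show ?case using int by simp
  qed (use eq in simp)
  have "measure M1 B = measure M2 B" if B: "B \<in> sets N" for B
  proof (rule ccontr)
    assume ne: "measure M1 B \<noteq> measure M2 B"
    define e where "e = \<bar>measure M1 B - measure M2 B\<bar> / 2"
    have "e > 0" using ne by (simp add: e_def)
    obtain f where f: "f \<in> trig L" "\<And>M. M \<in> {M1, M2} \<Longrightarrow> (\<integral>x. cmod (indicator B x - f x) \<partial>M) < e"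
      using trig_approx[of "{M1, M2}" B e] assms B \<open>e > 0\<close> by blast
    have *: "cmod (measure M B - (\<integral>x. f x \<partial>M)) < e" if M: "M = M1 \<or> M = M2" for M
    proof -
      interpret prob_space M using M assms by auto
      have BM: "B \<in> sets M" using B M assms by auto
      have "complex_of_real (measure M B) = (\<integral>x. indicator B x \<partial>M)"
        by (rule indicator_integral_complex[OF BM, symmetric])
      moreover have "integrable M (indicator B :: _ \<Rightarrow> complex)"
        by (rule integrable_const_bound[of _ 1]) (use BM in \<open>auto simp: indicator_def\<close>)
      ultimately have "measure M B - (\<integral>x. f x \<partial>M) = (\<integral>x. indicator B x - f x \<partial>M)"
        using int[OF f(1) M] by simp
      then have "cmod (measure M B - (\<integral>x. f x \<partial>M)) \<le> (\<integral>x. cmod (indicator B x - f x) \<partial>M)"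
        using integral_norm_bound by metis
      then show ?thesis using f(2)[of M] M by auto
    qed
    have "cmod (complex_of_real (measure M1 B) - measure M2 B) 
      \<le> cmod (measure M1 B - (\<integral>x. f x \<partial>M1)) + cmod (measure M2 B - (\<integral>x. f x \<partial>M2))"
      unfolding trig[OF f(1)] by (metis norm_triangle_ineq4 diff_diff_eq2 diff_add_cancel add_diff_eq)
    also have "\<dots> < e + e" using * by (intro add_strict_mono) auto
    finally show False by (simp add: e_def flip: of_real_diff)
  qed
  then show ?thesis using assms
    by (intro measure_eqI) (auto simp: M1.emeasure_eq_measure M2.emeasure_eq_measure)
qed

end

subsection \<open>Herglotz' theorem and the spectral measure of a mixing rigid system\<close>

lemma integral_cis_int:
  fixes m :: int
  shows "(\<integral>t. indicator {-pi..pi} t *\<^sub>R cis (of_int m * t) \<partial>lborel) = (if m = 0 then 2 * pi else 0)"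
proof (cases "m = 0")
  case True
  have "(\<integral>t. indicator {-pi..pi} t *\<^sub>R (1::complex) \<partial>lborel) = complex_of_real (\<integral>t. indicator {-pi..pi} t \<partial>lborel)"
    by (simp add: scaleR_conv_of_real)
  then show ?thesis using True by simp
next
  case False
  define F where "F = (\<lambda>t::real. cis (of_int m * t) / (\<i> * of_int m))"
  have d: "(F has_vector_derivative cis (of_int m * t)) (at t within {-pi..pi})" for t
  proof -
    have "((\<lambda>z. exp (\<i> * of_int m * z) / (\<i> * of_int m)) has_field_derivative exp (\<i> * of_int m * of_real t)) (at (of_real t))"
      using False by (auto intro!: derivative_eq_intros)
    from has_vector_derivative_real_field[OF this]
    show ?thesis by (simp add: F_def cis_conv_exp ac_simps)
  qed
  have "(\<integral>t. indicator {-pi..pi} t *\<^sub>R cis (of_int m * t) \<partial>lborel) = F pi - F (-pi)"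
    by (rule integral_FTC_Icc) (auto intro!: d continuous_on_cis continuous_intros)
  also have "\<dots> = 0"
  proof -
    have "cis (of_int m * pi) = cis (of_int m * (-pi))"
      by (simp add: complex_eq_iff)
         (metis sin_npi_int mult.commute neg_0_equal_iff_equal)
    then show ?thesis by (simp add: F_def)
  qed
  finally show ?thesis using False by simp
qed

lemma integrable_indicator_cis:
  "integrable lborel (\<lambda>t. indicator {-pi..pi} t *\<^sub>R cis (a * t))"
  by (intro borel_integrable_compact[unfolded set_integrable_def] compact_Icc continuous_on_cis continuous_intros)

text \<open>Positive definiteness makes the Fejer means of the series with coefficients
  \<open>c\<close> non-negative, so they are densities of probability measures on [-pi, pi]. A weak
  limit of these has the coefficients \<open>c\<close>, and \<open>cis\<close> carries it to the
  circle.\<close>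

theorem herglotz:
  fixes c :: "int \<Rightarrow> complex"
  assumes c0: "c 0 = 1"
    and pd: "\<And>N u. \<exists>r\<ge>0. (\<Sum>j<N. \<Sum>k<N. u j * cnj (u k) * c (int j - int k)) = complex_of_real r"
  shows "\<exists>\<sigma>. borel_prob_circle \<sigma> \<and> (\<forall>n. fourier_coeff \<sigma> n = c (int n))"
proof -
  \<comment> \<open>The quadratic form of \<open>pd\<close> evaluated at
    \<open>u j = cis (- j t)\<close>, hence non-negative. Dividing it by 2 pi (N+1), as in
    \<open>q\<close>, yields the Fejer mean.\<close>
  define Q where "Q N t = (\<Sum>j<Suc N. \<Sum>k<Suc N. c (int j - int k) * cis (of_int (int k - int j) * t))" for N t
  define q where "q N t = indicator {-pi..pi} t * (Re (Q N t) / (2 * pi * real (Suc N)))" for N t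
  have Q: "\<exists>r\<ge>0. Q N t = complex_of_real r" for N t
  proof -
    have "Q N t = (\<Sum>j<Suc N. \<Sum>k<Suc N. cis (- real j * t) * cnj (cis (- real k * t)) * c (int j - int k))"
      unfolding Q_def by (intro sum.cong refl) (simp add: cis_cnj cis_mult algebra_simps)
    then show ?thesis using pd[of "\<lambda>j. cis (- real j * t)" "Suc N"] by simp
  qed
  have Qre: "complex_of_real (Re (Q N t)) = Q N t" and Qnn: "Re (Q N t) \<ge> 0" for N t
    using Q[of N t] by auto
  have q_nn: "q N t \<ge> 0" for N t using Qnn[of N t] by (simp add: q_def)
  have [measurable]: "Q N \<in> borel_measurable borel" for N
    unfolding Q_def by (intro borel_measurable_continuous_onI continuous_intros continuous_on_cis)
  have [measurable]: "q N \<in> borel_measurable borel" for N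
    unfolding q_def by measurable
  have expand: "q N t *\<^sub>R cis (real n * t) = (\<Sum>j<Suc N. \<Sum>k<Suc N.
      (c (int j - int k) / (2 * pi * real (Suc N))) * (indicator {-pi..pi} t *\<^sub>R cis (of_int (int n + int k - int j) * t)))"
    for N n t
  proof -
    have "q N t *\<^sub>R cis (real n * t) = indicator {-pi..pi} t *\<^sub>R (Q N t / (2 * pi * real (Suc N)) * cis (real n * t))"
      by (simp add: q_def scaleR_conv_of_real Qre)
    also have "\<dots> = (\<Sum>j<Suc N. \<Sum>k<Suc N. indicator {-pi..pi} t *\<^sub>R
        (c (int j - int k) * cis (of_int (int k - int j) * t) / (2 * pi * real (Suc N)) * cis (real n * t)))"
      by (simp only: Q_def sum_divide_distrib sum_distrib_right scaleR_sum_right)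
    also have "\<dots> = (\<Sum>j<Suc N. \<Sum>k<Suc N.
      (c (int j - int k) / (2 * pi * real (Suc N))) * (indicator {-pi..pi} t *\<^sub>R cis (of_int (int n + int k - int j) * t)))"
    proof (intro sum.cong refl)
      fix j k
      have "cis (of_int (int n + int k - int j) * t) = cis (of_int (int k - int j) * t) * cis (real n * t)"
        by (simp add: cis_mult algebra_simps)
      then show "indicator {-pi..pi} t *\<^sub>R
        (c (int j - int k) * cis (of_int (int k - int j) * t) / (2 * pi * real (Suc N)) * cis (real n * t)) =
        (c (int j - int k) / (2 * pi * real (Suc N))) * (indicator {-pi..pi} t *\<^sub>R cis (of_int (int n + int k - int j) * t))"
        by (simp add: scaleR_conv_of_real)
    qed
    finally show ?thesis .
  qed
  have int_q: "integrable lborel (\<lambda>t. q N t *\<^sub>R cis (real n * t))" for N n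
    unfolding expand by (intro Bochner_Integration.integrable_sum integrable_mult_right integrable_indicator_cis)
  \<comment> \<open>Of the pairs (j, k) only those with j = n + k survive the integration, and there
    are N + 1 - n of them. The truncated subtraction gives the correct value 0 when n > N.\<close>
  have fc: "(\<integral>t. q N t *\<^sub>R cis (real n * t) \<partial>lborel) = of_real (real (Suc N - n) / real (Suc N)) * c (int n)" for N n
  proof -
    have "(\<integral>t. q N t *\<^sub>R cis (real n * t) \<partial>lborel) = (\<Sum>j<Suc N. \<Sum>k<Suc N.
      (c (int j - int k) / (2 * pi * real (Suc N))) * (\<integral>t. indicator {-pi..pi} t *\<^sub>R cis (of_int (int n + int k - int j) * t) \<partial>lborel))"
      unfolding expand
      by (subst Bochner_Integration.integral_sum, (intro Bochner_Integration.integrable_sum integrable_mult_right integrable_indicator_cis)[1])+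
         (simp only: integral_mult_right_zero)
    also have "\<dots> = (\<Sum>j<Suc N. \<Sum>k<Suc N. if j = n + k then c (int n) / real (Suc N) else 0)"
    proof (intro sum.cong refl)
      fix j k
      have "int n + int k - int j = 0 \<longleftrightarrow> j = n + k" by auto
      then show "(c (int j - int k) / (2 * pi * real (Suc N))) *
          (\<integral>t. indicator {-pi..pi} t *\<^sub>R cis (of_int (int n + int k - int j) * t) \<partial>lborel)
        = (if j = n + k then c (int n) / real (Suc N) else 0)"
        unfolding integral_cis_int by (auto simp del: of_nat_Suc)
    qed
    also have "\<dots> = (\<Sum>k<Suc N. \<Sum>j<Suc N. if j = n + k then c (int n) / real (Suc N) else 0)"
      by (rule sum.swap)
    also have "\<dots> = (\<Sum>k<Suc N. if n + k < Suc N then c (int n) / real (Suc N) else 0)"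
      by (intro sum.cong refl) (simp add: sum.delta del: of_nat_Suc)
    also have "\<dots> = (\<Sum>k\<in>{..<Suc N - n}. c (int n) / real (Suc N))"
    proof -
      have "{..<Suc N} \<inter> {k. n + k < Suc N} = {..<Suc N - n}" by auto
      then show ?thesis by (subst sum.If_cases) (auto simp del: of_nat_Suc)
    qed
    also have "\<dots> = of_real (real (Suc N - n) / real (Suc N)) * c (int n)"
      by (simp del: of_nat_Suc)
    finally show ?thesis .
  qed
  define \<mu> where "\<mu> N = density lborel (\<lambda>t. ennreal (q N t))" for N
  have em: "(\<integral>\<^sup>+t. ennreal (q N t) \<partial>lborel) = 1" for N
  proof -
    have i: "integrable lborel (q N)"
      using int_q[of N 0, THEN integrable_Re] by simp
    have "complex_of_real (\<integral>t. q N t \<partial>lborel) = (\<integral>t. q N t *\<^sub>R cis (real 0 * t) \<partial>lborel)"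
      by (simp add: scaleR_conv_of_real)
    also have "\<dots> = 1" unfolding fc by (simp add: c0 del: of_nat_Suc)
    finally have "(\<integral>t. q N t \<partial>lborel) = 1" by (simp only: of_real_eq_1_iff)
    then show ?thesis using nn_integral_eq_integral[OF i] q_nn by simp
  qed
  have rd: "real_distribution (\<mu> N)" for N
  proof -
    have "prob_space (\<mu> N)" unfolding \<mu>_def
      by (rule prob_spaceI) (simp add: emeasure_density em)
    then show ?thesis by (simp add: real_distribution_def real_distribution_axioms_def \<mu>_def)
  qed
  have "tight \<mu>" unfolding tight_def
  proof (intro conjI allI impI)
    show "real_distribution (\<mu> n)" for n by (rule rd)
    fix e :: real assume "e > 0"
    \<comment> \<open>Tightness is stated with half-open intervals, so the support [-pi, pi] is
      enclosed using the crude bound pi < 4.\<close>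
    have "measure (\<mu> N) {-4<..4} = 1" for N
    proof -
      interpret real_distribution "\<mu> N" by (rule rd)
      have "emeasure (\<mu> N) {-4<..4} = (\<integral>\<^sup>+t. ennreal (q N t) * indicator {-4<..4} t \<partial>lborel)"
        unfolding \<mu>_def by (subst emeasure_density) auto
      also have "\<dots> = (\<integral>\<^sup>+t. ennreal (q N t) \<partial>lborel)"
        using pi_less_4 by (intro nn_integral_cong) (auto simp: q_def indicator_def)
      finally show ?thesis using em by (simp add: emeasure_eq_measure)
    qed
    then show "\<exists>a b. a < b \<and> (\<forall>n. 1 - e < measure (\<mu> n) {a<..b})"
      using \<open>e > 0\<close> by (intro exI[of _ "-4"] exI[of _ 4]) auto
  qed
  then obtain r M where r: "strict_mono (r :: nat \<Rightarrow> nat)" and M: "real_distribution M" and w: "weak_conv_m (\<mu> \<circ> id \<circ> r) M"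
    using tight_imp_convergent_subsubsequence[of \<mu> id] by (auto simp: strict_mono_id)
  interpret M: real_distribution M by fact
  have char_\<mu>: "char (\<mu> N) (real n) = of_real (real (Suc N - n) / real (Suc N)) * c (int n)" for N n
  proof -
    have "char (\<mu> N) (real n) = (\<integral>t. q N t *\<^sub>R cis (real n * t) \<partial>lborel)"
      unfolding char_def \<mu>_def
      by (subst integral_density) (auto simp: q_nn cis_conv_exp)
    then show ?thesis using fc by simp
  qed
  have char_M: "char M (real n) = c (int n)" for n
  proof (rule LIMSEQ_unique)
    show "(\<lambda>k. char ((\<mu> \<circ> id \<circ> r) k) (real n)) \<longlonglongrightarrow> char M (real n)"
      by (rule levy_continuity1[OF _ M w]) (simp add: rd)
    have "(\<lambda>N. real (Suc N - n) / real (Suc N)) \<longlonglongrightarrow> 1"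
    proof (rule Lim_transform_eventually)
      show "(\<lambda>N. 1 - real n / real (Suc N)) \<longlonglongrightarrow> 1"
        using tendsto_diff[OF tendsto_const LIMSEQ_Suc[OF lim_const_over_n[of "real n"]], of 1]
        by (simp del: of_nat_Suc)
      show "\<forall>\<^sub>F N in sequentially. 1 - real n / real (Suc N) = real (Suc N - n) / real (Suc N)"
        using eventually_ge_at_top[of n]
        by eventually_elim (simp add: of_nat_diff field_simps)
    qed
    then have "(\<lambda>N. char (\<mu> N) (real n)) \<longlonglongrightarrow> of_real 1 * c (int n)"
      unfolding char_\<mu> by (intro tendsto_mult tendsto_of_real tendsto_const)
    from LIMSEQ_subseq_LIMSEQ[OF this r]
    show "(\<lambda>k. char ((\<mu> \<circ> id \<circ> r) k) (real n)) \<longlonglongrightarrow> c (int n)"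
      by (simp add: o_def)
  qed
  have cism: "cis \<in> borel_measurable borel"
    by (intro borel_measurable_continuous_onI continuous_on_cis continuous_on_id)
  have [measurable]: "cis \<in> measurable M (restrict_space borel circle)"
    by (rule measurable_restrict_space2) (use cism in auto)
  \<comment> \<open>The map glues -pi to pi, which is harmless: only integer frequencies are
    tested.\<close>
  define \<sigma> where "\<sigma> = distr M (restrict_space borel circle) cis"
  have "borel_prob_circle \<sigma>"
    unfolding borel_prob_circle_def \<sigma>_def by (auto intro!: M.prob_space_distr)
  moreover have "fourier_coeff \<sigma> n = c (int n)" for n
  proof -
    have "fourier_coeff \<sigma> n = (\<integral>t. cis t ^ n \<partial>M)"
      unfolding fourier_coeff_def \<sigma>_def
      by (rule integral_distr) (auto intro!: measurable_restrict_space1)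
    also have "\<dots> = char M (real n)"
      unfolding char_def by (intro Bochner_Integration.integral_cong) (simp_all add: cis_conv_exp exp_of_nat_mult[symmetric] algebra_simps)
    finally show ?thesis using char_M by simp
  qed
  ultimately show ?thesis by blast
qed

section \<open>Cesaro means on the circle, and the measure attached to a mixing rigid system\<close>

lemma cesaro_unit_circle:
  fixes w :: complex
  assumes "cmod w = 1"
  shows "(\<lambda>N. (\<Sum>n=1..N. w ^ n) / of_nat N) \<longlonglongrightarrow> (if w = 1 then 1 else 0)"
proof (cases "w = 1")
  case True
  have "\<forall>\<^sub>F N in sequentially. (\<Sum>n=1..N. w ^ n) / of_nat N = 1"
    using eventually_gt_at_top[of 0] by eventually_elim (simp add: True)
  then show ?thesis using True by (simp add: tendsto_eventually)
next
  case False
  have bound: "cmod ((\<Sum>n=1..N. w ^ n) / of_nat N) \<le> (2 / cmod (1 - w)) / real N" for N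
  proof -
    have "(1 - w) * (\<Sum>n=1..N. w ^ n) = w - w ^ Suc N"
    proof (induction N)
      case (Suc N)
      have "(1 - w) * (\<Sum>n=1..Suc N. w ^ n) = (1 - w) * (\<Sum>n=1..N. w ^ n) + (w ^ Suc N - w ^ Suc (Suc N))"
        by (simp add: algebra_simps)
      then show ?case using Suc by simp
    qed simp
    then have "(\<Sum>n=1..N. w ^ n) = (w - w ^ Suc N) / (1 - w)"
      using False by (simp add: field_simps)
    moreover have "cmod (w - w ^ Suc N) \<le> 2"
      using norm_triangle_ineq4[of w "w ^ Suc N"] assms by (simp add: norm_mult norm_power)
    ultimately have "cmod (\<Sum>n=1..N. w ^ n) \<le> 2 / cmod (1 - w)"
      by (simp add: norm_divide divide_right_mono)
    from divide_right_mono[OF this, of "real N"]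
    show ?thesis by (simp add: norm_divide)
  qed
  have "(\<lambda>N. (\<Sum>n=1..N. w ^ n) / of_nat N) \<longlonglongrightarrow> 0"
    by (rule Lim_null_comparison[OF _ lim_const_over_n[of "2 / cmod (1 - w)"]])
       (use bound in auto)
  then show ?thesis using False by simp
qed

lemma cmod_cesaro_le:
  assumes "\<And>n. cmod (w n) \<le> 1"
  shows "cmod ((\<Sum>n=1..N. w n) / of_nat N) \<le> 1"
proof (cases "N = 0")
  case False
  have "cmod (\<Sum>n=1..N. w n) \<le> (\<Sum>n=1..N. 1)"
    by (rule sum_norm_le) (use assms in auto)
  then show ?thesis using False by (simp add: norm_divide)
qed simp

lemma measure_preserving_funpow:
  assumes "measure_preserving_map m T"
  shows "T ^^ n \<in> measurable m m" "distr m m (T ^^ n) = m"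
proof (induction n)
  case 0
  have "distr m m (\<lambda>x. x) = m" by (rule distr_id2) simp
  then show "T ^^ 0 \<in> measurable m m" "distr m m (T ^^ 0) = m" by (auto simp: id_def)
next
  case (Suc n)
  have T: "T \<in> measurable m m" "distr m m T = m" using assms by (auto simp: measure_preserving_map_def)
  show "T ^^ Suc n \<in> measurable m m" using measurable_comp[OF Suc(1) T(1)] by simp
  show "distr m m (T ^^ Suc n) = m" using distr_distr[OF T(1) Suc(1)] T Suc by simp
qed

lemma integral_measure_preserving:
  fixes f :: "'a \<Rightarrow> 'b::{banach, second_countable_topology}"
  assumes "measure_preserving_map m T" "f \<in> borel_measurable m"
  shows "(\<integral>x. f ((T ^^ n) x) \<partial>m) = (\<integral>x. f x \<partial>m)"
  using integral_distr[OF measure_preserving_funpow(1)[OF assms(1)] assms(2)]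
    measure_preserving_funpow(2)[OF assms(1)] by metis

theorem weakly_mixing_rigid_imp_measure:
  assumes "prob_space m" and wm: "weakly_mixing m T" and rg: "rigid_wrt m T nk"
    and A[measurable]: "A \<in> sets m" and A0: "0 < measure m A" and A1: "measure m A < 1"
  shows "\<exists>\<sigma>. borel_prob_circle \<sigma> \<and> continuous_measure \<sigma> \<and> (\<lambda>k. fourier_coeff \<sigma> (nk k)) \<longlonglongrightarrow> 1"
proof -
  interpret prob_space m by fact
  have mp: "measure_preserving_map m T" using wm by (simp add: weakly_mixing_def)
  have [measurable]: "T ^^ n \<in> measurable m m" for n using measure_preserving_funpow[OF mp] by blast
  define a where "a = measure m A"
  \<comment> \<open>The variance of the indicator of \<open>A\<close>, positive because 0 < m(A) <
    1. Dividing the correlations by it normalises the zeroth coefficient to 1.\<close>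
  define v where "v = a - a\<^sup>2"
  have v: "v > 0"
    using A0 A1 unfolding v_def a_def by (simp add: power2_eq_square)
  define f where "f x = indicator A x - a" for x
  have [measurable]: "f \<in> borel_measurable m" unfolding f_def by measurable
  have fb: "\<bar>f x\<bar> \<le> 1" for x using A0 A1 by (auto simp: f_def a_def indicator_def)
  define r where "r n = measure m ((T ^^ n) -` A \<inter> space m \<inter> A) - a\<^sup>2" for n
  define g where "g j x = f ((T ^^ j) x)" for j x
  have [measurable]: "g j \<in> borel_measurable m" for j unfolding g_def by measurable
  have gb: "\<bar>g j x\<bar> \<le> 1" for j x unfolding g_def by (rule fb)
  have intgg: "integrable m (\<lambda>x. g j x * g k x)" for j k
    by (rule integrable_const_bound[of _ 1]) (auto simp: abs_mult intro!: mult_le_one gb)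
  have r: "(\<integral>x. g n x * g 0 x \<partial>m) = r n" for n
  proof -
    let ?B = "(T ^^ n) -` A \<inter> space m"
    have B[measurable]: "?B \<in> sets m" by measurable
    have mB: "measure m ?B = a"
    proof -
      have "measure m ?B = measure (distr m m (T ^^ n)) A" by (simp add: measure_distr)
      then show ?thesis using measure_preserving_funpow(2)[OF mp] by (simp add: a_def)
    qed
    have "(\<integral>x. g n x * g 0 x \<partial>m) = (\<integral>x. indicator (?B \<inter> A) x - a * indicator ?B x - a * indicator A x + a\<^sup>2 \<partial>m)"
      by (rule Bochner_Integration.integral_cong)
         (auto simp: g_def f_def indicator_def algebra_simps power2_eq_square)
    also have "\<dots> = r n"
    proof -
      have i: "integrable m (indicator C :: _ \<Rightarrow> real)" if "C \<in> sets m" for C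
        using that by (simp add: integrable_real_indicator emeasure_eq_measure)
      note [simp] = i[OF B] i[OF A] i[OF sets.Int[OF B A]]
      have "(\<integral>x. indicator (?B \<inter> A) x - a * indicator ?B x - a * indicator A x + a\<^sup>2 \<partial>m)
          = measure m (?B \<inter> A) - a * measure m ?B - a * measure m A + a\<^sup>2"
        using B A by (simp add: prob_space)
      then show ?thesis by (simp add: mB r_def power2_eq_square flip: a_def)
    qed
    finally show ?thesis .
  qed
  \<comment> \<open>Invariance cancels the common iterates, and the symmetry of the product accounts
    for the absolute value.\<close>
  have ggr: "(\<integral>x. g j x * g k x \<partial>m) = r (nat \<bar>int j - int k\<bar>)" for j k
  proof -
    have *: "(\<integral>x. g (n + k) x * g k x \<partial>m) = r n" for n k
    proof -
      have "(\<integral>x. g (n + k) x * g k x \<partial>m) = (\<integral>x. g n ((T ^^ k) x) * g 0 ((T ^^ k) x) \<partial>m)"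
        by (simp add: g_def funpow_add)
      also have "\<dots> = (\<integral>x. g n x * g 0 x \<partial>m)"
        by (rule integral_measure_preserving[OF mp]) measurable
      finally show ?thesis using r by simp
    qed
    show ?thesis
    proof (cases "k \<le> j")
      case True
      then show ?thesis using *[of "j - k" k] by (simp add: nat_diff_distrib)
    next
      case False
      then show ?thesis using *[of "k - j" j] by (simp add: nat_diff_distrib mult.commute)
    qed
  qed
  define c where "c i = complex_of_real (r (nat \<bar>i\<bar>) / v)" for i
  have r0: "r 0 = v" by (simp add: r_def v_def a_def sets.sets_into_space Int_absorb1)
  have "c 0 = 1" using v by (simp add: c_def r0)
  moreover have "\<exists>s\<ge>0. (\<Sum>j<N. \<Sum>k<N. u j * cnj (u k) * c (int j - int k)) = complex_of_real s" for N u
  proof (intro exI conjI)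
    \<comment> \<open>Up to the factor 1/v, the form is the squared L2(m) norm of the combination of
      the \<open>g j\<close> with coefficients \<open>u j\<close>.\<close>
    let ?s = "(\<integral>x. (cmod (\<Sum>j<N. u j * of_real (g j x)))\<^sup>2 \<partial>m)"
    show "?s / v \<ge> 0" using v by simp
    have "complex_of_real ?s = (\<integral>x. (\<Sum>j<N. u j * of_real (g j x)) * cnj (\<Sum>j<N. u j * of_real (g j x)) \<partial>m)"
      by (simp only: complex_norm_square[symmetric] integral_complex_of_real)
    also have "\<dots> = (\<integral>x. (\<Sum>j<N. \<Sum>k<N. (u j * cnj (u k)) * complex_of_real (g j x * g k x)) \<partial>m)"
      by (intro Bochner_Integration.integral_cong refl)
         (simp add: sum_product cnj_sum ac_simps)
    also have "\<dots> = (\<Sum>j<N. \<Sum>k<N. \<integral>x. (u j * cnj (u k)) * complex_of_real (g j x * g k x) \<partial>m)"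
      by (subst Bochner_Integration.integral_sum,
          (intro Bochner_Integration.integrable_sum integrable_mult_right integrable_of_real intgg)[1])+ simp
    also have "\<dots> = (\<Sum>j<N. \<Sum>k<N. (u j * cnj (u k)) * complex_of_real (r (nat \<bar>int j - int k\<bar>)))"
      by (simp only: integral_mult_right_zero integral_complex_of_real ggr)
    finally have "complex_of_real ?s = (\<Sum>j<N. \<Sum>k<N. (u j * cnj (u k)) * complex_of_real (r (nat \<bar>int j - int k\<bar>)))" .
    then have "complex_of_real (?s / v) = (\<Sum>j<N. \<Sum>k<N. (u j * cnj (u k)) * complex_of_real (r (nat \<bar>int j - int k\<bar>))) / of_real v"
      by simp
    then show "(\<Sum>j<N. \<Sum>k<N. u j * cnj (u k) * c (int j - int k)) = complex_of_real (?s / v)"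
      by (simp add: c_def sum_divide_distrib)
  qed
  ultimately obtain \<sigma> where \<sigma>: "borel_prob_circle \<sigma>" "\<And>n. fourier_coeff \<sigma> n = c (int n)"
    using herglotz[of c] by blast
  interpret S: prob_space \<sigma> using \<sigma>(1) by (simp add: borel_prob_circle_def)
  have sets\<sigma>: "sets \<sigma> = sets (restrict_space borel circle)" using \<sigma>(1) by (simp add: borel_prob_circle_def)
  then have sp: "space \<sigma> = circle" using sets_eq_imp_space_eq[of \<sigma>] by (simp add: space_restrict_space)
  have idm[measurable]: "(\<lambda>z. z) \<in> borel_measurable \<sigma>"
    unfolding measurable_cong_sets[OF sets\<sigma> refl] by (intro measurable_restrict_space1) simp
  have "emeasure \<sigma> {l} = 0" for l
  proof (cases "l \<in> circle")
    case False
    \<comment> \<open>Outside the circle the singleton is not measurable, and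
      \<open>emeasure\<close> takes its default value 0.\<close>
    then have "{l} \<notin> sets \<sigma>" using sp sets.sets_into_space by blast
    then show ?thesis by (rule emeasure_notin_sets)
  next
    case True
    then have l1: "cmod l = 1" by simp
    have l: "{l} \<in> sets \<sigma>" unfolding sets\<sigma> using True by (auto simp: sets_restrict_space_iff)
    \<comment> \<open>The mass of an atom is the limit of the Cesaro means of the Fourier
      coefficients rotated by \<open>cnj l\<close>. Weak mixing makes the Cesaro means of their
      absolute values vanish, whatever \<open>l\<close> is.\<close>
    have "(\<lambda>N. \<integral>z. (\<Sum>n=1..N. (z * cnj l) ^ n) / of_nat N \<partial>\<sigma>) \<longlonglongrightarrow> (\<integral>z. complex_of_real (indicator {l} z) \<partial>\<sigma>)"
    proof (rule integral_dominated_convergence[where w="\<lambda>_. 1"])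
      show "AE z in \<sigma>. (\<lambda>N. (\<Sum>n=1..N. (z * cnj l) ^ n) / of_nat N) \<longlonglongrightarrow> complex_of_real (indicator {l} z)"
      proof (rule AE_I2)
        fix z assume "z \<in> space \<sigma>"
        then have z: "cmod z = 1" using sp by simp
        have "z * cnj l = 1 \<longleftrightarrow> z = l"
        proof
          assume "z * cnj l = 1"
          then have "z * (l * cnj l) = l" by (simp add: algebra_simps)
          then show "z = l" using l1 by (simp add: complex_norm_square[symmetric])
        next
          assume "z = l"
          then show "z * cnj l = 1" using l1 by (simp add: complex_norm_square[symmetric])
        qed
        then show "(\<lambda>N. (\<Sum>n=1..N. (z * cnj l) ^ n) / of_nat N) \<longlonglongrightarrow> complex_of_real (indicator {l} z)"
          using cesaro_unit_circle[of "z * cnj l"] z l1 by (auto simp: norm_mult indicator_def)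
      qed
      show "AE z in \<sigma>. norm ((\<Sum>n=1..N. (z * cnj l) ^ n) / of_nat N) \<le> 1" for N
        using sp l1 by (intro AE_I2 cmod_cesaro_le) (simp add: norm_power norm_mult)
    qed (use l in auto)
    also have "(\<integral>z. complex_of_real (indicator {l} z) \<partial>\<sigma>) = measure \<sigma> {l}"
      using l by (simp add: integral_complex_of_real)
    also have "(\<lambda>N. \<integral>z. (\<Sum>n=1..N. (z * cnj l) ^ n) / of_nat N \<partial>\<sigma>) = (\<lambda>N. (\<Sum>n=1..N. c (int n) * cnj l ^ n) / of_nat N)"
    proof
      fix N
      have "integrable \<sigma> (\<lambda>z. z ^ n)" for n
        by (rule S.integrable_const_bound[of _ 1]) (use sp in \<open>auto simp: norm_power\<close>)
      then show "(\<integral>z. (\<Sum>n=1..N. (z * cnj l) ^ n) / of_nat N \<partial>\<sigma>) = (\<Sum>n=1..N. c (int n) * cnj l ^ n) / of_nat N"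
        by (simp add: power_mult_distrib \<sigma>(2)[symmetric] fourier_coeff_def)
    qed
    finally have lim: "(\<lambda>N. (\<Sum>n=1..N. c (int n) * cnj l ^ n) / of_nat N) \<longlonglongrightarrow> measure \<sigma> {l}" .
    have "(\<lambda>N. (\<Sum>n=1..N. c (int n) * cnj l ^ n) / of_nat N) \<longlonglongrightarrow> 0"
    proof (rule Lim_null_comparison)
      have "(\<lambda>N. (1 / v) * ((1 / real N) * (\<Sum>n=1..N. \<bar>r n\<bar>))) \<longlonglongrightarrow> (1 / v) * 0"
        using wm A by (intro tendsto_mult tendsto_const) (auto simp: weakly_mixing_def r_def a_def power2_eq_square)
      then show "(\<lambda>N. (1 / v) * ((1 / real N) * (\<Sum>n=1..N. \<bar>r n\<bar>))) \<longlonglongrightarrow> 0" by simp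
      show "\<forall>\<^sub>F N in sequentially. norm ((\<Sum>n=1..N. c (int n) * cnj l ^ n) / of_nat N) \<le> (1 / v) * ((1 / real N) * (\<Sum>n=1..N. \<bar>r n\<bar>))"
      proof (rule always_eventually, rule allI)
        fix N
        have "norm (\<Sum>n=1..N. c (int n) * cnj l ^ n) \<le> (\<Sum>n=1..N. \<bar>r n\<bar> / v)"
          by (rule sum_norm_le) (use v l1 in \<open>simp add: c_def norm_mult norm_power norm_divide\<close>)
        then have "norm (\<Sum>n=1..N. c (int n) * cnj l ^ n) / real N \<le> (\<Sum>n=1..N. \<bar>r n\<bar> / v) / real N"
          by (rule divide_right_mono) simp
        then show "norm ((\<Sum>n=1..N. c (int n) * cnj l ^ n) / of_nat N) \<le> (1 / v) * ((1 / real N) * (\<Sum>n=1..N. \<bar>r n\<bar>))"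
          by (simp add: norm_divide sum_divide_distrib[symmetric] mult.commute)
      qed
    qed
    then have "complex_of_real (measure \<sigma> {l}) = 0" by (rule LIMSEQ_unique[OF lim])
    then have "measure \<sigma> {l} = 0" by (simp only: of_real_eq_0_iff)
    then show ?thesis by (simp add: S.emeasure_eq_measure)
  qed
  then have "continuous_measure \<sigma>" by (simp add: continuous_measure_def)
  moreover have "(\<lambda>k. fourier_coeff \<sigma> (nk k)) \<longlonglongrightarrow> 1"
  proof -
    let ?D = "\<lambda>k. measure m ((((T ^^ nk k) -` A \<inter> space m) - A) \<union> (A - (T ^^ nk k) -` A))"
    have D: "?D \<longlonglongrightarrow> 0" using rg A by (auto simp: rigid_wrt_def)
    \<comment> \<open>With B the preimage of A under the iterate, r - v = m(B \<inter> A) - m(A) = -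
      m(A - B), which is bounded by the mass of the symmetric difference.\<close>
    have "(\<lambda>k. r (nk k) - v) \<longlonglongrightarrow> 0"
    proof (rule Lim_null_comparison[OF _ D], rule always_eventually, rule allI)
      fix k
      let ?B = "(T ^^ nk k) -` A \<inter> space m"
      have B[measurable]: "?B \<in> sets m" by measurable
      have AB: "A - (T ^^ nk k) -` A = A - ?B" using sets.sets_into_space[OF A] by auto
      have "a = measure m (?B \<inter> A) + measure m (A - ?B)"
      proof -
        have "measure m ((?B \<inter> A) \<union> (A - ?B)) = measure m (?B \<inter> A) + measure m (A - ?B)"
          by (rule finite_measure_Union) (use A B in auto)
        moreover have "(?B \<inter> A) \<union> (A - ?B) = A" by auto
        ultimately show ?thesis by (simp add: a_def)
      qed
      moreover have "measure m (A - ?B) \<le> ?D k"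
        unfolding AB by (rule finite_measure_mono) auto
      ultimately show "norm (r (nk k) - v) \<le> ?D k"
        by (simp add: r_def v_def)
    qed
    then have "(\<lambda>k. (r (nk k) - v) / v + 1) \<longlonglongrightarrow> 0 / v + 1"
      using v by (intro tendsto_intros) auto
    then have "(\<lambda>k. r (nk k) / v) \<longlonglongrightarrow> 1"
      using v by (simp add: diff_divide_distrib)
    then have "(\<lambda>k. complex_of_real (r (nk k) / v)) \<longlonglongrightarrow> of_real 1" by (rule tendsto_of_real)
    then show ?thesis by (simp add: \<sigma>(2) c_def)
  qed
  ultimately show ?thesis using \<sigma>(1) by blast
qed

subsection \<open>Orthonormal systems in complex inner product spaces\<close>

text \<open>The form may be degenerate, so that one Gram-Schmidt process serves both
  \<open>cinner\<close> and the L2(\<open>\<sigma>\<close>) form on polynomials. As for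
  \<open>cinner\<close>, the first argument is the conjugate-linear one.\<close>

locale semi_inner =
  fixes scale :: "complex \<Rightarrow> 'v::ab_group_add \<Rightarrow> 'v" and ip :: "'v \<Rightarrow> 'v \<Rightarrow> complex"
  assumes add_left: "ip (x + y) z = ip x z + ip y z"
    and scale_left: "ip (scale a x) y = cnj a * ip x y"
    and commute: "ip x y = cnj (ip y x)"
    and nonneg: "0 \<le> Re (ip x x)"
begin

lemma add_right: "ip x (y + z) = ip x y + ip x z"
  by (metis add_left commute complex_cnj_add)

lemma scale_right: "ip x (scale a y) = a * ip x y"
  by (metis scale_left commute complex_cnj_mult complex_cnj_cnj)

lemma zero_right [simp]: "ip x 0 = 0"
  using add_right[of x 0 0] by simp

lemma diff_right: "ip x (y - z) = ip x y - ip x z"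
  using add_right[of x "y - z" z] by (simp add: algebra_simps)

lemma diff_left: "ip (y - z) x = ip y x - ip z x"
  using add_left[of "y - z" z x] by (simp add: algebra_simps)

lemma sum_right: "ip x (sum f A) = (\<Sum>a\<in>A. ip x (f a))"
  by (induction A rule: infinite_finite_induct) (auto simp: add_right)

lemma self_real: "ip x x = complex_of_real (Re (ip x x))"
  using commute[of x x] by (simp add: complex_eq_iff)

lemma null_right:
  assumes "ip x x = 0" shows "ip x y = 0"
proof (rule ccontr)
  assume c: "ip x y \<noteq> 0"
  define c where "c = ip x y"
  \<comment> \<open>Subtracting t c x from y changes the squared norm only through the cross terms,
    because x is null. This \<open>t\<close> is tuned to make the result -1.\<close>
  define t where "t = (Re (ip y y) + 1) / (2 * (cmod c)\<^sup>2)"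
  let ?z = "y - scale (of_real t * c) x"
  have yx: "ip y x = cnj c" using commute[of y x] by (simp add: c_def)
  have "ip ?z ?z = ip y y - 2 * of_real t * (c * cnj c)"
    using assms by (simp add: diff_left diff_right scale_left scale_right yx c_def[symmetric] algebra_simps)
  also have "c * cnj c = of_real ((cmod c)\<^sup>2)" by (simp add: complex_norm_square[symmetric])
  finally have "Re (ip ?z ?z) = Re (ip y y) - 2 * t * (cmod c)\<^sup>2" by simp
  also have "\<dots> = -1" using c by (simp add: t_def c_def field_simps)
  finally show False using nonneg[of ?z] by simp
qed

lemma null_left: "ip x x = 0 \<Longrightarrow> ip y x = 0"
  using null_right commute by (metis complex_cnj_zero)

text \<open>Gram-Schmidt. Degenerate vectors are mapped to 0 by \<open>1 / 0 = 0\<close>, so no independence is needed.\<close>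
function gs :: "(nat \<Rightarrow> 'v) \<Rightarrow> nat \<Rightarrow> 'v" where
  "gs d n = (let w = d n - (\<Sum>k<n. scale (ip (gs d k) (d n)) (gs d k))
             in scale (1 / of_real (sqrt (Re (ip w w)))) w)"
  by pat_completeness auto
termination by (relation "Wellfounded.measure snd") auto

declare gs.simps [simp del]

text \<open>The three claims need each other in the induction: orthogonality of the remainder uses
  the squared norms 0 or 1 of the earlier vectors. In a degenerate form \<open>d n\<close> equals
  its expansion only up to a null vector, so the expansion is stated after pairing with an arbitrary
  \<open>x\<close>.\<close>

lemma gs_props:
  "(\<forall>j<n. ip (gs d j) (gs d n) = 0) \<and> (ip (gs d n) (gs d n) = 0 \<or> ip (gs d n) (gs d n) = 1) \<and>
   (\<forall>x. ip x (d n) = (\<Sum>k\<le>n. ip (gs d k) (d n) * ip x (gs d k)))"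
proof (induction n rule: less_induct)
  case (less n)
  define w where "w = d n - (\<Sum>k<n. scale (ip (gs d k) (d n)) (gs d k))"
  define s where "s = sqrt (Re (ip w w))"
  have gsn: "gs d n = scale (1 / of_real s) w"
    by (subst gs.simps) (simp add: w_def s_def Let_def)
  have orth: "ip (gs d j) (gs d k) = 0" if "j < n" "k < n" "j \<noteq> k" for j k
  proof (cases "j < k")
    case True then show ?thesis using less that by blast
  next
    case False
    then have "ip (gs d k) (gs d j) = 0" using less that by (metis nat_neq_iff)
    then show ?thesis using commute by (metis complex_cnj_zero)
  qed
  have jw: "ip (gs d j) w = 0" if j: "j < n" for j
  proof -
    have "(\<Sum>k<n. ip (gs d k) (d n) * ip (gs d j) (gs d k)) = (\<Sum>k<n. if k = j then ip (gs d j) (d n) * ip (gs d j) (gs d j) else 0)"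
      by (rule sum.cong) (use orth j in auto)
    also have "\<dots> = ip (gs d j) (d n) * ip (gs d j) (gs d j)" using j by simp
    \<comment> \<open>Either \<open>gs d j\<close> is normalised, or it is a null vector and both
      sides vanish.\<close>
    also have "\<dots> = ip (gs d j) (d n)"
      using less[OF j] null_right[of "gs d j"] by auto
    finally show ?thesis by (simp add: w_def diff_right sum_right scale_right)
  qed
  have 1: "\<forall>j<n. ip (gs d j) (gs d n) = 0" by (simp add: gsn scale_right jw)
  have ww: "ip w w = of_real (s\<^sup>2)" using self_real[of w] nonneg[of w] by (simp add: s_def)
  have gg: "ip (gs d n) (gs d n) = of_real (s\<^sup>2 / s\<^sup>2)"
    by (simp add: gsn scale_left scale_right ww power2_eq_square)
  then have 2: "ip (gs d n) (gs d n) = 0 \<or> ip (gs d n) (gs d n) = 1" by (cases "s = 0") auto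
  have gd: "ip (gs d n) (d n) = of_real s"
  proof -
    have "d n = w + (\<Sum>k<n. scale (ip (gs d k) (d n)) (gs d k))" by (simp add: w_def)
    then have "ip (gs d n) (d n) = ip (gs d n) w + (\<Sum>k<n. ip (gs d k) (d n) * ip (gs d n) (gs d k))"
      by (metis (no_types, lifting) add_right sum_right scale_right sum.cong)
    also have "(\<Sum>k<n. ip (gs d k) (d n) * ip (gs d n) (gs d k)) = 0"
      by (rule sum.neutral) (use 1 commute in \<open>metis complex_cnj_zero lessThan_iff mult_zero_right\<close>)
    finally show ?thesis by (simp add: gsn scale_left ww power2_eq_square)
  qed
  have 3: "ip x (d n) = (\<Sum>k\<le>n. ip (gs d k) (d n) * ip x (gs d k))" for x
  proof -
    have "ip x w = of_real s * ip x (gs d n)"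
      using null_left[of w x] ww by (cases "s = 0") (auto simp: gsn scale_right)
    moreover have "ip x w = ip x (d n) - (\<Sum>k<n. ip (gs d k) (d n) * ip x (gs d k))"
      by (simp add: w_def diff_right sum_right scale_right)
    ultimately show ?thesis by (simp add: lessThan_Suc_atMost[symmetric] gd algebra_simps)
  qed
  show ?case using 1 2 3 by blast
qed

lemma gs_orthogonal: "j \<noteq> k \<Longrightarrow> ip (gs d j) (gs d k) = 0"
  using gs_props commute by (metis complex_cnj_zero nat_neq_iff)

lemma gs_self: "ip (gs d n) (gs d n) = 0 \<or> ip (gs d n) (gs d n) = 1"
  using gs_props by blast

lemma gs_expand: "ip x (d n) = (\<Sum>k\<le>n. ip (gs d k) (d n) * ip x (gs d k))"
  using gs_props by blast

lemma gs_upper: "n < k \<Longrightarrow> ip (gs d k) (d n) = 0"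
  by (subst gs_expand) (auto intro!: sum.neutral gs_orthogonal)

lemma gs_mem:
  assumes "\<And>k. d k \<in> S" "\<And>x y. x \<in> S \<Longrightarrow> y \<in> S \<Longrightarrow> x - y \<in> S" "\<And>c x. x \<in> S \<Longrightarrow> scale c x \<in> S"
  shows "gs d n \<in> S"
proof (induction n rule: less_induct)
  case (less n)
  have z: "0 \<in> S" using assms(2)[OF assms(1) assms(1), of 0 0] by simp
  have p: "x + y \<in> S" if "x \<in> S" "y \<in> S" for x y
    using assms(2)[OF that(1) assms(2)[OF z that(2)]] by simp
  have "(\<Sum>k<m. scale (ip (gs d k) (d n)) (gs d k)) \<in> S" if "m \<le> n" for m
    using that by (induction m) (auto intro!: z p assms(3) less)
  then show ?case by (subst gs.simps) (auto simp: Let_def intro!: assms)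
qed

end

section \<open>Orthogonal expansions in complex Hilbert spaces\<close>

lemma cinner_semi_inner: "semi_inner scaleC (cinner :: 'a::complex_inner \<Rightarrow> 'a \<Rightarrow> complex)"
  by unfold_locales (auto simp: cinner_add_left cinner_scaleC_left cinner_self_norm intro: cinner_commute)

interpretation cinner: semi_inner scaleC "cinner :: 'a::complex_inner \<Rightarrow> 'a \<Rightarrow> complex"
  by (rule cinner_semi_inner)

lemma cinner_eq_zero_iff [simp]: "cinner x x = 0 \<longleftrightarrow> x = (0::'a::complex_inner)"
  by (simp add: cinner_self_norm)

lemma cinner_zero_left [simp]: "cinner 0 x = 0"
  by (rule cinner.null_right) simp

lemma norm_scaleC [simp]: "norm (scaleC a (x::'a::complex_inner)) = cmod a * norm x"
proof -
  have "complex_of_real ((norm (scaleC a x))\<^sup>2) = of_real ((cmod a * norm x)\<^sup>2)"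
    unfolding cinner_self_norm[symmetric] cinner_scaleC_left cinner.scale_right
    by (simp only: cinner_self_norm power_mult_distrib of_real_mult complex_norm_square mult.assoc mult.left_commute)
  then have "(norm (scaleC a x))\<^sup>2 = (cmod a * norm x)\<^sup>2" by (simp only: of_real_eq_iff)
  then show ?thesis by (simp add: power2_eq_iff_nonneg)
qed

lemma scaleC_zero_left [simp]: "scaleC 0 (x::'a::complex_inner) = 0"
  by (metis norm_scaleC norm_eq_zero mult_zero_left norm_zero)

lemma scaleC_zero_right [simp]: "scaleC a (0::'a::complex_inner) = 0"
  by (metis norm_scaleC norm_eq_zero mult_zero_right norm_zero)

lemma scaleC_diff_right: "scaleC a (x - y::'a::complex_inner) = scaleC a x - scaleC a y"
  by (metis scaleC_add_right diff_add_cancel add_diff_cancel)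

lemma norm_sum_orthogonal:
  fixes f :: "nat \<Rightarrow> 'a::complex_inner"
  assumes "finite A" "\<And>i j. i \<in> A \<Longrightarrow> j \<in> A \<Longrightarrow> i \<noteq> j \<Longrightarrow> cinner (f i) (f j) = 0"
  shows "(norm (sum f A))\<^sup>2 = (\<Sum>i\<in>A. (norm (f i))\<^sup>2)"
  using assms
proof (induction A rule: finite_induct)
  case (insert a A)
  have 0: "cinner (f a) (sum f A) = 0" unfolding cinner.sum_right
    by (rule sum.neutral) (use insert in auto)
  then have 1: "cinner (sum f A) (f a) = 0" using cinner_commute by (metis complex_cnj_zero)
  have "complex_of_real ((norm (f a + sum f A))\<^sup>2) = complex_of_real ((norm (f a))\<^sup>2 + (norm (sum f A))\<^sup>2)"
    by (simp only: cinner_self_norm[symmetric] cinner.add_left cinner.add_right 0 1 of_real_add) simp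
  then have "(norm (f a + sum f A))\<^sup>2 = (norm (f a))\<^sup>2 + (norm (sum f A))\<^sup>2"
    by (simp only: of_real_eq_iff)
  then show ?case using insert by simp
qed simp

lemma Cauchy_Schwarz_cinner: "cmod (cinner x y) \<le> norm x * norm (y::'a::complex_inner)"
proof (cases "x = 0")
  case False
  define c where "c = cinner x y / of_real ((norm x)\<^sup>2)"
  define f where "f = (\<lambda>n::nat. if n = 0 then scaleC c x else y - scaleC c x)"
  have xx: "cinner x x = of_real ((norm x)\<^sup>2)" by (rule cinner_self_norm)
  have o: "cinner x (y - scaleC c x) = 0"
    unfolding cinner.diff_right cinner.scale_right c_def xx using False by simp
  then have o': "cinner (y - scaleC c x) x = 0" using cinner_commute by (metis complex_cnj_zero)
  have "(norm (sum f {0, 1}))\<^sup>2 = (\<Sum>i\<in>{0,1}. (norm (f i))\<^sup>2)"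
    by (rule norm_sum_orthogonal) (auto simp: f_def cinner_scaleC_left cinner.scale_right o o')
  then have "(norm y)\<^sup>2 = (cmod c * norm x)\<^sup>2 + (norm (y - scaleC c x))\<^sup>2" by (simp add: f_def)
  then have "(cmod c * norm x)\<^sup>2 \<le> (norm y)\<^sup>2" by simp
  then have "cmod c * norm x \<le> norm y" by (rule power2_le_imp_le) simp
  then have "cmod c * norm x * norm x \<le> norm y * norm x" by (rule mult_right_mono) simp
  moreover have "cmod c * norm x * norm x = cmod (cinner x y)"
    using False by (simp add: c_def norm_divide norm_mult power2_eq_square norm_power)
  ultimately show ?thesis by (simp add: mult.commute)
qed simp

lemma bounded_linear_cinner_right: "bounded_linear (cinner (x::'a::complex_inner))"
  by (rule bounded_linear_intro[where K="norm x"])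
     (auto simp: cinner.add_right scaleR_scaleC cinner.scale_right scaleR_conv_of_real
       Cauchy_Schwarz_cinner[of x, unfolded mult.commute[of "norm x"]])

subclass (in complex_hilbert) banach ..

locale orthogonal_system =
  fixes u :: "nat \<Rightarrow> 'h::complex_hilbert"
  assumes orth: "j \<noteq> k \<Longrightarrow> cinner (u j) (u k) = 0"
    and self: "cinner (u k) (u k) = 0 \<or> cinner (u k) (u k) = 1"
begin

lemma norm_u_le: "norm (u k) \<le> 1"
  using self[of k] by (auto simp: cinner_self_norm power2_eq_1_iff simp flip: of_real_power)

lemma self_cases: "u k = 0 \<or> cinner (u k) (u k) = 1"
  using self[of k] by simp

lemma norm_sum_le:
  assumes "finite A" shows "(norm (\<Sum>k\<in>A. scaleC (c k) (u k)))\<^sup>2 \<le> (\<Sum>k\<in>A. (cmod (c k))\<^sup>2)"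
proof -
  have "(norm (\<Sum>k\<in>A. scaleC (c k) (u k)))\<^sup>2 = (\<Sum>k\<in>A. (norm (scaleC (c k) (u k)))\<^sup>2)"
    by (rule norm_sum_orthogonal[OF assms]) (simp add: cinner_scaleC_left cinner.scale_right orth)
  also have "\<dots> \<le> (\<Sum>k\<in>A. (cmod (c k))\<^sup>2)"
    by (intro sum_mono power_mono) (auto intro: mult_left_le norm_u_le)
  finally show ?thesis .
qed

lemma summable_scaleC:
  assumes "summable (\<lambda>k. (cmod (c k))\<^sup>2)" shows "summable (\<lambda>k. scaleC (c k) (u k))"
  unfolding summable_Cauchy
proof (intro allI impI)
  fix e :: real assume "e > 0"
  then have "e\<^sup>2 > 0" by simp
  then obtain N where N: "\<And>m n. m \<ge> N \<Longrightarrow> norm (\<Sum>k=m..<n. (cmod (c k))\<^sup>2) < e\<^sup>2"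
    using assms unfolding summable_Cauchy by blast
  show "\<exists>N. \<forall>m\<ge>N. \<forall>n. norm (\<Sum>k=m..<n. scaleC (c k) (u k)) < e"
  proof (intro exI allI impI)
    fix m n assume "N \<le> m"
    have "(norm (\<Sum>k=m..<n. scaleC (c k) (u k)))\<^sup>2 \<le> (\<Sum>k=m..<n. (cmod (c k))\<^sup>2)"
      by (rule norm_sum_le) simp
    also have "\<dots> < e\<^sup>2" using N[OF \<open>N \<le> m\<close>, of n] by simp
    finally show "norm (\<Sum>k=m..<n. scaleC (c k) (u k)) < e"
      using \<open>e > 0\<close> by (intro power2_less_imp_less[of _ e]) auto
  qed
qed

lemma cinner_partial:
  "cinner (u j) (\<Sum>k<n. scaleC (c k) (u k)) = (if j < n then c j * cinner (u j) (u j) else 0)"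
proof -
  have "cinner (u j) (\<Sum>k<n. scaleC (c k) (u k)) = (\<Sum>k<n. if k = j then c j * cinner (u j) (u j) else 0)"
    unfolding cinner.sum_right cinner.scale_right by (rule sum.cong) (auto simp: orth)
  then show ?thesis by simp
qed

lemma bessel_partial: "(\<Sum>k<n. (cmod (cinner (u k) x))\<^sup>2) \<le> (norm x)\<^sup>2"
proof -
  define p where "p = (\<Sum>k<n. scaleC (cinner (u k) x) (u k))"
  have uu: "cinner (u k) x * cinner (u k) (u k) = cinner (u k) x" for k
    using self_cases[of k] by auto
  have ux: "cinner (u k) p = cinner (u k) x" if "k < n" for k
    unfolding p_def cinner_partial using that uu by simp
  have pp: "cinner p p = (\<Sum>k<n. of_real ((cmod (cinner (u k) x))\<^sup>2))"
  proof -
    have "cinner p p = (\<Sum>k<n. cinner (u k) x * cinner p (u k))"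
      by (subst (2) p_def) (simp only: cinner.sum_right cinner.scale_right)
    also have "\<dots> = (\<Sum>k<n. of_real ((cmod (cinner (u k) x))\<^sup>2))"
      by (rule sum.cong) (simp_all add: complex_norm_square ux cinner_commute[of p] del: of_real_power)
    finally show ?thesis .
  qed
  have px: "cinner p (x - p) = 0"
  proof -
    have "cinner (x - p) p = (\<Sum>k<n. cinner (u k) x * cinner (x - p) (u k))"
      by (subst (2) p_def) (simp only: cinner.sum_right cinner.scale_right)
    also have "\<dots> = 0"
    proof (rule sum.neutral, rule ballI)
      fix k assume "k \<in> {..<n}"
      then have "cinner (u k) (x - p) = 0" by (simp add: cinner.diff_right ux)
      then show "cinner (u k) x * cinner (x - p) (u k) = 0"
        by (subst cinner_commute[of "x - p"]) simp
    qed
    finally show ?thesis by (subst cinner_commute) simp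
  qed
  define f where "f = (\<lambda>n::nat. if n = 0 then p else x - p)"
  have "(norm (sum f {0, 1}))\<^sup>2 = (\<Sum>i\<in>{0,1}. (norm (f i))\<^sup>2)"
    using px cinner_commute[of "x - p" p] by (intro norm_sum_orthogonal) (auto simp: f_def)
  then have "(norm x)\<^sup>2 = (norm p)\<^sup>2 + (norm (x - p))\<^sup>2" by (simp add: f_def)
  moreover have "complex_of_real ((norm p)\<^sup>2) = of_real (\<Sum>k<n. (cmod (cinner (u k) x))\<^sup>2)"
    unfolding cinner_self_norm[symmetric] pp by simp
  then have "(norm p)\<^sup>2 = (\<Sum>k<n. (cmod (cinner (u k) x))\<^sup>2)" by (simp only: of_real_eq_iff)
  ultimately show ?thesis by simp
qed

lemma bessel_summable: "summable (\<lambda>k. (cmod (cinner (u k) x))\<^sup>2)"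
  by (rule bounded_imp_summable[of _ "(norm x)\<^sup>2"])
     (use bessel_partial[of x "Suc n" for n] in \<open>auto simp: lessThan_Suc_atMost\<close>)

lemma cinner_suminf:
  assumes "summable (\<lambda>k. (cmod (c k))\<^sup>2)"
  shows "cinner (u j) (\<Sum>k. scaleC (c k) (u k)) = c j * cinner (u j) (u j)"
proof (rule LIMSEQ_unique)
  show "(\<lambda>n. cinner (u j) (\<Sum>k<n. scaleC (c k) (u k))) \<longlonglongrightarrow> cinner (u j) (\<Sum>k. scaleC (c k) (u k))"
    by (intro bounded_linear.tendsto[OF bounded_linear_cinner_right] summable_LIMSEQ summable_scaleC assms)
  have "\<forall>\<^sub>F n in sequentially. c j * cinner (u j) (u j) = cinner (u j) (\<Sum>k<n. scaleC (c k) (u k))"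
    using eventually_gt_at_top[of j] by eventually_elim (simp add: cinner_partial)
  then show "(\<lambda>n. cinner (u j) (\<Sum>k<n. scaleC (c k) (u k))) \<longlonglongrightarrow> c j * cinner (u j) (u j)"
    by (rule tendsto_eventually[OF eventually_mono]) simp
qed

lemma residual_orthogonal:
  "cinner (u j) (x - (\<Sum>k. scaleC (cinner (u k) x) (u k))) = 0"
  using self_cases[of j] by (auto simp: cinner.diff_right cinner_suminf[OF bessel_summable])

end

text \<open>After orthogonalising \<open>v\<close>, the residual of the Bessel expansion of x is
  orthogonal to every \<open>v k\<close>, hence 0, and the partial sums of the expansion lie in
  \<open>S\<close>. Here \<open>S\<close> is any subspace containing the \<open>v k\<close>, which
  allows it to be the set of directions with some property.\<close>

lemma dense_span_of_trivial_complement: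
  fixes v :: "nat \<Rightarrow> 'h::complex_hilbert"
  assumes triv: "\<And>x. (\<And>k. cinner (v k) x = 0) \<Longrightarrow> x = 0"
    and S: "\<And>k. v k \<in> S" "\<And>x y. x \<in> S \<Longrightarrow> y \<in> S \<Longrightarrow> x - y \<in> S" "\<And>c x. x \<in> S \<Longrightarrow> scaleC c x \<in> S"
  shows "closure S = UNIV"
proof -
  define u where "u = cinner.gs v"
  interpret orthogonal_system u
    unfolding u_def by unfold_locales (erule cinner.gs_orthogonal, rule cinner.gs_self)
  have uS: "u k \<in> S" for k unfolding u_def by (rule cinner.gs_mem) (use S in auto)
  have z: "0 \<in> S" using S(2)[OF S(1) S(1), of 0 0] by simp
  have p: "x + y \<in> S" if "x \<in> S" "y \<in> S" for x y
    using S(2)[OF that(1) S(2)[OF z that(2)]] by simp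
  have "x \<in> closure S" for x
  proof -
    define y where "y = x - (\<Sum>k. scaleC (cinner (u k) x) (u k))"
    have "cinner (v n) y = 0" for n
    proof -
      have "cinner y (v n) = (\<Sum>k\<le>n. cinner (u k) (v n) * cinner y (u k))"
        unfolding u_def by (rule cinner.gs_expand)
      also have "\<dots> = 0"
      proof (rule sum.neutral, rule ballI)
        fix k
        have "cinner (u k) y = 0" unfolding y_def by (rule residual_orthogonal)
        then have "cinner y (u k) = 0" using cinner_commute by (metis complex_cnj_zero)
        then show "cinner (u k) (v n) * cinner y (u k) = 0" by simp
      qed
      finally show ?thesis using cinner_commute by (metis complex_cnj_zero)
    qed
    then have "x = (\<Sum>k. scaleC (cinner (u k) x) (u k))" using triv[of y] by (simp add: y_def)
    then have "(\<lambda>n. \<Sum>k<n. scaleC (cinner (u k) x) (u k)) \<longlonglongrightarrow> x"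
      using summable_LIMSEQ[OF summable_scaleC[OF bessel_summable[of x]]] by simp
    moreover have "(\<Sum>k<n. scaleC (cinner (u k) x) (u k)) \<in> S" for n
      by (induction n) (auto intro: z p S(3) uS)
    ultimately show ?thesis unfolding closure_sequential
      by (intro exI[of _ "\<lambda>n. \<Sum>k<n. scaleC (cinner (u k) x) (u k)"]) auto
  qed
  then show ?thesis by auto
qed

locale hilbert_basis =
  fixes e :: "nat \<Rightarrow> 'h::complex_hilbert"
  assumes orthonormal: "cinner (e i) (e j) = (if i = j then 1 else 0)"
    and complete: "(\<And>i. cinner (e i) x = 0) \<Longrightarrow> x = 0"
begin

sublocale orthogonal_system e
  by unfold_locales (auto simp: orthonormal)

lemma norm_e [simp]: "norm (e k) = 1"
  using cinner_self_norm[of "e k"] by (simp add: orthonormal) (metis of_real_eq_1_iff of_real_power power2_eq_1_iff norm_ge_zero neg_0_le_iff_le not_one_le_zero)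

lemma expansion: "(\<lambda>k. scaleC (cinner (e k) x) (e k)) sums x"
proof -
  have "x - (\<Sum>k. scaleC (cinner (e k) x) (e k)) = 0"
    by (rule complete) (rule residual_orthogonal)
  then show ?thesis using summable_sums[OF summable_scaleC[OF bessel_summable[of x]]] by simp
qed

lemma parseval: "(\<lambda>k. (cmod (cinner (e k) x))\<^sup>2) sums (norm x)\<^sup>2"
proof -
  have "(\<lambda>n. (norm (\<Sum>k<n. scaleC (cinner (e k) x) (e k)))\<^sup>2) \<longlonglongrightarrow> (norm x)\<^sup>2"
    by (intro tendsto_intros) (use expansion[of x] in \<open>simp add: sums_def\<close>)
  moreover have "(norm (\<Sum>k<n. scaleC (cinner (e k) x) (e k)))\<^sup>2 = (\<Sum>k<n. (cmod (cinner (e k) x))\<^sup>2)" for n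
    by (subst norm_sum_orthogonal) (auto simp: cinner_scaleC_left cinner.scale_right orthonormal)
  ultimately show ?thesis by (simp add: sums_def)
qed

lemma cinner_suminf_e:
  assumes "summable (\<lambda>k. (cmod (c k))\<^sup>2)"
  shows "cinner (e j) (\<Sum>k. scaleC (c k) (e k)) = c j"
  using cinner_suminf[OF assms] by (simp add: orthonormal)

text \<open>By Parseval the distance of \<open>f x\<close> to a fixed point is measurable, so
  preimages of balls are; by separability every open set is a countable union of balls.\<close>

lemma borel_measurable_coordinates:
  assumes sep: "separable_type TYPE('h)"
    and f: "\<And>n. (\<lambda>x. cinner (e n) (f x)) \<in> borel_measurable M"
  shows "f \<in> borel_measurable M"
proof (rule borel_measurableI)
  fix U :: "'h set" assume "open U"
  obtain D :: "'h set" where D: "countable D" "closure D = UNIV"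
    using sep by (auto simp: separable_type_def)
  have ball: "f -` ball y r \<inter> space M \<in> sets M" for y r
  proof -
    have "norm (f x - y) = sqrt (\<Sum>n. (cmod (cinner (e n) (f x) - cinner (e n) y))\<^sup>2)" for x
      using parseval[of "f x - y"] by (simp add: sums_iff cinner.diff_right)
    then have "(\<lambda>x. norm (f x - y)) = (\<lambda>x. sqrt (\<Sum>n. (cmod (cinner (e n) (f x) - cinner (e n) y))\<^sup>2))" by auto
    moreover have "\<dots> \<in> borel_measurable M" using f by measurable
    ultimately have [measurable]: "(\<lambda>x. norm (f x - y)) \<in> borel_measurable M" by simp
    have "f -` ball y r \<inter> space M = {x \<in> space M. norm (f x - y) < r}"
      by (auto simp: dist_norm norm_minus_commute)
    also have "\<dots> \<in> sets M" by measurable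
    finally show ?thesis .
  qed
  define B where "B = {p \<in> D \<times> (\<rat> \<inter> {0<..}). ball (fst p) (snd p) \<subseteq> U}"
  have "countable B" unfolding B_def
    by (rule countable_subset[of _ "D \<times> \<rat>"]) (use D countable_rat in auto)
  have "U = (\<Union>p\<in>B. ball (fst p) (snd p))"
  proof
    show "U \<subseteq> (\<Union>p\<in>B. ball (fst p) (snd p))"
    proof
      fix x assume "x \<in> U"
      then obtain r where r: "r > 0" "ball x r \<subseteq> U" using \<open>open U\<close> open_contains_ball by blast
      \<comment> \<open>The lower bound r/3 lets the ball around \<open>d\<close> reach
        \<open>x\<close>, and the upper bound r/2 keeps it inside \<open>ball x r\<close>, since r/3
        + r/2 < r.\<close>
      obtain q :: real where q: "q \<in> \<rat>" "r/3 < q" "q < r/2" using Rats_dense_in_real[of "r/3" "r/2"] r by auto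
      obtain d where d: "d \<in> D" "dist d x < r/3"
        using D(2) closure_approachable[of x D] r by (metis UNIV_I divide_pos_pos zero_less_numeral)
      have "ball d q \<subseteq> ball x r"
      proof
        fix z assume "z \<in> ball d q"
        then have "dist x z \<le> dist d x + dist d z" using dist_triangle3[of x z d] by (simp add: dist_commute)
        then show "z \<in> ball x r" using d q \<open>z \<in> ball d q\<close> r by auto
      qed
      then have "(d, q) \<in> B" using d q r by (auto simp: B_def)
      moreover have "x \<in> ball d q" using d q by (simp add: dist_commute)
      ultimately show "x \<in> (\<Union>p\<in>B. ball (fst p) (snd p))" by force
    qed
  qed (auto simp: B_def)
  then have "f -` U \<inter> space M = (\<Union>p\<in>B. f -` ball (fst p) (snd p) \<inter> space M)" by auto
  also have "\<dots> \<in> sets M" using \<open>countable B\<close> ball by (intro sets.countable_UN') auto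
  finally show "f -` U \<inter> space M \<in> sets M" .
qed

end

text \<open>Gram-Schmidt applied to a dense sequence, with the zero vectors discarded. Were only
  finitely many vectors left, they would span the space; as infinitely many remain, they can be
  enumerated by the naturals.\<close>

lemma exists_hilbert_basis:
  assumes sep: "separable_type TYPE('h::complex_hilbert)" and inf: "cinfinite_dim TYPE('h)"
  shows "\<exists>e :: nat \<Rightarrow> 'h. hilbert_basis e"
proof -
  obtain D :: "'h set" where D: "countable D" "closure D = UNIV"
    using sep by (auto simp: separable_type_def)
  then have "D \<noteq> {}" by auto
  then obtain d where d: "D = range (d :: nat \<Rightarrow> 'h)"
    using uncountable_def D(1) by blast
  define u where "u = cinner.gs d"
  interpret orthogonal_system u
    unfolding u_def by unfold_locales (erule cinner.gs_orthogonal, rule cinner.gs_self)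
  define J where "J = {k. u k \<noteq> 0}"
  have dense: "x = 0" if "\<And>k. cinner (u k) x = 0" for x
  proof -
    have d0: "cinner x (d n) = 0" for n
    proof -
      have "cinner x (d n) = (\<Sum>k\<le>n. cinner (u k) (d n) * cinner x (u k))"
        unfolding u_def by (rule cinner.gs_expand)
      also have "\<dots> = 0"
        by (rule sum.neutral) (use that cinner_commute[of x] in simp)
      finally show ?thesis .
    qed
    have "closed {y. cinner x y = 0}"
      by (intro closed_Collect_eq continuous_on_const
          linear_continuous_on[OF bounded_linear_cinner_right])
    then have "closure D \<subseteq> {y. cinner x y = 0}" using d d0 by (intro closure_minimal) auto
    then have "cinner x x = 0" using D(2) by (metis (mono_tags) UNIV_I mem_Collect_eq subsetD)
    then show ?thesis by simp
  qed
  have "infinite J"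
  proof
    assume fin: "finite J"
    have ex: "x = (\<Sum>v\<in>u ` J. scaleC (cinner v x) v)" for x
    proof -
      have inj: "inj_on u J"
      proof (rule inj_onI)
        fix i j assume "i \<in> J" "j \<in> J" "u i = u j"
        then show "i = j" using orth[of i j] by (auto simp: J_def)
      qed
      have "x - (\<Sum>k\<in>J. scaleC (cinner (u k) x) (u k)) = 0"
      proof (rule dense)
        fix j
        have "cinner (u j) (\<Sum>k\<in>J. scaleC (cinner (u k) x) (u k)) = (\<Sum>k\<in>J. if k = j then cinner (u j) x * cinner (u j) (u j) else 0)"
          unfolding cinner.sum_right cinner.scale_right by (rule sum.cong) (auto simp: orth)
        also have "\<dots> = cinner (u j) x" using fin self_cases[of j] by (auto simp: J_def)
        finally show "cinner (u j) (x - (\<Sum>k\<in>J. scaleC (cinner (u k) x) (u k))) = 0"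
          by (simp add: cinner.diff_right)
      qed
      then show ?thesis by (simp add: sum.reindex[OF inj])
    qed
    have "x \<in> cspan (u ` J)" for x unfolding cspan_def
      by (intro CollectI exI[of _ "u ` J"] exI[of _ "\<lambda>v. cinner v x"] conjI finite_imageI fin subset_refl ex)
    then have "cspan (u ` J) = UNIV" by blast
    then show False using inf fin unfolding cinfinite_dim_def by blast
  qed
  have "hilbert_basis (\<lambda>n. u (enumerate J n))"
  proof
    show "cinner (u (enumerate J i)) (u (enumerate J j)) = (if i = j then 1 else 0)" for i j
    proof (cases "i = j")
      case True
      then show ?thesis using self_cases[of "enumerate J i"] enumerate_in_set[OF \<open>infinite J\<close>, of i]
        by (auto simp: J_def)
    next
      case False
      then have "enumerate J i \<noteq> enumerate J j"
        using \<open>infinite J\<close> by (metis enumerate_mono nat_neq_iff)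
      then show ?thesis using False orth by simp
    qed
    fix x assume 0: "\<And>i. cinner (u (enumerate J i)) x = 0"
    show "x = 0"
    proof (rule dense)
      fix k
      show "cinner (u k) x = 0"
      proof (cases "k \<in> J")
        case True
        then obtain i where "enumerate J i = k" using enumerate_Ex \<open>infinite J\<close> by metis
        then show ?thesis using 0 by metis
      qed (auto simp: J_def)
    qed
  qed
  then show ?thesis by blast
qed

subsection \<open>Continuous measures on the circle\<close>

locale continuous_circle_measure =
  fixes \<sigma> :: "complex measure"
  assumes borel_prob_circle: "borel_prob_circle \<sigma>" and continuous: "continuous_measure \<sigma>"
begin

sublocale prob_space \<sigma>
  using borel_prob_circle by (simp add: borel_prob_circle_def)

lemma sets_\<sigma>: "sets \<sigma> = sets (restrict_space borel circle)"
  using borel_prob_circle by (simp add: borel_prob_circle_def)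

lemma space_\<sigma> [simp]: "space \<sigma> = circle"
  using sets_eq_imp_space_eq[OF sets_\<sigma>] by (simp add: space_restrict_space)

lemma continuous_measurable:
  fixes f :: "complex \<Rightarrow> 'b::topological_space"
  assumes "continuous_on circle f" shows "f \<in> borel_measurable \<sigma>"
  unfolding measurable_cong_sets[OF sets_\<sigma> refl] by (rule borel_measurable_continuous_on_restrict[OF assms])

lemma continuous_bounded:
  fixes f :: "complex \<Rightarrow> 'b::real_normed_vector"
  assumes "continuous_on circle f" obtains K where "\<And>z. z \<in> circle \<Longrightarrow> norm (f z) \<le> K" "K > 0"
proof -
  have "bounded (f ` circle)"
    by (intro compact_imp_bounded compact_continuous_image assms) simp
  then show thesis using that unfolding bounded_pos by blast
qed

lemma continuous_integrable:
  fixes f :: "complex \<Rightarrow> 'b::{banach, second_countable_topology}"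
  assumes "continuous_on circle f" shows "integrable \<sigma> f"
proof -
  obtain K where "\<And>z. z \<in> circle \<Longrightarrow> norm (f z) \<le> K" using continuous_bounded[OF assms] by blast
  then show ?thesis
    by (intro integrable_const_bound[of _ K]) (use continuous_measurable[OF assms] in auto)
qed

lemma AE_not_point: "AE z in \<sigma>. z \<noteq> p"
proof (cases "{p} \<in> sets \<sigma>")
  case True
  then have "{p} \<in> null_sets \<sigma>" using continuous by (auto simp: continuous_measure_def)
  from AE_not_in[OF this] show ?thesis by simp
next
  case False
  then have "p \<notin> circle" unfolding sets_\<sigma> by (auto simp: sets_restrict_space_iff)
  then show ?thesis by (intro AE_I2) auto
qed

text \<open>Finite sets are null for a measure without atoms, so a function vanishing almost
  everywhere cannot do so on a finite set only.\<close>

lemma AE_infinite_zeros: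
  assumes "AE z in \<sigma>. F z = 0" shows "infinite {z \<in> circle. F z = 0}"
proof
  assume fin: "finite {z \<in> circle. F z = 0}"
  have "AE z in \<sigma>. \<forall>p\<in>{z \<in> circle. F z = 0}. z \<noteq> p"
    by (rule AE_finite_allI[OF fin]) (rule AE_not_point)
  with assms AE_space have "AE z in \<sigma>. False"
    by eventually_elim auto
  then show False by simp
qed

text \<open>The mean of the |a n|^2 is the double integral of the kernel \<open>H N z w\<close>,
  which tends to 0 off the diagonal. The diagonal is handled with iterated integrals: for fixed z
  only the point w = z is exceptional, and it has measure 0. Dominated convergence is applied in w
  and then in z.\<close>

lemma wiener:
  assumes h: "continuous_on circle h"
  shows "(\<lambda>N. (\<Sum>n=1..N. cmod (\<integral>z. z ^ n * h z \<partial>\<sigma>)) / real N) \<longlonglongrightarrow> 0"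
proof -
  define a where "a n = (\<integral>z. z ^ n * h z \<partial>\<sigma>)" for n
  obtain K where K: "\<And>z. z \<in> circle \<Longrightarrow> cmod (h z) \<le> K" "K > 0" using continuous_bounded[OF h] by blast
  define G where "G N z = (\<Sum>n=1..N. z ^ n * h z * cnj (a n)) / of_nat N" for N z
  define H where "H N z w = (\<Sum>n=1..N. (z * cnj w) ^ n) / of_nat N * (h z * cnj (h w))" for N z w
  have Gc: "continuous_on circle (G N)" for N unfolding G_def divide_inverse by (intro continuous_intros h)
  have Hc: "continuous_on circle (H N z)" for N z unfolding H_def divide_inverse by (intro continuous_intros h)
  have Hb: "cmod (H N z w) \<le> K * K" if "z \<in> circle" "w \<in> circle" for N z w
  proof -
    have "cmod ((\<Sum>n=1..N. (z * cnj w) ^ n) / of_nat N) \<le> 1"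
      by (rule cmod_cesaro_le) (use that in \<open>simp add: norm_power norm_mult\<close>)
    moreover have "cmod (h z * cnj (h w)) \<le> K * K"
      unfolding norm_mult using K that by (auto intro!: mult_mono)
    ultimately have "cmod (H N z w) \<le> 1 * (K * K)" unfolding H_def norm_mult[of "_ / _"]
      by (intro mult_mono) auto
    then show ?thesis by simp
  qed
  have GH: "G N z = (\<integral>w. H N z w \<partial>\<sigma>)" if "z \<in> circle" for N z
  proof -
    have H_eq: "H N z w = (\<Sum>n=1..N. (z ^ n * h z / of_nat N) * cnj (w ^ n * h w))" for w
      unfolding H_def by (simp add: sum_divide_distrib sum_distrib_left sum_distrib_right power_mult_distrib ac_simps)
    have i: "integrable \<sigma> (\<lambda>w. cnj (w ^ n * h w))" for n
      by (intro continuous_integrable continuous_intros h)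
    have "(\<integral>w. H N z w \<partial>\<sigma>) = (\<Sum>n=1..N. (z ^ n * h z / of_nat N) * (\<integral>w. cnj (w ^ n * h w) \<partial>\<sigma>))"
      unfolding H_eq
      by (subst Bochner_Integration.integral_sum)
         (intro integrable_mult_right i, simp only: integral_mult_right_zero)
    moreover have "(\<integral>w. cnj (w ^ n * h w) \<partial>\<sigma>) = cnj (a n)" for n
      unfolding a_def by (rule Bochner_Integration.integral_cnj)
    ultimately show ?thesis by (simp only: G_def sum_divide_distrib times_divide_eq_left)
  qed
  have G0: "(\<lambda>N. G N z) \<longlonglongrightarrow> 0" if z: "z \<in> circle" for z
  proof -
    have "(\<lambda>N. \<integral>w. H N z w \<partial>\<sigma>) \<longlonglongrightarrow> (\<integral>w. 0 \<partial>\<sigma>)"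
    proof (rule integral_dominated_convergence[where w="\<lambda>_. K * K"])
      show "AE w in \<sigma>. (\<lambda>N. H N z w) \<longlonglongrightarrow> 0"
        using AE_not_point[of z] AE_space
      proof eventually_elim
        case (elim w)
        have "z * cnj w \<noteq> 1"
        proof
          assume "z * cnj w = 1"
          then have "z * (w * cnj w) = w" by (simp add: algebra_simps)
          then show False using elim by (simp add: complex_norm_square[symmetric])
        qed
        moreover have "cmod (z * cnj w) = 1" using elim z by (simp add: norm_mult)
        ultimately have "(\<lambda>N. (\<Sum>n=1..N. (z * cnj w) ^ n) / of_nat N) \<longlonglongrightarrow> 0"
          using cesaro_unit_circle[of "z * cnj w"] by simp
        from tendsto_mult_left_zero[OF this] show ?case unfolding H_def .
      qed
      show "AE w in \<sigma>. norm (H N z w) \<le> K * K" for N using Hb z by (intro AE_I2) auto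
    qed (use continuous_measurable[OF Hc] in auto)
    then show ?thesis by (simp add: GH[OF z])
  qed
  have "(\<lambda>N. \<integral>z. G N z \<partial>\<sigma>) \<longlonglongrightarrow> (\<integral>z. 0 \<partial>\<sigma>)"
  proof (rule integral_dominated_convergence[where w="\<lambda>_. K * K"])
    show "AE z in \<sigma>. (\<lambda>N. G N z) \<longlonglongrightarrow> 0" using G0 by (intro AE_I2) auto
    show "AE z in \<sigma>. norm (G N z) \<le> K * K" for N
    proof (rule AE_I2)
      fix z assume z: "z \<in> space \<sigma>"
      have "norm (\<integral>w. H N z w \<partial>\<sigma>) \<le> (\<integral>w. norm (H N z w) \<partial>\<sigma>)" by (rule integral_norm_bound)
      also have "\<dots> \<le> K * K"
        by (rule integral_le_const) (use Hb z in \<open>auto intro!: continuous_integrable continuous_intros Hc AE_I2\<close>)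
      finally show "norm (G N z) \<le> K * K" using GH z by simp
    qed
  qed (use continuous_measurable[OF Gc] in auto)
  moreover have "(\<integral>z. G N z \<partial>\<sigma>) = of_real ((\<Sum>n=1..N. (cmod (a n))\<^sup>2) / real N)" for N
  proof -
    have i: "integrable \<sigma> (\<lambda>z. z ^ n * h z)" for n
      by (intro continuous_integrable continuous_intros h)
    have "(\<integral>z. G N z \<partial>\<sigma>) = (\<Sum>n=1..N. a n * cnj (a n)) / of_nat N"
      unfolding G_def integral_divide_zero
      by (subst Bochner_Integration.integral_sum) (use i in \<open>auto simp: a_def\<close>)
    also have "\<dots> = (\<Sum>n=1..N. of_real ((cmod (a n))\<^sup>2)) / of_nat N"
      by (simp only: complex_norm_square)
    finally show ?thesis by simp
  qed
  ultimately have "(\<lambda>N. complex_of_real ((\<Sum>n=1..N. (cmod (a n))\<^sup>2) / real N)) \<longlonglongrightarrow> of_real 0"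
    by simp
  then have "(\<lambda>N. (\<Sum>n=1..N. (cmod (a n))\<^sup>2) / real N) \<longlonglongrightarrow> 0"
    unfolding tendsto_of_real_iff .
  from tendsto_real_sqrt[OF this]
  have s0: "(\<lambda>N. sqrt ((\<Sum>n=1..N. (cmod (a n))\<^sup>2) / real N)) \<longlonglongrightarrow> 0" by simp
  show ?thesis unfolding a_def[symmetric]
  proof (rule Lim_null_comparison[OF _ s0], rule always_eventually, rule allI)
    fix N
    \<comment> \<open>Cauchy-Schwarz against the constant 1 passes from the means of squares to
      means of absolute values.\<close>
    have "(\<Sum>n=1..N. cmod (a n) * 1)\<^sup>2 \<le> (\<Sum>n=1..N. (cmod (a n))\<^sup>2) * (\<Sum>n=1..N. 1\<^sup>2)"
      by (rule Cauchy_Schwarz_ineq_sum)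
    then have "(\<Sum>n=1..N. cmod (a n))\<^sup>2 \<le> (\<Sum>n=1..N. (cmod (a n))\<^sup>2) * real N" by simp
    then have "(\<Sum>n=1..N. cmod (a n))\<^sup>2 / (real N)\<^sup>2 \<le> (\<Sum>n=1..N. (cmod (a n))\<^sup>2) * real N / (real N)\<^sup>2"
      by (rule divide_right_mono) simp
    also have "\<dots> = (\<Sum>n=1..N. (cmod (a n))\<^sup>2) / real N" by (simp add: power2_eq_square)
    finally have "((\<Sum>n=1..N. cmod (a n)) / real N)\<^sup>2 \<le> (\<Sum>n=1..N. (cmod (a n))\<^sup>2) / real N"
      by (simp add: power_divide)
    then have "(\<Sum>n=1..N. cmod (a n)) / real N \<le> sqrt ((\<Sum>n=1..N. (cmod (a n))\<^sup>2) / real N)"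
      by (rule real_le_rsqrt)
    then show "norm ((\<Sum>n=1..N. cmod (a n)) / real N) \<le> sqrt ((\<Sum>n=1..N. (cmod (a n))\<^sup>2) / real N)"
      by (simp add: sum_nonneg)
  qed
qed

text \<open>The Gram matrix of the monomials in \<open>L\<^sup>2(\<sigma>)\<close>, as a quadratic form.\<close>
lemma exists_cholesky:
  "\<exists>a :: nat \<Rightarrow> nat \<Rightarrow> complex. (\<forall>n k. n < k \<longrightarrow> a n k = 0) \<and>
     (\<forall>N b. (\<Sum>k<N. (cmod (\<Sum>n<N. b n * a n k))\<^sup>2) = (\<integral>z. (cmod (\<Sum>n<N. b n * z ^ n))\<^sup>2 \<partial>\<sigma>))"
proof -
  define ip where "ip p q = (\<integral>z. cnj (poly p z) * poly q z \<partial>\<sigma>)" for p q :: "complex poly"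
  have i: "integrable \<sigma> (\<lambda>z. cnj (poly p z) * poly q z)" for p q
    by (intro continuous_integrable continuous_intros)
  have self: "ip p p = of_real (\<integral>z. (cmod (poly p z))\<^sup>2 \<partial>\<sigma>)" for p
  proof -
    have "ip p p = (\<integral>z. complex_of_real ((cmod (poly p z))\<^sup>2) \<partial>\<sigma>)"
      unfolding ip_def complex_norm_square by (simp add: mult.commute)
    then show ?thesis by (simp only: integral_complex_of_real)
  qed
  interpret ip: semi_inner smult ip
  proof
    fix x y z :: "complex poly" and a :: complex
    show "ip (x + y) z = ip x z + ip y z"
      unfolding ip_def using i by (simp add: distrib_right)
    show "ip (smult a x) y = cnj a * ip x y"
      unfolding ip_def by (simp add: mult.assoc)
    show "ip x y = cnj (ip y x)"
      unfolding ip_def using Bochner_Integration.integral_cnj[of \<sigma> "\<lambda>z. cnj (poly y z) * poly x z"] by (simp add: mult.commute)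
    show "0 \<le> Re (ip x x)" unfolding self by simp
  qed
  define d where "d n = monom (1::complex) n" for n
  \<comment> \<open>The coefficient of \<open>z ^ n\<close> along the k-th orthonormal polynomial.
    It vanishes for k > n, and the claimed identity is Parseval for a polynomial of degree below
    N.\<close>
  define a where "a n k = ip (ip.gs d k) (d n)" for n k
  have tri: "\<forall>n k. n < k \<longrightarrow> a n k = 0" unfolding a_def using ip.gs_upper by blast
  have "(\<Sum>k<N. (cmod (\<Sum>n<N. b n * a n k))\<^sup>2) = (\<integral>z. (cmod (\<Sum>n<N. b n * z ^ n))\<^sup>2 \<partial>\<sigma>)" for N b
  proof -
    define p where "p = (\<Sum>n<N. smult (b n) (d n))"
    define c where "c k = (\<Sum>n<N. b n * a n k)" for k
    have poly_p: "poly p z = (\<Sum>n<N. b n * z ^ n)" for z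
      by (simp add: p_def d_def poly_sum poly_monom)
    have ip_p: "ip x p = (\<Sum>n<N. b n * ip x (d n))" for x
      by (simp add: p_def ip.sum_right ip.scale_right)
    have c: "c k = ip (ip.gs d k) p" for k by (simp add: c_def ip_p a_def)
    have dn: "ip x (d n) = (\<Sum>k<N. a n k * ip x (ip.gs d k))" if "n < N" for x n
    proof -
      have "(\<Sum>k<N. a n k * ip x (ip.gs d k)) = (\<Sum>k\<le>n. a n k * ip x (ip.gs d k))"
        by (rule sum.mono_neutral_right) (use that tri in auto)
      then show ?thesis using ip.gs_expand[of x d n] by (simp add: a_def)
    qed
    have "ip p p = (\<Sum>n<N. b n * (\<Sum>k<N. a n k * ip p (ip.gs d k)))"
      unfolding ip_p[of p] by (rule sum.cong) (auto simp: dn)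
    also have "\<dots> = (\<Sum>n<N. \<Sum>k<N. b n * a n k * ip p (ip.gs d k))"
      by (simp add: sum_distrib_left mult.assoc)
    also have "\<dots> = (\<Sum>k<N. \<Sum>n<N. b n * a n k * ip p (ip.gs d k))" by (rule sum.swap)
    also have "\<dots> = (\<Sum>k<N. c k * ip p (ip.gs d k))" by (simp add: c_def sum_distrib_right)
    also have "\<dots> = (\<Sum>k<N. c k * cnj (c k))"
      by (rule sum.cong) (auto simp: c intro: ip.commute)
    also have "\<dots> = of_real (\<Sum>k<N. (cmod (c k))\<^sup>2)" by (simp only: complex_norm_square of_real_sum)
    finally have "complex_of_real (\<integral>z. (cmod (poly p z))\<^sup>2 \<partial>\<sigma>) = of_real (\<Sum>k<N. (cmod (c k))\<^sup>2)"
      unfolding self .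
    then have "(\<integral>z. (cmod (poly p z))\<^sup>2 \<partial>\<sigma>) = (\<Sum>k<N. (cmod (c k))\<^sup>2)" by (simp only: of_real_eq_iff)
    then show ?thesis by (simp add: poly_p c_def)
  qed
  with tri show ?thesis by blast
qed

end

text \<open>The symbol of a functional with coefficients \<open>l n\<close>: the weights \<open>2\<^sup>-\<^sup>n\<^sup>/\<^sup>2\<close> make it
  holomorphic beyond the unit circle.\<close>
definition symbol :: "(nat \<Rightarrow> complex) \<Rightarrow> complex \<Rightarrow> complex" where
  "symbol l z = (\<Sum>n. l n * of_real ((1 / sqrt 2) ^ n) * z ^ n)"

lemma symbol_summable:
  assumes "\<And>n. cmod (l n) \<le> K" "cmod z < sqrt 2"
  shows "summable (\<lambda>n. l n * of_real ((1 / sqrt 2) ^ n) * z ^ n)"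
proof (rule summable_comparison_test)
  show "summable (\<lambda>n. K * (cmod z / sqrt 2) ^ n)"
    using assms(2) by (intro summable_mult summable_geometric) simp
  have "norm (l n * of_real ((1 / sqrt 2) ^ n) * z ^ n) \<le> K * (cmod z / sqrt 2) ^ n" for n
  proof -
    have "norm (l n * of_real ((1 / sqrt 2) ^ n) * z ^ n) = cmod (l n) * (cmod z / sqrt 2) ^ n"
      by (simp add: norm_mult norm_power norm_divide power_divide)
    then show ?thesis using assms(1)[of n] by (simp add: mult_right_mono)
  qed
  then show "\<exists>N. \<forall>n\<ge>N. norm (l n * of_real ((1 / sqrt 2) ^ n) * z ^ n) \<le> K * (cmod z / sqrt 2) ^ n" by blast
qed

lemma symbol_sums:
  assumes "\<And>n. cmod (l n) \<le> K" "cmod z < sqrt 2"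
  shows "(\<lambda>n. l n * of_real ((1 / sqrt 2) ^ n) * z ^ n) sums symbol l z"
  using summable_sums[OF symbol_summable[OF assms]] by (simp add: symbol_def)

lemma symbol_holomorphic:
  assumes "\<And>n. cmod (l n) \<le> K" shows "symbol l holomorphic_on ball 0 (sqrt 2)"
  by (rule power_series_holomorphic[where a="\<lambda>n. l n * of_real ((1 / sqrt 2) ^ n)"])
     (use symbol_sums[OF assms] in simp)

lemma symbol_continuous:
  assumes "\<And>n. cmod (l n) \<le> K" shows "continuous_on circle (symbol l)"
  by (rule continuous_on_subset[OF holomorphic_on_imp_continuous_on[OF symbol_holomorphic[OF assms]]])
     (auto simp: dist_norm)

text \<open>The symbol has infinitely many zeros on the circle, and these accumulate at a point of
  the circle, which is interior to the disc of holomorphy of radius sqrt 2. The identity theorem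
  applies.\<close>

lemma (in continuous_circle_measure) symbol_zero:
  assumes l: "\<And>n. cmod (l n) \<le> K" and 0: "(\<integral>z. (cmod (symbol l z))\<^sup>2 \<partial>\<sigma>) = 0"
  shows "l n = 0"
proof -
  have "integrable \<sigma> (\<lambda>z. (cmod (symbol l z))\<^sup>2)"
    by (intro continuous_integrable continuous_intros symbol_continuous[OF l])
  then have "AE z in \<sigma>. (cmod (symbol l z))\<^sup>2 = 0"
    using 0 by (subst (asm) integral_nonneg_eq_0_iff_AE) auto
  then have "infinite {z \<in> circle. symbol l z = 0}"
    by (intro AE_infinite_zeros) simp
  then obtain x where x: "x \<in> circle" "x islimpt {z \<in> circle. symbol l z = 0}"
    using Heine_Borel_imp_Bolzano_Weierstrass[OF compact_sphere, of "{z \<in> circle. symbol l z = 0}" 0 1] by blast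
  have z0: "symbol l w = 0" if "w \<in> ball 0 (sqrt 2)" for w
    by (rule analytic_continuation[OF symbol_holomorphic[OF l] open_ball connected_ball _ _ x(2) _ that])
       (use x in \<open>auto simp: dist_norm\<close>)
  have s0: "symbol l 0 = l 0"
    using symbol_sums[of l K 0, OF l] powser_sums_zero[of "\<lambda>n. l n * of_real ((1 / sqrt 2) ^ n)"]
    by (simp add: sums_unique2)
  \<comment> \<open>The constant coefficient is the value at 0. For n > 0, a non-zero coefficient
    would make 0 an isolated zero, contradicted at a point close to 0.\<close>
  show "l n = 0"
  proof (cases "n = 0")
    case True
    then show ?thesis using s0 z0[of 0] by simp
  next
    case False
    show ?thesis
    proof (rule ccontr)
      assume "l n \<noteq> 0"
      have ss: "(\<lambda>n. (l n * of_real ((1 / sqrt 2) ^ n)) * (x - 0) ^ n) sums symbol l x" if "norm (x - 0) < sqrt 2" for x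
        using symbol_sums[OF l, of x] that by simp
      obtain s where s: "0 < s" "\<And>z. z \<in> cball 0 s - {0} \<Longrightarrow> symbol l z \<noteq> 0"
        by (rule powser_0_nonzero[of "sqrt 2", OF _ ss, of n]) (use False \<open>l n \<noteq> 0\<close> z0[of 0] in auto)
      define w where "w = complex_of_real (min s 1)"
      have "w \<in> cball 0 s - {0}" "w \<in> ball 0 (sqrt 2)"
        using s by (auto simp: w_def dist_norm min_less_iff_disj)
      then show False using s(2) z0 by blast
    qed
  qed
qed

subsection \<open>A Gaussian product space\<close>

abbreviation std_normal :: "real measure" where
  "std_normal \<equiv> density lborel (normal_density 0 1)"

definition gauss_space :: "('i \<Rightarrow> real) measure" where
  "gauss_space = PiM UNIV (\<lambda>_. std_normal)"

lemma prob_space_std_normal: "prob_space std_normal"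
  by (rule prob_space_normal_density) simp

lemma sets_gauss_space: "sets (gauss_space :: ('i \<Rightarrow> real) measure) = sets (PiM UNIV (\<lambda>_. borel))"
  unfolding gauss_space_def by (rule sets_PiM_cong) auto

lemma space_gauss_space [simp]: "space gauss_space = UNIV"
  by (simp add: gauss_space_def space_PiM)

interpretation gauss_space: prob_space "gauss_space :: ('i \<Rightarrow> real) measure"
  unfolding gauss_space_def by (intro prob_space_PiM prob_space_std_normal)

lemma measurable_gauss_component [measurable]: "(\<lambda>\<omega>. \<omega> i) \<in> borel_measurable gauss_space"
  unfolding measurable_cong_sets[OF sets_gauss_space refl] by measurable

lemma distr_gauss_component: "distr gauss_space borel (\<lambda>\<omega>. \<omega> i) = std_normal"
proof -
  have "distr gauss_space std_normal (\<lambda>\<omega>. \<omega> i) = std_normal"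
    unfolding gauss_space_def by (rule distr_PiM_component) (auto intro: prob_space_std_normal)
  moreover have "distr gauss_space std_normal (\<lambda>\<omega>. \<omega> i) = distr gauss_space borel (\<lambda>\<omega>. \<omega> i)"
    by (rule distr_cong) auto
  ultimately show ?thesis by simp
qed

lemma indep_gauss_components: "gauss_space.indep_vars (\<lambda>_. borel) (\<lambda>i \<omega>. \<omega> i) UNIV"
proof (subst gauss_space.indep_vars_iff_distr_eq_PiM)
  show "distr gauss_space (PiM UNIV (\<lambda>_. borel)) (\<lambda>x. \<lambda>i\<in>UNIV. x i)
      = (\<Pi>\<^sub>M i\<in>UNIV. distr gauss_space borel (\<lambda>\<omega>. \<omega> i))"
    unfolding distr_gauss_component gauss_space_def[symmetric] restrict_UNIV
    by (rule distr_id2) (simp add: sets_gauss_space)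
qed auto

lemma cis_sum: "finite A \<Longrightarrow> cis (\<Sum>i\<in>A. f i) = (\<Prod>i\<in>A. cis (f i))"
  by (induction A rule: finite_induct) (auto simp: cis_mult[symmetric])

lemma measurable_cis [measurable]: "cis \<in> borel_measurable borel"
  by (intro borel_measurable_continuous_onI continuous_on_cis continuous_on_id)

lemma gauss_space_char:
  assumes "finite I"
  shows "(\<integral>\<omega>. cis (\<Sum>i\<in>I. r i * \<omega> i) \<partial>gauss_space) = of_real (exp (- (\<Sum>i\<in>I. (r i)\<^sup>2) / 2))"
proof -
  have ind: "gauss_space.indep_vars (\<lambda>_. borel) (\<lambda>i \<omega>. cis (r i * \<omega> i)) I"
  proof -
    have "gauss_space.indep_vars (\<lambda>_. borel) (\<lambda>i \<omega>. \<omega> i) I"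
      by (rule gauss_space.indep_vars_subset[OF indep_gauss_components]) simp
    then show ?thesis by (rule gauss_space.indep_vars_compose2) measurable
  qed
  have int: "integrable gauss_space (\<lambda>\<omega>. cis (r i * \<omega> i))" for i
    by (rule gauss_space.integrable_const_bound[of _ 1]) auto
  have one: "(\<integral>\<omega>. cis (r i * \<omega> i) \<partial>gauss_space) = of_real (exp (- ((r i)\<^sup>2) / 2))" for i
  proof -
    have "(\<integral>\<omega>. cis (r i * \<omega> i) \<partial>gauss_space) = (\<integral>x. cis (r i * x) \<partial>distr gauss_space borel (\<lambda>\<omega>. \<omega> i))"
      by (rule integral_distr[symmetric]) auto
    also have "\<dots> = char std_normal_distribution (r i)"
      unfolding distr_gauss_component char_def by (simp add: cis_conv_exp)
    finally show ?thesis unfolding char_std_normal_distribution .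
  qed
  have "(\<integral>\<omega>. cis (\<Sum>i\<in>I. r i * \<omega> i) \<partial>gauss_space) = (\<integral>\<omega>. (\<Prod>i\<in>I. cis (r i * \<omega> i)) \<partial>gauss_space)"
    using assms by (simp add: cis_sum)
  also have "\<dots> = (\<Prod>i\<in>I. of_real (exp (- ((r i)\<^sup>2) / 2)))"
    by (subst gauss_space.indep_vars_lebesgue_integral[OF assms ind int]) (simp only: one)
  also have "\<dots> = of_real (exp (\<Sum>i\<in>I. - ((r i)\<^sup>2) / 2))"
    by (simp only: of_real_prod exp_sum[OF assms])
  also have "(\<Sum>i\<in>I. - ((r i)\<^sup>2) / 2) = - (\<Sum>i\<in>I. (r i)\<^sup>2) / 2"
    by (simp add: sum_negf sum_divide_distrib)
  finally show ?thesis .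
qed

text \<open>The normal density has no zeros and Lebesgue measure is translation invariant.\<close>
lemma AE_gauss_space_shift:
  fixes i :: 'i
  assumes Q: "{\<omega>. Q \<omega>} \<in> sets (gauss_space :: ('i \<Rightarrow> real) measure)" and ae: "AE \<omega> in gauss_space. Q \<omega>"
  shows "AE \<omega> in gauss_space. Q (fun_upd \<omega> i (\<omega> i + t))"
proof -
  \<comment> \<open>Coordinate \<open>i\<close> is split off: the product measure is the image under
    \<open>j\<close> of the one-dimensional factor times the product over the other
    coordinates.\<close>
  let ?J = "UNIV - {i}"
  let ?P = "PiM ?J (\<lambda>_. std_normal)"
  interpret S: prob_space std_normal by (rule prob_space_std_normal)
  interpret P: prob_space ?P by (intro prob_space_PiM prob_space_std_normal)
  interpret SP: pair_prob_space std_normal ?P ..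
  have ins: "insert i ?J = UNIV" by auto
  define j where "j = (\<lambda>(x::real, X::'i \<Rightarrow> real). fun_upd X i x)"
  have G: "gauss_space = distr (std_normal \<Otimes>\<^sub>M ?P) gauss_space j"
    using distr_pair_PiM_eq_PiM[of ?J "\<lambda>_. std_normal" i] prob_space_std_normal
    unfolding ins gauss_space_def j_def by auto
  have jm[measurable]: "j \<in> measurable (std_normal \<Otimes>\<^sub>M ?P) gauss_space"
  proof -
    have "(\<lambda>p. fun_upd (snd p) i (fst p)) \<in> measurable (std_normal \<Otimes>\<^sub>M ?P) (PiM UNIV (\<lambda>_. std_normal))"
      by (rule measurable_fun_upd[where J="?J"]) auto
    then show ?thesis by (simp add: j_def gauss_space_def split_beta')
  qed
  have upd[measurable]: "(\<lambda>\<omega>. fun_upd \<omega> i (\<omega> i + t)) \<in> measurable gauss_space (gauss_space :: ('i \<Rightarrow> real) measure)"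
    unfolding measurable_cong_sets[OF sets_gauss_space sets_gauss_space]
    by (rule measurable_PiM_single') (auto simp: fun_upd_def)
  have Q'[measurable]: "Measurable.pred gauss_space Q" using Q by (simp add: pred_def)
  have "AE p in std_normal \<Otimes>\<^sub>M ?P. Q (j p)"
    using ae by (subst (asm) G) (simp add: AE_distr_iff Q)
  then have "AE x in std_normal. AE X in ?P. Q (j (x, X))" by (rule SP.AE_pair)
  moreover have "{p \<in> space (std_normal \<Otimes>\<^sub>M ?P). Q (j (fst p, snd p))} \<in> sets (std_normal \<Otimes>\<^sub>M ?P)"
    unfolding prod.collapse by (rule predE) measurable
  \<comment> \<open>With the other coordinates \<open>X\<close> fixed first, the inner statement
    concerns one real variable and can be moved to Lebesgue measure and translated. Afterwards the
    order is exchanged again.\<close>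
  ultimately have sw: "AE X in ?P. AE x in std_normal. Q (j (x, X))"
    by (subst (asm) SP.AE_commute)
  have "AE X in ?P. AE x in std_normal. Q (j (x + t, X))"
    using sw AE_space
  proof eventually_elim
    case (elim X)
    have jX[measurable]: "(\<lambda>x. j (x, X)) \<in> measurable borel gauss_space"
    proof -
      have "(\<lambda>x. (x, X)) \<in> measurable std_normal (std_normal \<Otimes>\<^sub>M ?P)" using elim by simp
      from measurable_compose[OF this jm] show ?thesis by simp
    qed
    have "AE x in lborel. Q (j (x, X))"
      using elim(1) by (subst (asm) AE_density) (auto simp: normal_density_pos)
    then have "AE x in distr lborel borel ((+) t). Q (j (x, X))"
      unfolding lborel_distr_plus .
    then have "AE x in lborel. Q (j (t + x, X))"
      by (subst (asm) AE_distr_iff) auto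
    then show ?case
      by (subst AE_density) (auto simp: add.commute)
  qed
  moreover have "(\<lambda>p. (fst p + t, snd p)) \<in> measurable (std_normal \<Otimes>\<^sub>M ?P) (std_normal \<Otimes>\<^sub>M ?P)"
    by (rule measurable_Pair) (auto simp: measurable_cong_sets[OF refl, of std_normal borel])
  from measurable_compose[OF this jm]
  have [measurable]: "(\<lambda>p. j (fst p + t, snd p)) \<in> measurable (std_normal \<Otimes>\<^sub>M ?P) gauss_space" .
  have mt: "{p \<in> space (std_normal \<Otimes>\<^sub>M ?P). Q (j (fst p + t, snd p))} \<in> sets (std_normal \<Otimes>\<^sub>M ?P)"
    by (rule predE) measurable
  ultimately have "AE x in std_normal. AE X in ?P. Q (j (x + t, X))"
    by (subst SP.AE_commute) (use mt in auto)
  with mt have "AE p in std_normal \<Otimes>\<^sub>M ?P. Q (j (fst p + t, snd p))"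
    by (intro SP.AE_pair_measure) auto
  moreover have "j (fst p + t, snd p) = fun_upd (j p) i (j p i + t)" for p
    by (simp add: j_def split_beta)
  ultimately have "AE p in std_normal \<Otimes>\<^sub>M ?P. Q (fun_upd (j p) i (j p i + t))" by simp
  then have "AE \<omega> in distr (std_normal \<Otimes>\<^sub>M ?P) gauss_space j. Q (fun_upd \<omega> i (\<omega> i + t))"
    using measurable_compose[OF upd Q'] by (subst AE_distr_iff) (auto simp: pred_def)
  then show ?thesis by (subst G)
qed

lemma integrable_abs_gauss: "integrable gauss_space (\<lambda>\<omega>. \<bar>\<omega> i\<bar>)"
proof -
  have "integrable std_normal (\<lambda>x. x ^ 1)"
    using integrable_std_normal_moment[of 1] by (subst integrable_density) (auto simp: mult.commute)
  then have "integrable (distr gauss_space borel (\<lambda>\<omega>. \<omega> i)) (\<lambda>x. x)"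
    unfolding distr_gauss_component by simp
  then show ?thesis by (subst (asm) integrable_distr_eq) auto
qed

lemma integral_abs_gauss: "(\<integral>\<omega>. \<bar>\<omega> i\<bar> \<partial>gauss_space) = (\<integral>x. \<bar>x\<bar> \<partial>std_normal)"
  using integral_distr[of "\<lambda>\<omega>. \<omega> i" gauss_space borel "\<lambda>x. \<bar>x\<bar>"]
  by (simp add: distr_gauss_component)

subsection \<open>The Gaussian random series\<close>

lemma bounded_cfunctional_bounded_linear:
  assumes "bounded_cfunctional f" shows "bounded_linear f"
proof -
  obtain K where "\<forall>x. norm (f x) \<le> K * norm x" using assms by (auto simp: bounded_cfunctional_def)
  then show ?thesis using assms
    by (intro bounded_linear_intro[where K=K])
       (auto simp: bounded_cfunctional_def scaleR_scaleC scaleR_conv_of_real mult.commute)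
qed

lemma bounded_cfunctional_scaleC: "bounded_cfunctional f \<Longrightarrow> f (scaleC c x) = c * f x"
  by (simp add: bounded_cfunctional_def)

lemma bounded_cfunctional_cinner: "bounded_cfunctional (cinner x)"
  unfolding bounded_cfunctional_def
  by (auto simp: cinner.add_right cinner.scale_right intro!: exI[of _ "norm x"] Cauchy_Schwarz_cinner)

lemma bounded_cfunctional_add:
  assumes "bounded_cfunctional f" "bounded_cfunctional g" shows "bounded_cfunctional (\<lambda>x. f x + g x)"
proof -
  obtain K L where "\<forall>x. norm (f x) \<le> K * norm x" "\<forall>x. norm (g x) \<le> L * norm x"
    using assms by (auto simp: bounded_cfunctional_def)
  then have "\<forall>x. norm (f x + g x) \<le> (K + L) * norm x"
    by (metis add_mono distrib_right norm_triangle_le)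
  with assms show ?thesis unfolding bounded_cfunctional_def
    by (intro conjI exI[of _ "K + L"]) (simp_all add: distrib_left)
qed

lemma bounded_cfunctional_mult:
  assumes "bounded_cfunctional f" shows "bounded_cfunctional (\<lambda>x. c * f x)"
proof -
  obtain K where "\<forall>x. norm (f x) \<le> K * norm x" using assms by (auto simp: bounded_cfunctional_def)
  then have "\<forall>x. norm (c * f x) \<le> (cmod c * K) * norm x"
    by (simp add: norm_mult mult.assoc mult_left_mono)
  with assms show ?thesis unfolding bounded_cfunctional_def
    by (intro conjI exI[of _ "cmod c * K"]) (simp_all add: distrib_left)
qed

context hilbert_basis
begin

lemma functional_bound:
  assumes "bounded_cfunctional f" obtains K where "\<And>n. cmod (f (e n)) \<le> K"
  using assms norm_e by (metis bounded_cfunctional_def mult.right_neutral)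

lemma functional_zero:
  assumes "bounded_cfunctional f" "\<And>n. f (e n) = 0" shows "f x = 0"
proof -
  have "(\<lambda>k. f (scaleC (cinner (e k) x) (e k))) sums f x"
    by (rule bounded_linear.sums[OF bounded_cfunctional_bounded_linear[OF assms(1)] expansion])
  then show ?thesis using assms by (simp add: bounded_cfunctional_scaleC sums_iff)
qed

end

text \<open>The matrix \<open>a\<close> is a Cholesky factor of the Gram matrix of the monomials; it
  turns independent Gaussians into a sequence with spectral measure \<open>\<sigma>\<close>. The
  factorisation is given as an identity of quadratic forms at each size N, the form in which
  characteristic functions of finite combinations ask for it.\<close>

locale gaussian_series = continuous_circle_measure \<sigma> + hilbert_basis e
  for \<sigma> :: "complex measure" and e :: "nat \<Rightarrow> 'h::complex_hilbert" +
  fixes a :: "nat \<Rightarrow> nat \<Rightarrow> complex"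
  assumes separable: "separable_type TYPE('h)"
    and triangular: "n < k \<Longrightarrow> a n k = 0"
    and cholesky: "(\<Sum>k<N. (cmod (\<Sum>n<N. b n * a n k))\<^sup>2) = (\<integral>z. (cmod (\<Sum>n<N. b n * z ^ n))\<^sup>2 \<partial>\<sigma>)"
begin

definition q :: "nat \<Rightarrow> real" where "q n = (1 / sqrt 2) ^ n"

text \<open>The Boolean selects the real (\<open>False\<close>) or imaginary (\<open>True\<close>)
  part. Both are standard normal, so the expectation of |g k|^2 is 2; this is the factor 2 in the
  covariance of the \<open>X n\<close>.\<close>

definition g :: "nat \<Rightarrow> (nat \<times> bool \<Rightarrow> real) \<Rightarrow> complex" where
  "g k \<omega> = Complex (\<omega> (k, False)) (\<omega> (k, True))"

definition X :: "nat \<Rightarrow> (nat \<times> bool \<Rightarrow> real) \<Rightarrow> complex" where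
  "X n \<omega> = (\<Sum>k\<le>n. a n k * g k \<omega>)"

text \<open>Absolute convergence of the random series, written as an extended sum so that
  measurability is immediate. Off this almost sure event \<open>\<xi>\<close> is set to 0.\<close>

definition good :: "(nat \<times> bool \<Rightarrow> real) \<Rightarrow> bool" where
  "good \<omega> \<longleftrightarrow> (\<Sum>n. ennreal (q n * cmod (X n \<omega>))) \<noteq> \<top>"

definition \<xi> :: "(nat \<times> bool \<Rightarrow> real) \<Rightarrow> 'h" where
  "\<xi> \<omega> = (if good \<omega> then (\<Sum>n. scaleC (of_real (q n) * X n \<omega>) (e n)) else 0)"

definition law :: "'h measure" where "law = distr gauss_space borel \<xi>"

lemma q_nonneg [simp]: "q n \<ge> 0" by (simp add: q_def)

lemma summable_q: "summable q"
  unfolding q_def by (intro summable_geometric) simp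

text \<open>Row \<open>n\<close> is a unit vector: \<open>z ^ n\<close> has modulus 1 on the circle,
  and \<open>cholesky\<close> is applied to the coordinate vector \<open>b\<close> at size n +
  1.\<close>

lemma a_le: "cmod (a n k) \<le> 1"
proof (cases "k \<le> n")
  case True
  define b where "b j = (if j = n then 1 else 0 :: complex)" for j
  have s: "(\<Sum>j<Suc n. b j * c j) = c n" for c :: "nat \<Rightarrow> complex"
  proof -
    have "(\<Sum>j<Suc n. b j * c j) = (\<Sum>j<Suc n. if j = n then c n else 0)"
      by (rule sum.cong) (auto simp: b_def)
    then show ?thesis by simp
  qed
  have "(\<Sum>k<Suc n. (cmod (a n k))\<^sup>2) = (\<integral>z. (cmod (z ^ n))\<^sup>2 \<partial>\<sigma>)"
    using cholesky[where N="Suc n" and b=b] by (simp only: s)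
  also have "\<dots> = (\<integral>z. 1 \<partial>\<sigma>)"
    by (rule Bochner_Integration.integral_cong) (auto simp: norm_power)
  also have "\<dots> = 1" using prob_space by simp
  finally have "(\<Sum>k<Suc n. (cmod (a n k))\<^sup>2) = 1" .
  moreover have "(cmod (a n k))\<^sup>2 \<le> (\<Sum>k<Suc n. (cmod (a n k))\<^sup>2)"
    by (rule member_le_sum) (use True in auto)
  ultimately have "(cmod (a n k))\<^sup>2 \<le> 1\<^sup>2" by simp
  then show ?thesis by (rule power2_le_imp_le) simp
qed (simp add: triangular)

lemma X_eq: "n < N \<Longrightarrow> X n \<omega> = (\<Sum>k<N. a n k * g k \<omega>)"
  unfolding X_def by (rule sum.mono_neutral_left) (auto simp: triangular)

lemma g_measurable [measurable]: "g k \<in> borel_measurable gauss_space"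
proof -
  have "g k = (\<lambda>\<omega>. complex_of_real (\<omega> (k, False)) + \<i> * complex_of_real (\<omega> (k, True)))"
    by (auto simp: g_def complex_eq_iff)
  then show ?thesis by simp
qed

lemma X_measurable [measurable]: "X n \<in> borel_measurable gauss_space"
proof -
  have "(\<lambda>\<omega>. \<Sum>k\<le>n. a n k * g k \<omega>) \<in> borel_measurable gauss_space" by measurable
  then show ?thesis by (simp add: X_def[abs_def])
qed

lemma good_measurable [measurable]: "Measurable.pred gauss_space good"
  unfolding good_def[abs_def] by measurable

text \<open>First moments suffice. Entries of \<open>a\<close> are at most 1 in modulus, so the
  expectation of |X n| is at most 2 C (n+1), with C the mean of a standard normal in absolute value.
  This linear growth is summable against the geometric weights.\<close>

lemma AE_good: "AE \<omega> in gauss_space. good \<omega>"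
proof -
  define C where "C = (\<integral>x. \<bar>x\<bar> \<partial>std_normal)"
  have C0: "C \<ge> 0" by (simp add: C_def)
  have EX: "(\<integral>\<^sup>+\<omega>. ennreal (q n * cmod (X n \<omega>)) \<partial>gauss_space) \<le> ennreal (2 * C * (real (Suc n) * q n))" for n
  proof -
    let ?F = "\<lambda>\<omega> k. \<bar>\<omega> (k, False)\<bar> + \<bar>\<omega> (k, True)\<bar>"
    have b: "q n * cmod (X n \<omega>) \<le> q n * (\<Sum>k\<le>n. ?F \<omega> k)" for \<omega>
    proof -
      have "cmod (X n \<omega>) \<le> (\<Sum>k\<le>n. cmod (a n k * g k \<omega>))" unfolding X_def by (rule norm_sum)
      also have "\<dots> \<le> (\<Sum>k\<le>n. ?F \<omega> k)"
      proof (rule sum_mono)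
        fix k
        have "cmod (a n k) * cmod (g k \<omega>) \<le> 1 * cmod (g k \<omega>)" by (rule mult_right_mono[OF a_le]) simp
        also have "\<dots> \<le> ?F \<omega> k" using cmod_le[of "g k \<omega>"] by (simp add: g_def)
        finally show "cmod (a n k * g k \<omega>) \<le> ?F \<omega> k" by (simp add: norm_mult)
      qed
      finally show ?thesis by (rule mult_left_mono) simp
    qed
    have i: "integrable gauss_space (\<lambda>\<omega>. q n * (\<Sum>k\<le>n. ?F \<omega> k))"
      by (intro integrable_mult_right Bochner_Integration.integrable_sum Bochner_Integration.integrable_add integrable_abs_gauss)
    have "(\<integral>\<^sup>+\<omega>. ennreal (q n * cmod (X n \<omega>)) \<partial>gauss_space) \<le> (\<integral>\<^sup>+\<omega>. ennreal (q n * (\<Sum>k\<le>n. ?F \<omega> k)) \<partial>gauss_space)"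
      by (intro nn_integral_mono ennreal_leI b)
    also have "\<dots> = ennreal (\<integral>\<omega>. q n * (\<Sum>k\<le>n. ?F \<omega> k) \<partial>gauss_space)"
      by (rule nn_integral_eq_integral[OF i]) (intro AE_I2 mult_nonneg_nonneg sum_nonneg, auto)
    also have "(\<integral>\<omega>. q n * (\<Sum>k\<le>n. ?F \<omega> k) \<partial>gauss_space) = q n * (\<Sum>k\<le>n. C + C)"
      by (simp add: integrable_abs_gauss integral_abs_gauss C_def)
    finally show ?thesis by (simp add: algebra_simps)
  qed
  have sm: "summable (\<lambda>n. 2 * C * (real (Suc n) * q n))"
    unfolding q_def using geometric_deriv_sums[of "1 / sqrt 2 :: real"] by (intro summable_mult) (auto simp: sums_iff)
  have "(\<integral>\<^sup>+\<omega>. (\<Sum>n. ennreal (q n * cmod (X n \<omega>))) \<partial>gauss_space)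
      = (\<Sum>n. \<integral>\<^sup>+\<omega>. ennreal (q n * cmod (X n \<omega>)) \<partial>gauss_space)"
    by (rule nn_integral_suminf) measurable
  also have "\<dots> \<le> (\<Sum>n. ennreal (2 * C * (real (Suc n) * q n)))"
    by (intro suminf_le EX summableI)
  also have "\<dots> = ennreal (\<Sum>n. 2 * C * (real (Suc n) * q n))"
    by (rule suminf_ennreal2) (use sm C0 in auto)
  also have "\<dots> < \<top>" by simp
  finally have "(\<integral>\<^sup>+\<omega>. (\<Sum>n. ennreal (q n * cmod (X n \<omega>))) \<partial>gauss_space) \<noteq> \<infinity>" by simp
  then have "AE \<omega> in gauss_space. (\<Sum>n. ennreal (q n * cmod (X n \<omega>))) \<noteq> \<infinity>"
    by (intro nn_integral_PInf_AE) measurable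
  then show ?thesis unfolding good_def infinity_ennreal_def .
qed

lemma good_summable: "good \<omega> \<Longrightarrow> summable (\<lambda>n. q n * cmod (X n \<omega>))"
  unfolding good_def by (intro summable_suminf_not_top) auto

lemma summable_good: "summable (\<lambda>n. q n * cmod (X n \<omega>)) \<Longrightarrow> good \<omega>"
  unfolding good_def by (subst suminf_ennreal2) auto

lemma summable_series: "good \<omega> \<Longrightarrow> summable (\<lambda>n. scaleC (of_real (q n) * X n \<omega>) (e n))"
  by (rule summable_norm_cancel) (use good_summable in \<open>simp add: norm_mult\<close>)

lemma functional_\<xi>:
  assumes "bounded_cfunctional f" "good \<omega>"
  shows "(\<lambda>n. f (e n) * of_real (q n) * X n \<omega>) sums f (\<xi> \<omega>)"
proof -
  have "(\<lambda>n. f (scaleC (of_real (q n) * X n \<omega>) (e n))) sums f (\<xi> \<omega>)"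
    using bounded_linear.sums[OF bounded_cfunctional_bounded_linear[OF assms(1)]
        summable_sums[OF summable_series[OF assms(2)]]] assms(2) by (simp add: \<xi>_def)
  then show ?thesis by (simp add: bounded_cfunctional_scaleC[OF assms(1)] ac_simps)
qed

lemma cinner_\<xi>: "good \<omega> \<Longrightarrow> cinner (e j) (\<xi> \<omega>) = of_real (q j) * X j \<omega>"
proof -
  assume "good \<omega>"
  from functional_\<xi>[OF bounded_cfunctional_cinner this, of "e j"]
  have "(\<lambda>n. if n = j then of_real (q n) * X n \<omega> else 0) sums cinner (e j) (\<xi> \<omega>)"
    by (rule sums_cong[THEN iffD1, rotated]) (simp add: orthonormal)
  moreover have "(\<lambda>n. if n = j then of_real (q n) * X n \<omega> else 0) sums (of_real (q j) * X j \<omega>)"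
    by (rule sums_single)
  ultimately show ?thesis by (rule sums_unique2)
qed

lemma \<xi>_measurable [measurable]: "\<xi> \<in> borel_measurable gauss_space"
proof (rule borel_measurable_coordinates[OF separable])
  fix j
  have "(\<lambda>\<omega>. cinner (e j) (\<xi> \<omega>)) = (\<lambda>\<omega>. if good \<omega> then of_real (q j) * X j \<omega> else 0)"
  proof
    fix \<omega>
    show "cinner (e j) (\<xi> \<omega>) = (if good \<omega> then of_real (q j) * X j \<omega> else 0)"
      by (cases "good \<omega>") (simp add: cinner_\<xi>, simp add: \<xi>_def)
  qed
  also have "\<dots> \<in> borel_measurable gauss_space" by measurable
  finally show "(\<lambda>\<omega>. cinner (e j) (\<xi> \<omega>)) \<in> borel_measurable gauss_space" .
qed

lemma sets_law [simp]: "sets law = sets borel" and space_law [simp]: "space law = UNIV"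
  by (auto simp: law_def)

lemma prob_space_law: "prob_space law"
  unfolding law_def by (rule gauss_space.prob_space_distr) simp

lemma char_finite:
  "(\<integral>\<omega>. cis (Re (\<Sum>n<N. b n * X n \<omega>)) \<partial>gauss_space)
     = of_real (exp (- (\<integral>z. (cmod (\<Sum>n<N. b n * z ^ n))\<^sup>2 \<partial>\<sigma>) / 2))"
proof -
  define c where "c k = (\<Sum>n<N. b n * a n k)" for k
  \<comment> \<open>Re (c g) = Re c Re g - Im c Im g displays the real part as a combination of
    independent real coordinates. The squares of the coefficients add up to the
    \<open>|c k|^2\<close>.\<close>
  define r where "r = (\<lambda>(k, t). if t then - Im (c k) else Re (c k))"
  have "(\<Sum>n<N. b n * X n \<omega>) = (\<Sum>k<N. c k * g k \<omega>)" for \<omega>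
  proof -
    have "(\<Sum>n<N. b n * X n \<omega>) = (\<Sum>n<N. \<Sum>k<N. b n * a n k * g k \<omega>)"
      by (intro sum.cong refl) (simp add: X_eq sum_distrib_left mult.assoc)
    also have "\<dots> = (\<Sum>k<N. \<Sum>n<N. b n * a n k * g k \<omega>)" by (rule sum.swap)
    finally show ?thesis by (simp add: c_def sum_distrib_right)
  qed
  then have "Re (\<Sum>n<N. b n * X n \<omega>) = (\<Sum>k<N. \<Sum>t\<in>UNIV. r (k, t) * \<omega> (k, t))" for \<omega>
    by (simp add: r_def UNIV_bool g_def)
  then have 1: "Re (\<Sum>n<N. b n * X n \<omega>) = (\<Sum>i\<in>{..<N} \<times> UNIV. r i * \<omega> i)" for \<omega>
    by (simp add: sum.cartesian_product split_beta')
  have "(\<Sum>i\<in>{..<N} \<times> UNIV. (r i)\<^sup>2) = (\<Sum>k<N. \<Sum>t\<in>UNIV. (r (k, t))\<^sup>2)"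
    by (simp add: sum.cartesian_product split_beta')
  also have "\<dots> = (\<Sum>k<N. (cmod (c k))\<^sup>2)"
    by (simp add: r_def UNIV_bool cmod_power2 add.commute)
  also have "\<dots> = (\<integral>z. (cmod (\<Sum>n<N. b n * z ^ n))\<^sup>2 \<partial>\<sigma>)" unfolding c_def by (rule cholesky)
  finally show ?thesis unfolding 1 by (subst gauss_space_char) auto
qed

definition \<Phi> :: "('h \<Rightarrow> complex) \<Rightarrow> complex \<Rightarrow> complex" where
  "\<Phi> f = symbol (\<lambda>n. f (e n))"

lemma \<Phi>_continuous: "bounded_cfunctional f \<Longrightarrow> continuous_on circle (\<Phi> f)"
  unfolding \<Phi>_def by (erule functional_bound) (rule symbol_continuous)

lemma \<Phi>_sums:
  assumes "bounded_cfunctional f" "z \<in> circle"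
  shows "(\<lambda>n. (f (e n) * of_real (q n)) * z ^ n) sums \<Phi> f z"
proof -
  obtain K where K: "\<And>n. cmod (f (e n)) \<le> K" using functional_bound[OF assms(1)] by blast
  show ?thesis using symbol_sums[of "\<lambda>n. f (e n)" K z, OF K] assms(2) unfolding \<Phi>_def q_def by simp
qed

lemma L2_limit:
  assumes f: "bounded_cfunctional f"
  shows "(\<lambda>N. \<integral>z. (cmod (\<Sum>n<N. (f (e n) * of_real (q n)) * z ^ n))\<^sup>2 \<partial>\<sigma>) \<longlonglongrightarrow> (\<integral>z. (cmod (\<Phi> f z))\<^sup>2 \<partial>\<sigma>)"
proof -
  obtain K where K: "\<And>n. cmod (f (e n)) \<le> K" using functional_bound[OF assms(1)] by blast
  have K0: "K \<ge> 0" using K[of 0] norm_ge_zero order_trans by blast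
  have s: "summable (\<lambda>n. K * q n)" by (intro summable_mult summable_q)
  show ?thesis
  proof (rule integral_dominated_convergence[where w="\<lambda>_. (\<Sum>n. K * q n)\<^sup>2"])
    show "(\<lambda>z. (cmod (\<Phi> f z))\<^sup>2) \<in> borel_measurable \<sigma>"
      by (intro continuous_measurable continuous_intros \<Phi>_continuous f)
    show "(\<lambda>z. (cmod (\<Sum>n<N. (f (e n) * of_real (q n)) * z ^ n))\<^sup>2) \<in> borel_measurable \<sigma>" for N
      by (intro continuous_measurable continuous_intros)
    show "AE z in \<sigma>. (\<lambda>N. (cmod (\<Sum>n<N. (f (e n) * of_real (q n)) * z ^ n))\<^sup>2) \<longlonglongrightarrow> (cmod (\<Phi> f z))\<^sup>2"
      by (intro AE_I2 tendsto_intros) (use \<Phi>_sums[OF f] in \<open>auto simp: sums_def\<close>)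
    show "AE z in \<sigma>. norm ((cmod (\<Sum>n<N. (f (e n) * of_real (q n)) * z ^ n))\<^sup>2) \<le> (\<Sum>n. K * q n)\<^sup>2" for N
    proof (rule AE_I2)
      fix z assume "z \<in> space \<sigma>"
      then have z: "cmod z = 1" by simp
      have "cmod (\<Sum>n<N. (f (e n) * of_real (q n)) * z ^ n) \<le> (\<Sum>n<N. K * q n)"
        by (rule sum_norm_le) (use z K in \<open>auto simp: norm_mult norm_power intro!: mult_right_mono\<close>)
      also have "\<dots> \<le> (\<Sum>n. K * q n)" by (rule sum_le_suminf[OF s]) (use K0 in auto)
      finally show "norm ((cmod (\<Sum>n<N. (f (e n) * of_real (q n)) * z ^ n))\<^sup>2) \<le> (\<Sum>n. K * q n)\<^sup>2"
        by (simp add: power_mono)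
    qed
  qed simp
qed

lemma functional_measurable: "bounded_cfunctional f \<Longrightarrow> f \<in> borel_measurable borel"
  by (intro borel_measurable_continuous_onI linear_continuous_on bounded_cfunctional_bounded_linear)

text \<open>Both sides are limits along partial sums: on the left the bounded continuous
  \<open>cis\<close> follows the almost sure convergence of the series, on the right the partial
  sums of the symbol converge in L2(\<open>\<sigma>\<close>).\<close>

theorem law_char:
  assumes f: "bounded_cfunctional f"
  shows "(\<integral>x. cis (Re (f x)) \<partial>law) = of_real (exp (- (\<integral>z. (cmod (\<Phi> f z))\<^sup>2 \<partial>\<sigma>) / 2))"
proof -
  define b where "b n = f (e n) * of_real (q n)" for n
  have [measurable]: "f \<in> borel_measurable borel" by (rule functional_measurable[OF f])
  have "(\<integral>x. cis (Re (f x)) \<partial>law) = (\<integral>\<omega>. cis (Re (f (\<xi> \<omega>))) \<partial>gauss_space)"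
    unfolding law_def by (rule integral_distr) measurable
  also have "\<dots> = of_real (exp (- (\<integral>z. (cmod (\<Phi> f z))\<^sup>2 \<partial>\<sigma>) / 2))"
  proof (rule LIMSEQ_unique)
    show "(\<lambda>N. \<integral>\<omega>. cis (Re (\<Sum>n<N. b n * X n \<omega>)) \<partial>gauss_space) \<longlonglongrightarrow> (\<integral>\<omega>. cis (Re (f (\<xi> \<omega>))) \<partial>gauss_space)"
    proof (rule integral_dominated_convergence[where w="\<lambda>_. 1"])
      show "AE \<omega> in gauss_space. (\<lambda>N. cis (Re (\<Sum>n<N. b n * X n \<omega>))) \<longlonglongrightarrow> cis (Re (f (\<xi> \<omega>)))"
        using AE_good
      proof eventually_elim
        case (elim \<omega>)
        have "(\<lambda>N. Re (\<Sum>n<N. b n * X n \<omega>)) \<longlonglongrightarrow> Re (f (\<xi> \<omega>))"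
          using functional_\<xi>[OF f elim] unfolding sums_def b_def by (rule tendsto_Re)
        moreover have "isCont cis x" for x
          using continuous_on_cis[OF continuous_on_id, of UNIV] by (simp add: continuous_on_eq_continuous_at)
        ultimately show ?case by (rule isCont_tendsto_compose[rotated])
      qed
    qed auto
    show "(\<lambda>N. \<integral>\<omega>. cis (Re (\<Sum>n<N. b n * X n \<omega>)) \<partial>gauss_space) \<longlonglongrightarrow> of_real (exp (- (\<integral>z. (cmod (\<Phi> f z))\<^sup>2 \<partial>\<sigma>) / 2))"
      unfolding char_finite by (intro tendsto_intros) (use L2_limit[OF f] in \<open>auto simp: b_def\<close>)
  qed
  finally show ?thesis .
qed

end

subsection \<open>Non-degeneracy\<close>

context gaussian_series
begin

text \<open>The direction in which \<open>\<xi>\<close> moves when the single Gaussian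
  \<open>g k\<close> is changed: column \<open>k\<close> of the Cholesky factor with the damping
  weights.\<close>

definition V :: "nat \<Rightarrow> 'h" where
  "V k = (\<Sum>n. scaleC (of_real (q n) * a n k) (e n))"

lemma summable_V: "summable (\<lambda>n. scaleC (of_real (q n) * a n k) (e n))"
proof (rule summable_norm_cancel, rule summable_comparison_test[OF _ summable_q])
  show "\<exists>N. \<forall>n\<ge>N. norm (norm (scaleC (of_real (q n) * a n k) (e n))) \<le> q n"
    using a_le by (auto simp: norm_mult intro!: mult_left_le)
qed

lemma X_shift:
  "X n (fun_upd \<omega> (k, b) (\<omega> (k, b) + t)) = X n \<omega> + a n k * (of_real t * (if b then \<i> else 1))"
proof -
  define u where "u = complex_of_real t * (if b then \<i> else 1)"
  have g: "g j (fun_upd \<omega> (k, b) (\<omega> (k, b) + t)) = g j \<omega> + (if j = k then u else 0)" for j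
    by (auto simp: g_def u_def complex_eq_iff)
  have "X n (fun_upd \<omega> (k, b) (\<omega> (k, b) + t)) = X n \<omega> + (\<Sum>j\<le>n. if j = k then a n k * u else 0)"
    unfolding X_def g distrib_left sum.distrib by (simp add: if_distrib cong: if_cong)
  then show ?thesis using triangular[of n k] by (auto simp: u_def)
qed

text \<open>\<open>\<xi>\<close> is linear in the coordinates wherever its series converges, and
  moving one coordinate stays within the good event because the entries of \<open>a\<close> are
  bounded and \<open>q\<close> is summable.\<close>

lemma \<xi>_shift:
  assumes "good \<omega>"
  shows "\<xi> (fun_upd \<omega> (k, b) (\<omega> (k, b) + t)) = \<xi> \<omega> + scaleC (of_real t * (if b then \<i> else 1)) (V k)"
proof -
  define u where "u = complex_of_real t * (if b then \<i> else 1)"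
  let ?\<omega> = "fun_upd \<omega> (k, b) (\<omega> (k, b) + t)"
  have X: "X n ?\<omega> = X n \<omega> + a n k * u" for n unfolding u_def by (rule X_shift)
  have "good ?\<omega>"
  proof (rule summable_good, rule summable_comparison_test)
    show "summable (\<lambda>n. q n * cmod (X n \<omega>) + q n * cmod u)"
      by (intro summable_add good_summable assms summable_mult2 summable_q)
    have "norm (q n * cmod (X n ?\<omega>)) \<le> q n * cmod (X n \<omega>) + q n * cmod u" for n
    proof -
      have "cmod (X n ?\<omega>) \<le> cmod (X n \<omega>) + cmod (a n k) * cmod u"
        unfolding X by (metis norm_triangle_ineq norm_mult)
      also have "\<dots> \<le> cmod (X n \<omega>) + 1 * cmod u" by (intro add_left_mono mult_right_mono a_le) simp
      finally have "cmod (X n ?\<omega>) \<le> cmod (X n \<omega>) + cmod u" by simp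
      then have "q n * cmod (X n ?\<omega>) \<le> q n * (cmod (X n \<omega>) + cmod u)" by (rule mult_left_mono) simp
      then show ?thesis by (simp add: distrib_left)
    qed
    then show "\<exists>N. \<forall>n\<ge>N. norm (q n * cmod (X n ?\<omega>)) \<le> q n * cmod (X n \<omega>) + q n * cmod u" by blast
  qed
  moreover have "(\<lambda>n. scaleC (of_real (q n) * X n ?\<omega>) (e n)) sums (\<xi> \<omega> + scaleC u (V k))"
  proof -
    have bl: "bounded_linear (\<lambda>x. scaleC u (x::'h))"
      by (rule bounded_linear_intro[where K="cmod u"])
         (auto simp: scaleC_add_right scaleR_scaleC scaleC_scaleC mult.commute)
    have "(\<lambda>n. scaleC (of_real (q n) * X n \<omega>) (e n) + scaleC u (scaleC (of_real (q n) * a n k) (e n)))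
        sums (\<xi> \<omega> + scaleC u (V k))"
      using summable_sums[OF summable_series[OF assms]] assms
      by (intro sums_add bounded_linear.sums[OF bl]) (auto simp: \<xi>_def V_def intro!: summable_sums summable_V)
    then show ?thesis unfolding X by (simp add: scaleC_add_left[symmetric] scaleC_scaleC algebra_simps)
  qed
  ultimately show ?thesis unfolding \<xi>_def[of ?\<omega>] u_def by (simp add: sums_iff)
qed

lemma q_add: "q (m + n) = q m * q n"
  by (simp add: q_def power_add)

text \<open>Orthogonality to \<open>V k\<close> means that the full series over n of
  \<open>b n * a n k\<close> is 0, so its truncation at N is minus a tail, of size at most C q N.
  Summing the squares over k < N gives at most C^2 N 2^(-N), while by \<open>cholesky\<close> this
  sum is the squared L2 norm of the truncated symbol. Hence the symbol is null and
  \<open>symbol_zero\<close> applies.\<close>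

lemma V_complement:
  assumes "\<And>k. cinner (V k) x = 0" shows "x = 0"
proof -
  define f where "f = cinner x"
  have f: "bounded_cfunctional f" unfolding f_def by (rule bounded_cfunctional_cinner)
  obtain K where K: "\<And>n. cmod (f (e n)) \<le> K" using functional_bound[OF f] by blast
  have K0: "K \<ge> 0" using K[of 0] norm_ge_zero order_trans by blast
  define b where "b n = f (e n) * of_real (q n)" for n
  define C where "C = K * (\<Sum>n. q n)"
  have sK: "summable (\<lambda>n. K * q n)" by (intro summable_mult summable_q)
  have ba: "cmod (b n * a n k) \<le> K * q n" for n k
  proof -
    have "cmod (b n) * cmod (a n k) \<le> (K * q n) * 1"
      using K[of n] a_le[of n k] K0 by (intro mult_mono) (auto simp: b_def norm_mult intro!: mult_right_mono)
    then show ?thesis by (simp add: norm_mult)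
  qed
  have sba: "summable (\<lambda>n. b n * a n k)" for k
    by (rule summable_comparison_test[OF _ sK]) (use ba in auto)
  have tail: "cmod (\<Sum>n<N. b n * a n k) \<le> C * q N" for N k
  proof -
    have "f (V k) = 0" using assms[of k] cinner_commute[of x "V k"] by (simp add: f_def)
    moreover have "(\<lambda>n. f (scaleC (of_real (q n) * a n k) (e n))) sums f (V k)"
      unfolding V_def by (intro bounded_linear.sums[OF bounded_cfunctional_bounded_linear[OF f]] summable_sums summable_V)
    ultimately have "(\<lambda>n. b n * a n k) sums 0"
      by (simp add: bounded_cfunctional_scaleC[OF f] b_def ac_simps)
    then have "(\<Sum>n. b n * a n k) = 0" by (simp add: sums_iff)
    then have "(\<Sum>n<N. b n * a n k) = - (\<Sum>n. b (n + N) * a (n + N) k)"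
      using suminf_split_initial_segment[OF sba[of k], of N] by (simp add: add_eq_0_iff add.commute)
    then have "cmod (\<Sum>n<N. b n * a n k) = cmod (\<Sum>n. b (n + N) * a (n + N) k)" by simp
    also have "\<dots> \<le> (\<Sum>n. K * q (n + N))"
      using sK by (intro norm_suminf_le ba) (simp only: summable_iff_shift[of "\<lambda>n. K * q n"])
    also have "\<dots> = (\<Sum>n. (K * q N) * q n)" by (simp add: q_add ac_simps)
    also have "\<dots> = (K * q N) * (\<Sum>n. q n)" by (rule suminf_mult[OF summable_q])
    finally show ?thesis by (simp add: C_def ac_simps)
  qed
  have bound: "(\<Sum>k<N. (cmod (\<Sum>n<N. b n * a n k))\<^sup>2) \<le> C\<^sup>2 * (real N * (1/2) ^ N)" for N
  proof -
    have "(\<Sum>k<N. (cmod (\<Sum>n<N. b n * a n k))\<^sup>2) \<le> (\<Sum>k<N. (C * q N)\<^sup>2)"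
      by (intro sum_mono power_mono tail) auto
    also have "(q N)\<^sup>2 = (1/2) ^ N"
      unfolding q_def by (subst power_mult[symmetric], subst mult.commute, subst power_mult) (simp add: power_divide)
    then have "(\<Sum>k<N. (C * q N)\<^sup>2) = C\<^sup>2 * (real N * (1/2) ^ N)" by (simp add: power_mult_distrib)
    finally show ?thesis .
  qed
  have "(\<lambda>N. C\<^sup>2 * (real N * (1/2) ^ N)) \<longlonglongrightarrow> C\<^sup>2 * 0"
    by (intro tendsto_mult tendsto_const powser_times_n_limit_0[of "1/2 :: real"]) simp
  then have "(\<lambda>N. \<Sum>k<N. (cmod (\<Sum>n<N. b n * a n k))\<^sup>2) \<longlonglongrightarrow> 0"
    by (intro Lim_null_comparison[where f="\<lambda>N. \<Sum>k<N. (cmod (\<Sum>n<N. b n * a n k))\<^sup>2"] always_eventually allI)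
       (use bound in \<open>auto simp: sum_nonneg\<close>)
  then have "(\<lambda>N. \<integral>z. (cmod (\<Sum>n<N. b n * z ^ n))\<^sup>2 \<partial>\<sigma>) \<longlonglongrightarrow> 0" unfolding cholesky .
  then have "(\<integral>z. (cmod (\<Phi> f z))\<^sup>2 \<partial>\<sigma>) = 0"
    using L2_limit[OF f] LIMSEQ_unique unfolding b_def by blast
  then have "f (e n) = 0" for n
    unfolding \<Phi>_def using symbol_zero[of "\<lambda>n. f (e n)" K n, OF K] by simp
  then have "f x = 0" by (rule functional_zero[OF f])
  then show ?thesis by (simp add: f_def)
qed

text \<open>Absolute continuity of the translated law with respect to the law, in one direction
  only. This form is stable under addition of directions.\<close>

definition quasi_invariant :: "'h \<Rightarrow> bool" where
  "quasi_invariant v \<longleftrightarrow> (\<forall>W\<in>sets borel. (AE x in law. x \<notin> W) \<longrightarrow> (AE x in law. x + v \<notin> W))"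

lemma translation_measurable: "(\<lambda>x. x + v) \<in> borel_measurable (borel :: 'h measure)"
  by (intro borel_measurable_continuous_onI continuous_intros)

lemma translation_sets: "W \<in> sets borel \<Longrightarrow> {x. x + v \<in> W} \<in> sets (borel :: 'h measure)"
  using measurable_sets[OF translation_measurable, of W v] by (simp add: vimage_def)

lemma quasi_invariant_add:
  assumes "quasi_invariant v" "quasi_invariant w" shows "quasi_invariant (v + w)"
  unfolding quasi_invariant_def
proof (intro ballI impI)
  fix W :: "'h set" assume W: "W \<in> sets borel" "AE x in law. x \<notin> W"
  then have "AE x in law. x \<notin> {x. x + w \<in> W}" using assms(2) by (auto simp: quasi_invariant_def)
  then have "AE x in law. x + v \<notin> {x. x + w \<in> W}"
    using assms(1) translation_sets[OF W(1)] unfolding quasi_invariant_def by blast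
  then show "AE x in law. x + (v + w) \<notin> W" by (simp add: add.assoc)
qed

text \<open>Moving the real and the imaginary coordinate of \<open>g k\<close> realises the
  multiples of \<open>V k\<close> by t and by t i; composing the two gives every complex
  multiple.\<close>

lemma quasi_invariant_V: "quasi_invariant (scaleC c (V k))"
proof -
  have 1: "quasi_invariant (scaleC (of_real t * (if b then \<i> else 1)) (V k))" for t b
    unfolding quasi_invariant_def
  proof (intro ballI impI)
    fix W :: "'h set" assume W[measurable]: "W \<in> sets borel" and ae: "AE x in law. x \<notin> W"
    let ?v = "scaleC (of_real t * (if b then \<i> else 1)) (V k)"
    have "AE \<omega> in gauss_space. \<xi> \<omega> \<notin> W"
      using ae unfolding law_def by (subst (asm) AE_distr_iff) auto
    moreover have "{\<omega>. \<xi> \<omega> \<notin> W} \<in> sets gauss_space"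
      using measurable_sets[OF \<xi>_measurable, of "- W"] W by (simp add: vimage_def Compl_in_sets_lebesgue)
    ultimately have "AE \<omega> in gauss_space. \<xi> (fun_upd \<omega> (k, b) (\<omega> (k, b) + t)) \<notin> W"
      by (intro AE_gauss_space_shift[where Q="\<lambda>\<omega>. \<xi> \<omega> \<notin> W"])
    with AE_good have "AE \<omega> in gauss_space. \<xi> \<omega> + ?v \<notin> W"
      by eventually_elim (simp add: \<xi>_shift)
    moreover have "{x. x + ?v \<notin> W} \<in> sets borel" using translation_sets[of "- W" ?v] W by simp
    ultimately show "AE x in law. x + ?v \<notin> W"
      unfolding law_def by (subst AE_distr_iff) auto
  qed
  have "quasi_invariant (scaleC (of_real (Re c) * 1) (V k) + scaleC (of_real (Im c) * \<i>) (V k))"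
    using 1[of "Re c" False] 1[of "Im c" True] by (intro quasi_invariant_add) auto
  moreover have "scaleC (of_real (Re c) * 1) (V k) + scaleC (of_real (Im c) * \<i>) (V k) = scaleC c (V k)"
  proof -
    have "of_real (Re c) * 1 + of_real (Im c) * \<i> = c" by (simp add: complex_eq_iff)
    then show ?thesis unfolding scaleC_add_left[symmetric] by (simp only:)
  qed
  ultimately show ?thesis by simp
qed

text \<open>If U were null, almost every x would avoid U after each of countably many
  quasi-invariant translations. By density these can be chosen so that every x is carried into U by
  one of them.\<close>

theorem law_non_degenerate: "non_degenerate law"
  unfolding non_degenerate_def
proof (intro allI impI, elim conjE)
  fix U :: "'h set" assume U: "open U" "U \<noteq> {}"
  interpret law: prob_space law by (rule prob_space_law)
  have Ub: "U \<in> sets borel" using U by simp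
  show "emeasure law U > 0"
  proof (rule ccontr)
    assume "\<not> emeasure law U > 0"
    then have "U \<in> null_sets law" using Ub by (simp add: null_setsI)
    then have null: "AE x in law. x \<notin> U" by (rule AE_not_in)
    \<comment> \<open>All complex multiples are required so that \<open>S\<close> is a subspace, as
      the density lemma demands.\<close>
    define S where "S = {v. \<forall>c. quasi_invariant (scaleC c v)}"
    have "closure S = UNIV"
    proof (rule dense_span_of_trivial_complement[OF V_complement])
      show "V k \<in> S" for k by (simp add: S_def quasi_invariant_V)
      show "x - y \<in> S" if "x \<in> S" "y \<in> S" for x y
      proof -
        have "scaleC c (x - y) = scaleC c x + scaleC (- c) y" for c
          using minus_unique[of "scaleC c y" "scaleC (- c) y"] scaleC_add_left[of c "- c" y]
          by (simp add: scaleC_diff_right flip: scaleC_add_left)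
        then show ?thesis using that quasi_invariant_add by (auto simp: S_def)
      qed
      show "scaleC c x \<in> S" if "x \<in> S" for c x
        using that by (simp add: S_def scaleC_scaleC)
    qed
    obtain u r where r: "r > 0" "ball u r \<subseteq> U" using U open_contains_ball by (metis all_not_in_conv)
    obtain D :: "'h set" where D: "countable D" "closure D = UNIV"
      using separable by (auto simp: separable_type_def)
    \<comment> \<open>Translation by nearly u - d carries a point close to \<open>d\<close> close to
      \<open>u\<close>. Only the countably many \<open>d\<close> of a dense set are needed.\<close>
    have "\<exists>s\<in>S. dist s (u - d) < r/2" for d
      using \<open>closure S = UNIV\<close> closure_approachable[of "u - d" S] r by (metis UNIV_I half_gt_zero)
    then obtain s where s: "\<And>d. s d \<in> S" "\<And>d. dist (s d) (u - d) < r/2" by metis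
    have "AE x in law. x + s d \<notin> U" for d
    proof -
      have "quasi_invariant (s d)" using s(1)[of d] unfolding S_def by (metis mem_Collect_eq scaleC_one)
      then show ?thesis using null Ub by (auto simp: quasi_invariant_def)
    qed
    then have avoid: "AE x in law. \<forall>d\<in>D. x + s d \<notin> U" using D(1) by (simp add: AE_ball_countable)
    have cover: "\<exists>d\<in>D. x + s d \<in> U" for x
    proof -
      obtain d where d: "d \<in> D" "dist d x < r/2"
        using D(2) closure_approachable[of x D] r by (metis UNIV_I half_gt_zero)
      have "dist u (x + s d) = norm ((s d - (u - d)) + (x - d))"
        by (simp add: dist_norm norm_minus_commute algebra_simps)
      also have "\<dots> \<le> norm (s d - (u - d)) + norm (x - d)" by (rule norm_triangle_ineq)
      also have "\<dots> < r" using s(2)[of d] d(2) by (simp add: dist_norm norm_minus_commute)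
      finally show ?thesis using d(1) r(2) by auto
    qed
    from avoid have "AE x in law. False"
    proof eventually_elim
      case (elim x)
      then show ?case using cover[of x] by blast
    qed
    then show False by simp
  qed
qed

end

subsection \<open>Mixing and rigidity on trigonometric polynomials\<close>

lemma (in prob_space) integral_cmod_mult_le:
  fixes u v :: "'a \<Rightarrow> complex"
  assumes "u \<in> borel_measurable M" "integrable M v" "\<And>x. x \<in> space M \<Longrightarrow> cmod (u x) \<le> K"
  shows "cmod (\<integral>x. u x * v x \<partial>M) \<le> K * (\<integral>x. cmod (v x) \<partial>M)"
proof -
  have K: "K \<ge> 0" using not_empty assms(3) norm_ge_zero order_trans by (metis ex_in_conv)
  have "cmod (\<integral>x. u x * v x \<partial>M) \<le> (\<integral>x. cmod (u x * v x) \<partial>M)" by (rule integral_norm_bound)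
  also have "\<dots> \<le> (\<integral>x. K * cmod (v x) \<partial>M)"
    by (rule integral_mono') (use assms K in \<open>auto simp: norm_mult intro!: mult_right_mono\<close>)
  finally show ?thesis by simp
qed

text \<open>Replacing \<open>a\<close> by \<open>f\<close> costs an L1 distance times the bound 1 of
  \<open>b\<close>; replacing \<open>b\<close> by \<open>h\<close> costs an L1 distance times the
  bound K of \<open>f\<close>. Invariance makes the estimate uniform in \<open>n\<close>, and the
  product of the means obeys the same bounds, whence the factors 2.\<close>

lemma (in prob_space) covariance_approx:
  fixes a b f h :: "'a \<Rightarrow> complex"
  assumes mp: "measure_preserving_map M T"
    and [measurable]: "a \<in> borel_measurable M" "b \<in> borel_measurable M" "f \<in> borel_measurable M" "h \<in> borel_measurable M"
    and a: "\<And>x. cmod (a x) \<le> 1" and b: "\<And>x. cmod (b x) \<le> 1"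
    and f: "\<And>x. cmod (f x) \<le> K" and h: "\<And>x. cmod (h x) \<le> L"
  shows "cmod (((\<integral>x. a ((T ^^ n) x) * b x \<partial>M) - (\<integral>x. a x \<partial>M) * (\<integral>x. b x \<partial>M))
      - ((\<integral>x. f ((T ^^ n) x) * h x \<partial>M) - (\<integral>x. f x \<partial>M) * (\<integral>x. h x \<partial>M)))
    \<le> 2 * (\<integral>x. cmod (a x - f x) \<partial>M) + 2 * (K * (\<integral>x. cmod (b x - h x) \<partial>M))"
proof -
  have [measurable]: "T ^^ n \<in> measurable M M" using measure_preserving_funpow[OF mp] by blast
  have int: "integrable M a" "integrable M b" "integrable M f" "integrable M h"
    using a b f h by (auto intro!: integrable_bounded_complex)
  define da where "da = (\<integral>x. cmod (a x - f x) \<partial>M)"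
  define db where "db = (\<integral>x. cmod (b x - h x) \<partial>M)"
  have K: "K \<ge> 0" using f norm_ge_zero order_trans by blast
  have bound2: "cmod (u * v) \<le> A * B" if "cmod u \<le> A" "cmod v \<le> B" for u v :: complex and A B
    unfolding norm_mult using that by (meson mult_mono norm_ge_zero order_trans)
  have intT: "integrable M (\<lambda>x. a ((T ^^ n) x) * b x)" "integrable M (\<lambda>x. f ((T ^^ n) x) * h x)"
     "integrable M (\<lambda>x. f ((T ^^ n) x) * b x)"
    by (rule integrable_bounded_complex[where K="1 * 1"], measurable, rule bound2[OF a b])
       (rule integrable_bounded_complex[where K="K * L"], measurable, rule bound2[OF f h],
        rule integrable_bounded_complex[where K="K * 1"], measurable, rule bound2[OF f b])
  have "(\<integral>x. a ((T ^^ n) x) * b x \<partial>M) - (\<integral>x. f ((T ^^ n) x) * h x \<partial>M)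
      = (\<integral>x. b x * (a ((T ^^ n) x) - f ((T ^^ n) x)) \<partial>M) + (\<integral>x. f ((T ^^ n) x) * (b x - h x) \<partial>M)"
  proof -
    have "(\<integral>x. b x * (a ((T ^^ n) x) - f ((T ^^ n) x)) \<partial>M)
        = (\<integral>x. a ((T ^^ n) x) * b x \<partial>M) - (\<integral>x. f ((T ^^ n) x) * b x \<partial>M)"
      unfolding Bochner_Integration.integral_diff[OF intT(1,3), symmetric] by (simp add: right_diff_distrib mult.commute)
    moreover have "(\<integral>x. f ((T ^^ n) x) * (b x - h x) \<partial>M)
        = (\<integral>x. f ((T ^^ n) x) * b x \<partial>M) - (\<integral>x. f ((T ^^ n) x) * h x \<partial>M)"
      unfolding Bochner_Integration.integral_diff[OF intT(3,2), symmetric] by (simp add: right_diff_distrib)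
    ultimately show ?thesis by simp
  qed
  moreover have "cmod (\<integral>x. b x * (a ((T ^^ n) x) - f ((T ^^ n) x)) \<partial>M) \<le> 1 * (\<integral>x. cmod (a ((T ^^ n) x) - f ((T ^^ n) x)) \<partial>M)"
  proof (rule integral_cmod_mult_le)
    show "integrable M (\<lambda>x. a ((T ^^ n) x) - f ((T ^^ n) x))"
      using a f by (intro Bochner_Integration.integrable_diff) (auto intro!: integrable_bounded_complex)
  qed (use b in auto)
  moreover have "(\<integral>x. cmod (a ((T ^^ n) x) - f ((T ^^ n) x)) \<partial>M) = da"
    unfolding da_def by (rule integral_measure_preserving[OF mp]) measurable
  moreover have "cmod (\<integral>x. f ((T ^^ n) x) * (b x - h x) \<partial>M) \<le> K * db"
    unfolding db_def by (rule integral_cmod_mult_le) (use f int in auto)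
  ultimately have 1: "cmod ((\<integral>x. a ((T ^^ n) x) * b x \<partial>M) - (\<integral>x. f ((T ^^ n) x) * h x \<partial>M)) \<le> da + K * db"
    by (smt (verit) norm_triangle_ineq mult_1)
  have 2: "cmod ((\<integral>x. a x \<partial>M) * (\<integral>x. b x \<partial>M) - (\<integral>x. f x \<partial>M) * (\<integral>x. h x \<partial>M)) \<le> da + K * db"
  proof -
    have "cmod (\<integral>x. a x - f x \<partial>M) \<le> da" unfolding da_def by (rule integral_norm_bound)
    then have a1: "cmod ((\<integral>x. a x \<partial>M) - (\<integral>x. f x \<partial>M)) \<le> da" using int by simp
    have "cmod (\<integral>x. b x - h x \<partial>M) \<le> db" unfolding db_def by (rule integral_norm_bound)
    then have b1: "cmod ((\<integral>x. b x \<partial>M) - (\<integral>x. h x \<partial>M)) \<le> db" using int by simp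
    have "cmod (\<integral>x. b x \<partial>M) \<le> (\<integral>x. cmod (b x) \<partial>M)" by (rule integral_norm_bound)
    also have "\<dots> \<le> 1" by (rule integral_le_const) (use b int in auto)
    finally have b2: "cmod (\<integral>x. b x \<partial>M) \<le> 1" .
    have "cmod (\<integral>x. f x \<partial>M) \<le> (\<integral>x. cmod (f x) \<partial>M)" by (rule integral_norm_bound)
    also have "\<dots> \<le> K" by (rule integral_le_const) (use f int in auto)
    finally have f2: "cmod (\<integral>x. f x \<partial>M) \<le> K" .
    have "(\<integral>x. a x \<partial>M) * (\<integral>x. b x \<partial>M) - (\<integral>x. f x \<partial>M) * (\<integral>x. h x \<partial>M)
       = ((\<integral>x. a x \<partial>M) - (\<integral>x. f x \<partial>M)) * (\<integral>x. b x \<partial>M) + (\<integral>x. f x \<partial>M) * ((\<integral>x. b x \<partial>M) - (\<integral>x. h x \<partial>M))"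
      by (simp add: algebra_simps)
    moreover have "cmod (((\<integral>x. a x \<partial>M) - (\<integral>x. f x \<partial>M)) * (\<integral>x. b x \<partial>M)) \<le> da * 1"
      by (rule bound2[OF a1 b2])
    moreover have "cmod ((\<integral>x. f x \<partial>M) * ((\<integral>x. b x \<partial>M) - (\<integral>x. h x \<partial>M))) \<le> K * db"
      by (rule bound2[OF f2 b1])
    ultimately show ?thesis by (smt (verit) norm_triangle_ineq mult.right_neutral)
  qed
  have "cmod (((\<integral>x. a ((T ^^ n) x) * b x \<partial>M) - (\<integral>x. a x \<partial>M) * (\<integral>x. b x \<partial>M))
      - ((\<integral>x. f ((T ^^ n) x) * h x \<partial>M) - (\<integral>x. f x \<partial>M) * (\<integral>x. h x \<partial>M)))
    = cmod (((\<integral>x. a ((T ^^ n) x) * b x \<partial>M) - (\<integral>x. f ((T ^^ n) x) * h x \<partial>M))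
      - ((\<integral>x. a x \<partial>M) * (\<integral>x. b x \<partial>M) - (\<integral>x. f x \<partial>M) * (\<integral>x. h x \<partial>M)))"
    by (simp add: algebra_simps)
  also have "\<dots> \<le> (da + K * db) + (da + K * db)"
    using norm_triangle_ineq4 1 2 by (meson add_mono order_trans)
  finally show ?thesis by (simp add: da_def db_def)
qed

lemma cesaro_null_comparison:
  fixes a b :: "nat \<Rightarrow> real"
  assumes "(\<lambda>N. (\<Sum>n=1..N. b n) / real N) \<longlonglongrightarrow> 0" "\<And>n. 0 \<le> a n" "\<And>n. a n \<le> C * b n"
  shows "(\<lambda>N. (\<Sum>n=1..N. a n) / real N) \<longlonglongrightarrow> 0"
proof (rule Lim_null_comparison)
  show "(\<lambda>N. C * ((\<Sum>n=1..N. b n) / real N)) \<longlonglongrightarrow> 0"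
    using tendsto_mult_right_zero[OF assms(1)] by simp
  have "norm ((\<Sum>n=1..N. a n) / real N) \<le> C * ((\<Sum>n=1..N. b n) / real N)" for N
  proof -
    have "(\<Sum>n=1..N. a n) \<le> (\<Sum>n=1..N. C * b n)" by (intro sum_mono assms(3))
    then have "(\<Sum>n=1..N. a n) / real N \<le> C * (\<Sum>n=1..N. b n) / real N"
      by (simp add: divide_right_mono sum_distrib_left)
    then show ?thesis using assms(2) by (simp add: sum_nonneg)
  qed
  then show "\<forall>\<^sub>F N in sequentially. norm ((\<Sum>n=1..N. a n) / real N) \<le> C * ((\<Sum>n=1..N. b n) / real N)" by simp
qed

lemma cesaro_null_add:
  fixes a b :: "nat \<Rightarrow> complex"
  assumes "(\<lambda>N. (\<Sum>n=1..N. cmod (a n)) / real N) \<longlonglongrightarrow> 0" "(\<lambda>N. (\<Sum>n=1..N. cmod (b n)) / real N) \<longlonglongrightarrow> 0"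
  shows "(\<lambda>N. (\<Sum>n=1..N. cmod (a n + b n)) / real N) \<longlonglongrightarrow> 0"
proof -
  have "(\<lambda>N. (\<Sum>n=1..N. cmod (a n) + cmod (b n)) / real N) \<longlonglongrightarrow> 0"
    using tendsto_add[OF assms] by (simp add: sum.distrib add_divide_distrib)
  then show ?thesis by (rule cesaro_null_comparison[where C=1]) (auto intro: norm_triangle_ineq)
qed

context trig_system
begin

lemma trig_integrable:
  assumes "prob_space m" "sets m = sets N" "f \<in> trig L" "T ^^ n \<in> measurable m m" "h \<in> trig L"
  shows "integrable m f" "integrable m (\<lambda>x. f ((T ^^ n) x) * h x)" "f \<in> borel_measurable m"
proof -
  interpret prob_space m by fact
  have fm[measurable]: "f \<in> borel_measurable m" and hm[measurable]: "h \<in> borel_measurable m"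
    using trig_measurable assms by (auto simp: measurable_cong_sets[OF assms(2) refl])
  show "f \<in> borel_measurable m" by measurable
  obtain K where K: "\<forall>x. cmod (f x) \<le> K" using trig_bounded[OF assms(3)] by blast
  obtain K' where K': "\<forall>x. cmod (h x) \<le> K'" using trig_bounded[OF assms(5)] by blast
  show "integrable m f" using K by (intro integrable_bounded_complex[where K=K]) auto
  note [measurable] = assms(4)
  have "cmod (f ((T ^^ n) x) * h x) \<le> K * K'" for x
    unfolding norm_mult using K K' by (meson mult_mono norm_ge_zero order_trans)
  then show "integrable m (\<lambda>x. f ((T ^^ n) x) * h x)"
    by (intro integrable_bounded_complex[where K="K * K'"]) auto
qed

text \<open>Covariances are bilinear, so the decay on pure exponentials extends to trigonometric
  polynomials. The approximation of indicators then costs an error uniform in \<open>n\<close>,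
  which survives Cesaro averaging.\<close>

lemma weakly_mixingI:
  assumes pm: "prob_space m" and sm: "sets m = sets N" and mp: "measure_preserving_map m T"
    and cov: "\<And>l l'. l \<in> L \<Longrightarrow> l' \<in> L \<Longrightarrow> (\<lambda>N. (\<Sum>n=1..N. cmod ((\<integral>x. cis (l ((T ^^ n) x)) * cis (l' x) \<partial>m)
        - (\<integral>x. cis (l x) \<partial>m) * (\<integral>x. cis (l' x) \<partial>m))) / real N) \<longlonglongrightarrow> 0"
  shows "weakly_mixing m T"
proof -
  interpret prob_space m by fact
  have Tn[measurable]: "T ^^ n \<in> measurable m m" for n using measure_preserving_funpow[OF mp] by blast
  define C where "C f h n = (\<integral>x. f ((T ^^ n) x) * h x \<partial>m) - (\<integral>x. f x \<partial>m) * (\<integral>x. h x \<partial>m)"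
    for f h :: "'a \<Rightarrow> complex" and n
  have trig_cov: "(\<lambda>N. (\<Sum>n=1..N. cmod (C f h n)) / real N) \<longlonglongrightarrow> 0" if "f \<in> trig L" "h \<in> trig L" for f h
    using that(1)
  proof (induction rule: trig.induct)
    case (monomial l c)
    note l = \<open>l \<in> L\<close>
    show ?case using that(2)
    proof (induction rule: trig.induct)
      case (monomial l' d)
      let ?b = "\<lambda>n. cmod ((\<integral>x. cis (l ((T ^^ n) x)) * cis (l' x) \<partial>m) - (\<integral>x. cis (l x) \<partial>m) * (\<integral>x. cis (l' x) \<partial>m))"
      have "C (\<lambda>x. c * cis (l x)) (\<lambda>x. d * cis (l' x)) n = (c * d) * ((\<integral>x. cis (l ((T ^^ n) x)) * cis (l' x) \<partial>m) - (\<integral>x. cis (l x) \<partial>m) * (\<integral>x. cis (l' x) \<partial>m))" for n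
      proof -
        have "(\<integral>x. (c * cis (l ((T ^^ n) x))) * (d * cis (l' x)) \<partial>m) = (\<integral>x. (c * d) * (cis (l ((T ^^ n) x)) * cis (l' x)) \<partial>m)"
          by (simp add: ac_simps)
        then show ?thesis unfolding C_def by (simp add: right_diff_distrib mult.assoc mult.left_commute)
      qed
      then have "cmod (C (\<lambda>x. c * cis (l x)) (\<lambda>x. d * cis (l' x)) n) \<le> cmod (c * d) * ?b n" for n
        by (simp only: norm_mult order_refl)
      then show ?case
        by (intro cesaro_null_comparison[OF cov[OF l \<open>l' \<in> L\<close>]]) auto
    next
      case (add h h')
      have f: "(\<lambda>x. c * cis (l x)) \<in> trig L" using trig.monomial[OF l] .
      have "C (\<lambda>x. c * cis (l x)) (\<lambda>x. h x + h' x) n = C (\<lambda>x. c * cis (l x)) h n + C (\<lambda>x. c * cis (l x)) h' n" for n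
        unfolding C_def distrib_left
        using trig_integrable[OF pm sm add(1) Tn f] trig_integrable[OF pm sm add(2) Tn f]
          trig_integrable(2)[OF pm sm f Tn add(1)] trig_integrable(2)[OF pm sm f Tn add(2)]
        by (simp add: distrib_left)
      then show ?case using cesaro_null_add[OF add.IH] by simp
    qed
  next
    case (add f f')
    have "C (\<lambda>x. f x + f' x) h n = C f h n + C f' h n" for n
      unfolding C_def distrib_right
      using trig_integrable[OF pm sm add(1) Tn that(2)] trig_integrable[OF pm sm add(2) Tn that(2)]
      by (simp add: distrib_right)
    then show ?case using cesaro_null_add[OF add.IH] by simp
  qed
  show ?thesis unfolding weakly_mixing_def
  proof (intro conjI ballI mp)
    fix A B assume A[measurable]: "A \<in> sets m" and B[measurable]: "B \<in> sets m"
    define p where "p n = measure m ((T ^^ n) -` A \<inter> space m \<inter> B) - measure m A * measure m B" for n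
    have pC: "complex_of_real (p n) = C (indicator A) (indicator B) n" for n
    proof -
      have "(\<integral>x. indicator A ((T ^^ n) x) * indicator B x \<partial>m) = (\<integral>x. (indicator ((T ^^ n) -` A \<inter> space m \<inter> B) x :: complex) \<partial>m)"
        by (rule Bochner_Integration.integral_cong) (auto simp: indicator_def)
      also have "\<dots> = complex_of_real (measure m ((T ^^ n) -` A \<inter> space m \<inter> B))"
        by (rule indicator_integral_complex) measurable
      finally show ?thesis unfolding C_def p_def by (simp add: indicator_integral_complex)
    qed
    have "(\<lambda>N. (\<Sum>n=1..N. \<bar>p n\<bar>) / real N) \<longlonglongrightarrow> 0"
    proof (rule LIMSEQ_I)
      fix r :: real assume "r > 0"
      obtain f where f: "f \<in> trig L" "\<And>M. M \<in> {m} \<Longrightarrow> (\<integral>x. cmod (indicator A x - f x) \<partial>M) < r/8"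
        using trig_approx[of "{m}" A "r/8"] pm sm A \<open>r > 0\<close> by auto
      obtain K0 where K0: "\<forall>x. cmod (f x) \<le> K0" using trig_bounded[OF f(1)] by blast
      define K where "K = max K0 1"
      have K: "cmod (f x) \<le> K" "K > 0" for x using K0 by (auto simp: K_def le_max_iff_disj)
      \<comment> \<open>Chosen after \<open>f\<close>, because its tolerance involves the bound K of
        \<open>f\<close>. The two errors together are at most 2 r/8 + 2 r/8 = r/2.\<close>
      obtain h where h: "h \<in> trig L" "\<And>M. M \<in> {m} \<Longrightarrow> (\<integral>x. cmod (indicator B x - h x) \<partial>M) < r/(8*K)"
        using trig_approx[of "{m}" B "r/(8*K)"] pm sm B \<open>r > 0\<close> K(2) by auto
      obtain K' where K': "\<forall>x. cmod (h x) \<le> K'" using trig_bounded[OF h(1)] by blast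
      have K8: "K * (\<integral>x. cmod (indicator B x - h x) \<partial>m) \<le> r/8"
        using h(2)[of m] K(2) by (simp add: field_simps)
      have fm: "f \<in> borel_measurable m" "h \<in> borel_measurable m"
        using trig_measurable f h by (auto simp: measurable_cong_sets[OF sm refl])
      have diff: "\<bar>p n\<bar> \<le> r/2 + cmod (C f h n)" for n
      proof -
        have "cmod (C (indicator A) (indicator B) n - C f h n)
            \<le> 2 * (\<integral>x. cmod (indicator A x - f x) \<partial>m) + 2 * (K * (\<integral>x. cmod (indicator B x - h x) \<partial>m))"
          unfolding C_def by (rule covariance_approx[OF mp])
            (use fm K K' in \<open>auto simp: indicator_def\<close>)
        also have "\<dots> \<le> r/2" using f(2)[of m] K8 by simp
        finally have "cmod (of_real (p n) - C f h n) \<le> r/2" by (simp add: pC)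
        moreover have "cmod (of_real (p n)) \<le> cmod (of_real (p n) - C f h n) + cmod (C f h n)"
          using norm_triangle_ineq[of "of_real (p n) - C f h n" "C f h n"] by simp
        ultimately show ?thesis by simp
      qed
      obtain n0 where n0: "\<And>N. N \<ge> n0 \<Longrightarrow> (\<Sum>n=1..N. cmod (C f h n)) / real N < r/2"
        using order_tendstoD(2)[OF trig_cov[OF f(1) h(1)], of "r/2"] \<open>r > 0\<close> by (auto simp: eventually_sequentially)
      show "\<exists>no. \<forall>N\<ge>no. norm ((\<Sum>n=1..N. \<bar>p n\<bar>) / real N - 0) < r"
      proof (intro exI allI impI)
        fix N assume N: "max n0 1 \<le> N"
        have "(\<Sum>n=1..N. \<bar>p n\<bar>) \<le> (\<Sum>n=1..N. r/2 + cmod (C f h n))" by (intro sum_mono diff)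
        also have "\<dots> = real N * (r/2) + (\<Sum>n=1..N. cmod (C f h n))" by (simp add: sum.distrib)
        finally have "(\<Sum>n=1..N. \<bar>p n\<bar>) / real N \<le> (real N * (r/2) + (\<Sum>n=1..N. cmod (C f h n))) / real N"
          by (rule divide_right_mono) simp
        also have "\<dots> = r/2 + (\<Sum>n=1..N. cmod (C f h n)) / real N" using N by (simp add: add_divide_distrib)
        also have "\<dots> < r"
        proof -
          have "n0 \<le> N" using N by simp
          from n0[OF this] show ?thesis by linarith
        qed
        finally show "norm ((\<Sum>n=1..N. \<bar>p n\<bar>) / real N - 0) < r" by (simp add: sum_nonneg)
      qed
    qed
    then show "(\<lambda>N. (1 / real N) * (\<Sum>n=1..N. \<bar>measure m ((T ^^ n) -` A \<inter> space m \<inter> B) - measure m A * measure m B\<bar>)) \<longlonglongrightarrow> 0"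
      by (simp add: p_def)
  qed
qed

text \<open>The mass of the symmetric difference is the L1 distance between the indicator and its
  composition with the iterate, so the claim reduces to approximants in L1.\<close>

lemma rigidI:
  assumes pm: "prob_space m" and sm: "sets m = sets N" and mp: "measure_preserving_map m T"
    and rg: "\<And>l. l \<in> L \<Longrightarrow> (\<lambda>k. \<integral>x. cmod (cis (l ((T ^^ nk k) x)) - cis (l x)) \<partial>m) \<longlonglongrightarrow> 0"
  shows "rigid_wrt m T nk"
proof -
  interpret prob_space m by fact
  have Tn[measurable]: "T ^^ n \<in> measurable m m" for n using measure_preserving_funpow[OF mp] by blast
  have int: "integrable m f" "integrable m (\<lambda>x. f ((T ^^ n) x))" if f: "f \<in> trig L" for f n
  proof -
    obtain K where K: "\<forall>x. cmod (f x) \<le> K" using trig_bounded[OF f] by blast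
    have [measurable]: "f \<in> borel_measurable m" using trig_measurable[OF f] by (simp add: measurable_cong_sets[OF sm refl])
    show "integrable m f" "integrable m (\<lambda>x. f ((T ^^ n) x))"
      using K by (auto intro!: integrable_bounded_complex)
  qed
  have trig_rg: "(\<lambda>k. \<integral>x. cmod (f ((T ^^ nk k) x) - f x) \<partial>m) \<longlonglongrightarrow> 0" if "f \<in> trig L" for f
    using that
  proof (induction rule: trig.induct)
    case (monomial l c)
    have "cmod (c * cis (l ((T ^^ nk k) x)) - c * cis (l x)) = cmod c * cmod (cis (l ((T ^^ nk k) x)) - cis (l x))" for k x
      by (metis norm_mult right_diff_distrib)
    then show ?case using tendsto_mult_right_zero[OF rg[OF monomial], of "cmod c"] by simp
  next
    case (add f h)
    show ?case
    proof (rule Lim_null_comparison)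
      show "(\<lambda>k. (\<integral>x. cmod (f ((T ^^ nk k) x) - f x) \<partial>m) + (\<integral>x. cmod (h ((T ^^ nk k) x) - h x) \<partial>m)) \<longlonglongrightarrow> 0"
        using tendsto_add[OF add.IH] by simp
      have "norm (\<integral>x. cmod (f ((T ^^ nk k) x) + h ((T ^^ nk k) x) - (f x + h x)) \<partial>m)
        \<le> (\<integral>x. cmod (f ((T ^^ nk k) x) - f x) \<partial>m) + (\<integral>x. cmod (h ((T ^^ nk k) x) - h x) \<partial>m)" for k
      proof -
        have i: "integrable m (\<lambda>x. cmod (f ((T ^^ nk k) x) - f x))" "integrable m (\<lambda>x. cmod (h ((T ^^ nk k) x) - h x))"
          using int[OF add(1)] int[OF add(2)] by auto
        have "(\<integral>x. cmod (f ((T ^^ nk k) x) + h ((T ^^ nk k) x) - (f x + h x)) \<partial>m)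
          \<le> (\<integral>x. cmod (f ((T ^^ nk k) x) - f x) + cmod (h ((T ^^ nk k) x) - h x) \<partial>m)"
        proof (rule integral_mono')
          fix x
          have "f ((T ^^ nk k) x) + h ((T ^^ nk k) x) - (f x + h x) = (f ((T ^^ nk k) x) - f x) + (h ((T ^^ nk k) x) - h x)" by simp
          then show "cmod (f ((T ^^ nk k) x) + h ((T ^^ nk k) x) - (f x + h x)) \<le> cmod (f ((T ^^ nk k) x) - f x) + cmod (h ((T ^^ nk k) x) - h x)"
            using norm_triangle_ineq by metis
        qed (use i in auto)
        then show ?thesis using i by simp
      qed
      then show "\<forall>\<^sub>F k in sequentially. norm (\<integral>x. cmod (f ((T ^^ nk k) x) + h ((T ^^ nk k) x) - (f x + h x)) \<partial>m)
        \<le> (\<integral>x. cmod (f ((T ^^ nk k) x) - f x) \<partial>m) + (\<integral>x. cmod (h ((T ^^ nk k) x) - h x) \<partial>m)" by simp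
    qed
  qed
  show ?thesis unfolding rigid_wrt_def
  proof (intro conjI ballI mp)
    fix A assume A[measurable]: "A \<in> sets m"
    let ?D = "\<lambda>k. (((T ^^ nk k) -` A \<inter> space m) - A) \<union> (A - (T ^^ nk k) -` A)"
    have D: "measure m (?D k) = (\<integral>x. cmod (indicator A ((T ^^ nk k) x) - indicator A x) \<partial>m)" for k
    proof -
      have "?D k = ((T ^^ nk k) -` A \<inter> space m - A) \<union> (A - ((T ^^ nk k) -` A \<inter> space m))"
        using sets.sets_into_space[OF A] by auto
      then have "?D k \<in> sets m" by simp
      then have "measure m (?D k) = (\<integral>x. indicator (?D k) x \<partial>m)" by simp
      also have "\<dots> = (\<integral>x. cmod (indicator A ((T ^^ nk k) x) - indicator A x) \<partial>m)"
        by (rule Bochner_Integration.integral_cong) (auto simp: indicator_def)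
      finally show ?thesis .
    qed
    show "(\<lambda>k. measure m (?D k)) \<longlonglongrightarrow> 0"
    proof (rule LIMSEQ_I)
      fix r :: real assume "r > 0"
      obtain f where f: "f \<in> trig L" "\<And>M. M \<in> {m} \<Longrightarrow> (\<integral>x. cmod (indicator A x - f x) \<partial>M) < r/4"
        using trig_approx[of "{m}" A "r/4"] pm sm A \<open>r > 0\<close> by auto
      have [measurable]: "f \<in> borel_measurable m" using trig_measurable[OF f(1)] by (simp add: measurable_cong_sets[OF sm refl])
      define d where "d = (\<integral>x. cmod (indicator A x - f x) \<partial>m)"
      have d: "d < r/4" using f(2)[of m] by (simp add: d_def)
      \<comment> \<open>By invariance the approximation error after the iterate is again
        \<open>d\<close>, for every exponent.\<close>
      have dT: "(\<integral>x. cmod (indicator A ((T ^^ n) x) - f ((T ^^ n) x)) \<partial>m) = d" for n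
        unfolding d_def by (rule integral_measure_preserving[OF mp]) measurable
      have bound: "measure m (?D k) \<le> r/2 + (\<integral>x. cmod (f ((T ^^ nk k) x) - f x) \<partial>m)" for k
      proof -
        have indA: "integrable m (\<lambda>x. indicator A ((T ^^ n) x) :: complex)" "integrable m (indicator A :: _ \<Rightarrow> complex)" for n
          by (auto intro!: integrable_bounded_complex[where K=1] simp: indicator_def)
        have i: "integrable m (\<lambda>x. cmod (indicator A ((T ^^ nk k) x) - f ((T ^^ nk k) x)))"
          "integrable m (\<lambda>x. cmod (f ((T ^^ nk k) x) - f x))" "integrable m (\<lambda>x. cmod (indicator A x - f x))"
          using int[OF f(1)] indA by auto
        have "measure m (?D k) \<le> (\<integral>x. (cmod (indicator A ((T ^^ nk k) x) - f ((T ^^ nk k) x)) + cmod (f ((T ^^ nk k) x) - f x)) + cmod (indicator A x - f x) \<partial>m)"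
          unfolding D
        proof (rule integral_mono')
          fix x
          have *: "cmod (u - w) \<le> (cmod (u - v) + cmod (v - y)) + cmod (w - y)" for u v w y :: complex
          proof -
            have "u - w = ((u - v) + (v - y)) - (w - y)" by simp
            then have "cmod (u - w) \<le> cmod ((u - v) + (v - y)) + cmod (w - y)" using norm_triangle_ineq4 by metis
            then show ?thesis using norm_triangle_ineq[of "u - v" "v - y"] by linarith
          qed
          show "cmod (indicator A ((T ^^ nk k) x) - indicator A x) \<le> (cmod (indicator A ((T ^^ nk k) x) - f ((T ^^ nk k) x)) + cmod (f ((T ^^ nk k) x) - f x)) + cmod (indicator A x - f x)"
            by (rule *)
        qed (use i in auto)
        also have "\<dots> = d + (\<integral>x. cmod (f ((T ^^ nk k) x) - f x) \<partial>m) + d"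
          using i dT by (simp add: d_def)
        finally show ?thesis using d by simp
      qed
      obtain k0 where k0: "\<And>k. k \<ge> k0 \<Longrightarrow> (\<integral>x. cmod (f ((T ^^ nk k) x) - f x) \<partial>m) < r/2"
        using order_tendstoD(2)[OF trig_rg[OF f(1)], of "r/2"] \<open>r > 0\<close> by (auto simp: eventually_sequentially)
      show "\<exists>k0. \<forall>k\<ge>k0. norm (measure m (?D k) - 0) < r"
      proof (intro exI allI impI)
        fix k assume "k0 \<le> k"
        from k0[OF this] bound[of k] have "measure m (?D k) < r" by linarith
        then show "norm (measure m (?D k) - 0) < r" by simp
      qed
    qed
  qed
qed

end

subsection \<open>The weighted backward shift\<close>

context hilbert_basis
begin

lemma coordinates_eqI: "(\<And>j. cinner (e j) x = cinner (e j) y) \<Longrightarrow> x = y"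
  using complete[of "x - y"] by (simp add: cinner.diff_right)

definition shift :: "'h \<Rightarrow> 'h" where
  "shift x = (\<Sum>n. scaleC (of_real (sqrt 2) * cinner (e (Suc n)) x) (e n))"

lemma shift_coeff_summable: "summable (\<lambda>n. (cmod (of_real (sqrt 2) * cinner (e (Suc n)) x))\<^sup>2)"
proof -
  have "summable (\<lambda>n. 2 * (cmod (cinner (e (Suc n)) x))\<^sup>2)"
    using bessel_summable[of x] by (intro summable_mult) (simp only: summable_Suc_iff[of "\<lambda>n. (cmod (cinner (e n) x))\<^sup>2"])
  then show ?thesis by (simp add: norm_mult power_mult_distrib)
qed

lemma cinner_shift: "cinner (e j) (shift x) = of_real (sqrt 2) * cinner (e (Suc j)) x"
  unfolding shift_def by (rule cinner_suminf_e[OF shift_coeff_summable])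

lemma shift_basis: "shift (e 0) = 0" "shift (e (Suc n)) = scaleC (of_real (sqrt 2)) (e n)"
  by (auto intro!: coordinates_eqI simp: cinner_shift orthonormal cinner.scale_right)

lemma norm_shift: "norm (shift x) \<le> sqrt 2 * norm x"
proof -
  have "(norm (shift x))\<^sup>2 = (\<Sum>n. 2 * (cmod (cinner (e (Suc n)) x))\<^sup>2)"
    using parseval[of "shift x"] by (simp add: sums_iff cinner_shift norm_mult power_mult_distrib)
  also have "\<dots> = 2 * ((norm x)\<^sup>2 - (cmod (cinner (e 0) x))\<^sup>2)"
  proof -
    have "(\<lambda>n. (cmod (cinner (e (Suc n)) x))\<^sup>2) sums ((norm x)\<^sup>2 - (cmod (cinner (e 0) x))\<^sup>2)"
      using parseval[of x] by (subst sums_Suc_iff) simp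
    from sums_mult[OF this, of 2] show ?thesis by (simp add: sums_iff)
  qed
  also have "\<dots> \<le> (sqrt 2 * norm x)\<^sup>2" by (simp add: power_mult_distrib)
  finally show ?thesis by (rule power2_le_imp_le) simp
qed

lemma shift_bounded_clinear: "bounded_clinear shift"
  unfolding bounded_clinear_def clinear_def
proof (intro conjI allI exI)
  show "shift (x + y) = shift x + shift y" for x y
    by (rule coordinates_eqI) (simp add: cinner_shift cinner.add_right distrib_left)
  show "shift (scaleC c x) = scaleC c (shift x)" for c x
    by (rule coordinates_eqI) (simp add: cinner_shift cinner.scale_right)
  show "norm (shift x) \<le> sqrt 2 * norm x" for x by (rule norm_shift)
qed

lemma shift_measurable: "shift \<in> borel_measurable borel"
proof -
  have "bounded_linear shift"
    using shift_bounded_clinear norm_shift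
    by (intro bounded_linear_intro[where K="sqrt 2"])
       (auto simp: bounded_clinear_def clinear_def scaleR_scaleC mult.commute)
  then show ?thesis by (intro borel_measurable_continuous_onI linear_continuous_on)
qed

lemma functional_shift:
  assumes "bounded_cfunctional f" shows "bounded_cfunctional (\<lambda>x. f (shift x))"
proof -
  obtain K where K: "\<forall>x. norm (f x) \<le> K * norm x" using assms by (auto simp: bounded_cfunctional_def)
  have "norm (f (shift x)) \<le> (\<bar>K\<bar> * sqrt 2) * norm x" for x
  proof -
    have "norm (f (shift x)) \<le> K * norm (shift x)" using K by blast
    also have "\<dots> \<le> \<bar>K\<bar> * norm (shift x)" by (rule mult_right_mono) auto
    also have "\<dots> \<le> \<bar>K\<bar> * (sqrt 2 * norm x)" by (rule mult_left_mono[OF norm_shift]) simp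
    finally show ?thesis by (simp add: mult.assoc)
  qed
  then show ?thesis using assms shift_bounded_clinear
    unfolding bounded_cfunctional_def bounded_clinear_def clinear_def
    by (intro conjI exI[of _ "\<bar>K\<bar> * sqrt 2"]) simp_all
qed

text \<open>The induction generalises over \<open>f\<close>, absorbing one application of the shift
  into the functional at each step.\<close>

lemma functional_shift_funpow:
  "bounded_cfunctional f \<Longrightarrow> bounded_cfunctional (\<lambda>x. f ((shift ^^ n) x))"
proof (induction n arbitrary: f)
  case (Suc n)
  from Suc.IH[OF functional_shift[OF Suc.prems]] show ?case by simp
qed simp

text \<open>Real parts alone also cover imaginary parts, since Im f = Re (-i f) and -i f is again a
  bounded functional.\<close>

definition functionals :: "('h \<Rightarrow> real) set" where
  "functionals = {\<lambda>x. Re (f x) | f. bounded_cfunctional f}"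

lemma trig_system_functionals:
  assumes "separable_type TYPE('h)"
  shows "trig_system borel functionals"
proof
  have fm: "f \<in> borel_measurable borel" if "bounded_cfunctional f" for f :: "'h \<Rightarrow> complex"
    using that by (intro borel_measurable_continuous_onI linear_continuous_on bounded_cfunctional_bounded_linear)
  show "l \<in> borel_measurable borel" if "l \<in> functionals" for l
    using that fm by (auto simp: functionals_def)
  show "(\<lambda>x. l x + l' x) \<in> functionals" if l: "l \<in> functionals" and l': "l' \<in> functionals" for l l'
  proof -
    obtain f f' where "l = (\<lambda>x. Re (f x))" "l' = (\<lambda>x. Re (f' x))" "bounded_cfunctional f" "bounded_cfunctional f'"
      using l l' by (auto simp: functionals_def)
    then show ?thesis unfolding functionals_def
      by (intro CollectI exI[of _ "\<lambda>x. f x + f' x"]) (auto intro: bounded_cfunctional_add)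
  qed
  show "(\<lambda>x. t * l x) \<in> functionals" if l: "l \<in> functionals" for l t
  proof -
    obtain f where "l = (\<lambda>x. Re (f x))" "bounded_cfunctional f"
      using l by (auto simp: functionals_def)
    then show ?thesis unfolding functionals_def
      by (intro CollectI exI[of _ "\<lambda>x. of_real t * f x"]) (auto intro: bounded_cfunctional_mult)
  qed
  show "functionals \<noteq> {}" using bounded_cfunctional_cinner by (auto simp: functionals_def)
  fix S :: "'h measure" assume S: "space S = space borel" and m: "\<And>l. l \<in> functionals \<Longrightarrow> l \<in> borel_measurable S"
  have "(\<lambda>x. cinner (e n) x) \<in> borel_measurable S" for n
  proof -
    have "(\<lambda>x. Re (cinner (e n) x)) \<in> borel_measurable S"
      by (rule m) (auto simp: functionals_def intro: bounded_cfunctional_cinner)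
    moreover have "(\<lambda>x. Re (- \<i> * cinner (e n) x)) \<in> borel_measurable S"
      unfolding functionals_def
      by (intro m[unfolded functionals_def] CollectI exI[of _ "\<lambda>x. - \<i> * cinner (e n) x"] conjI refl
          bounded_cfunctional_mult bounded_cfunctional_cinner)
    then have "(\<lambda>x. Im (cinner (e n) x)) \<in> borel_measurable S" by simp
    ultimately show ?thesis by (simp add: borel_measurable_complex_iff)
  qed
  then have "(\<lambda>x. x) \<in> borel_measurable S" by (rule borel_measurable_coordinates[OF assms])
  then show "sets borel \<subseteq> sets S"
    using S measurable_sets[of "\<lambda>x. x" S borel] by auto
qed

end

subsection \<open>Circular Gaussian distributions\<close>

lemma char_normal:
  assumes "s > 0"
  shows "(\<integral>x. cis (u * x) \<partial>density lborel (normal_density 0 s)) = of_real (exp (- (s * u)\<^sup>2 / 2))"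
proof -
  interpret prob_space std_normal by (rule prob_space_std_normal)
  have "distributed std_normal lborel (\<lambda>x. x) (normal_density 0 1)"
    unfolding distributed_def by (auto simp: distr_id2)
  from normal_density_affine[OF this, of s 0] have "distributed std_normal lborel (\<lambda>x. 0 + s * x) (normal_density 0 s)"
    using assms by simp
  then have d: "density lborel (normal_density 0 s) = distr std_normal lborel (\<lambda>x. s * x)"
    by (simp add: distributed_def)
  have "(\<integral>x. cis (u * x) \<partial>density lborel (normal_density 0 s)) = (\<integral>x. cis (u * (s * x)) \<partial>std_normal)"
    unfolding d by (rule integral_distr) auto
  also have "\<dots> = char std_normal_distribution (s * u)"
    unfolding char_def by (simp add: cis_conv_exp ac_simps)
  finally show ?thesis by (simp add: char_std_normal_distribution)
qed

lemma prob_space_complex_gaussian: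
  assumes "s \<ge> 0" shows "prob_space (complex_gaussian_distr s)"
proof (cases "s = 0")
  case True
  then show ?thesis by (simp add: complex_gaussian_distr_def prob_space_return)
next
  case False
  then interpret prob_space "density lborel (normal_density 0 s)"
    using assms by (intro prob_space_normal_density) simp
  interpret pair_prob_space "density lborel (normal_density 0 s)" "density lborel (normal_density 0 s)" ..
  show ?thesis using False by (simp add: complex_gaussian_distr_def) unfold_locales
qed

lemma sets_complex_gaussian: "sets (complex_gaussian_distr s) = sets borel"
proof (cases "s = 0")
  case False
  have "sets (density lborel (normal_density 0 s) \<Otimes>\<^sub>M density lborel (normal_density 0 s)) = sets (borel \<Otimes>\<^sub>M (borel :: real measure))"
    by (rule sets_pair_measure_cong) auto
  also have "\<dots> = sets borel" by (simp only: borel_prod)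
  finally show ?thesis using False by (simp only: complex_gaussian_distr_def if_False)
qed (simp add: complex_gaussian_distr_def)

lemma char_complex_gaussian:
  assumes "s \<ge> 0"
  shows "(\<integral>p. cis (u * fst p + v * snd p) \<partial>complex_gaussian_distr s) = of_real (exp (- (s\<^sup>2 * (u\<^sup>2 + v\<^sup>2)) / 2))"
proof (cases "s = 0")
  case True
  have "(\<integral>p. cis (u * fst p + v * snd p) \<partial>return borel (0, 0)) = cis (u * fst (0::real, 0::real) + v * snd (0::real, 0::real))"
    by (rule integral_return) (auto simp: space_pair_measure simp flip: borel_prod)
  then show ?thesis using True by (simp add: complex_gaussian_distr_def)
next
  case False
  let ?D = "density lborel (normal_density 0 s)"
  interpret D: prob_space ?D
    using assms False by (intro prob_space_normal_density) simp
  interpret DD: pair_prob_space ?D ?D ..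
  have i: "integrable (?D \<Otimes>\<^sub>M ?D) (\<lambda>p. cis (u * fst p + v * snd p))"
    by (rule DD.integrable_const_bound[of _ 1]) auto
  have "(\<integral>p. cis (u * fst p + v * snd p) \<partial>(?D \<Otimes>\<^sub>M ?D)) = (\<integral>x. \<integral>y. cis (u * x + v * y) \<partial>?D \<partial>?D)"
    using DD.integral_fst'[OF i] by simp
  also have "\<dots> = (\<integral>x. cis (u * x) * (\<integral>y. cis (v * y) \<partial>?D) \<partial>?D)"
    by (simp add: cis_mult[symmetric])
  also have "\<dots> = (\<integral>x. cis (u * x) \<partial>?D) * (\<integral>y. cis (v * y) \<partial>?D)" by simp
  also have "\<dots> = of_real (exp (- (s * u)\<^sup>2 / 2) * exp (- (s * v)\<^sup>2 / 2))"
    using assms False by (simp add: char_normal)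
  also have "exp (- (s * u)\<^sup>2 / 2) * exp (- (s * v)\<^sup>2 / 2) = exp (- (s\<^sup>2 * (u\<^sup>2 + v\<^sup>2)) / 2)"
    by (simp add: exp_add[symmetric] power_mult_distrib algebra_simps add_divide_distrib)
  finally show ?thesis using False by (simp add: complex_gaussian_distr_def)
qed

text \<open>Supplies uniqueness of characteristic functions on the plane, by which the joint law of
  Re f and Im f is identified.\<close>

lemma trig_system_plane:
  "trig_system (borel :: (real \<times> real) measure) {\<lambda>p. u * fst p + v * snd p | u v. True}"
proof
  let ?L = "{\<lambda>p. u * fst p + v * snd p | u v. True} :: (real \<times> real \<Rightarrow> real) set"
  show "l \<in> borel_measurable borel" if "l \<in> ?L" for l
    using that by (auto intro!: borel_measurable_continuous_onI continuous_intros)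
  show "(\<lambda>x. l x + l' x) \<in> ?L" if l: "l \<in> ?L" "l' \<in> ?L" for l l'
  proof -
    obtain u v u' v' where "l = (\<lambda>p. u * fst p + v * snd p)" "l' = (\<lambda>p. u' * fst p + v' * snd p)"
      using l by auto
    then have "(\<lambda>x. l x + l' x) = (\<lambda>p. (u + u') * fst p + (v + v') * snd p)" by (auto simp: algebra_simps)
    then show ?thesis by blast
  qed
  show "(\<lambda>x. t * l x) \<in> ?L" if l: "l \<in> ?L" for l t
  proof -
    obtain u v where "l = (\<lambda>p. u * fst p + v * snd p)" using l by auto
    then have "(\<lambda>x. t * l x) = (\<lambda>p. (t * u) * fst p + (t * v) * snd p)" by (auto simp: algebra_simps)
    then show ?thesis by blast
  qed
  show "?L \<noteq> {}" by auto
  fix S :: "(real \<times> real) measure" assume S: "space S = space borel" and m: "\<And>l. l \<in> ?L \<Longrightarrow> l \<in> borel_measurable S"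
  have "(\<lambda>p. 1 * fst p + 0 * snd p) \<in> borel_measurable S" by (rule m) blast
  moreover have "(\<lambda>p. 0 * fst p + 1 * snd p) \<in> borel_measurable S" by (rule m) blast
  ultimately have "(\<lambda>p. (fst p, snd p)) \<in> borel_measurable S"
    by (intro borel_measurable_Pair) simp_all
  then show "sets borel \<subseteq> sets S"
    using S measurable_sets[of "\<lambda>x. x" S borel] by auto
qed

lemma cmod_add_squared: "(cmod (u + v))\<^sup>2 = (cmod u)\<^sup>2 + (cmod v)\<^sup>2 + 2 * Re (u * cnj v)"
  unfolding cmod_power2 by (simp add: power2_eq_square algebra_simps)

lemma cmod_minus_one_squared: "(cmod (w - 1))\<^sup>2 = (cmod w)\<^sup>2 + 1 - 2 * Re w"
  using cmod_add_squared[of w "- 1"] by simp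

subsection \<open>Dynamics of the shift under the Gaussian law\<close>

context gaussian_series
begin

lemma \<Phi>_add:
  assumes "bounded_cfunctional f" "bounded_cfunctional h" "z \<in> circle"
  shows "\<Phi> (\<lambda>x. f x + h x) z = \<Phi> f z + \<Phi> h z"
proof -
  have "(\<lambda>n. (f (e n) * of_real (q n)) * z ^ n + (h (e n) * of_real (q n)) * z ^ n) sums (\<Phi> f z + \<Phi> h z)"
    by (intro sums_add \<Phi>_sums assms)
  moreover have "(\<lambda>n. ((f (e n) + h (e n)) * of_real (q n)) * z ^ n) sums \<Phi> (\<lambda>x. f x + h x) z"
    by (rule \<Phi>_sums[OF bounded_cfunctional_add[OF assms(1,2)] assms(3)])
  ultimately show ?thesis by (simp add: distrib_right sums_unique2)
qed

lemma \<Phi>_mult: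
  assumes "bounded_cfunctional f" "z \<in> circle"
  shows "\<Phi> (\<lambda>x. c * f x) z = c * \<Phi> f z"
proof -
  have "(\<lambda>n. c * ((f (e n) * of_real (q n)) * z ^ n)) sums (c * \<Phi> f z)"
    by (intro sums_mult \<Phi>_sums assms)
  moreover have "(\<lambda>n. ((c * f (e n)) * of_real (q n)) * z ^ n) sums \<Phi> (\<lambda>x. c * f x) z"
    by (rule \<Phi>_sums[OF bounded_cfunctional_mult[OF assms(1)] assms(2)])
  ultimately show ?thesis by (simp add: mult.assoc sums_unique2)
qed

text \<open>The weight sqrt 2 times \<open>q (Suc n)\<close> is \<open>q n\<close>, so the series of
  the composed functional is that of \<open>f\<close> moved up one power of z. Its term of index 0
  vanishes because the shift kills \<open>e 0\<close>.\<close>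

lemma \<Phi>_shift:
  assumes "bounded_cfunctional f" "z \<in> circle"
  shows "\<Phi> (\<lambda>x. f (shift x)) z = z * \<Phi> f z"
proof -
  define t where "t n = (f (shift (e n)) * of_real (q n)) * z ^ n" for n
  have f0: "f 0 = 0" using bounded_cfunctional_scaleC[OF assms(1), of 0 0] by simp
  have t: "t (Suc n) = z * ((f (e n) * of_real (q n)) * z ^ n)" for n
  proof -
    have "complex_of_real (sqrt 2) * complex_of_real (q (Suc n)) = of_real (q n)"
      unfolding of_real_mult[symmetric] by (simp add: q_def)
    then show ?thesis
      by (simp add: t_def shift_basis bounded_cfunctional_scaleC[OF assms(1)] mult.commute mult.left_commute)
  qed
  have "(\<lambda>n. t (Suc n)) sums (z * \<Phi> f z)"
    unfolding t by (intro sums_mult \<Phi>_sums assms)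
  then have "t sums (z * \<Phi> f z + t 0)" by (simp add: sums_Suc_iff)
  moreover have "t 0 = 0" by (simp add: t_def shift_basis f0)
  moreover have "t sums \<Phi> (\<lambda>x. f (shift x)) z"
    unfolding t_def by (rule \<Phi>_sums[OF functional_shift[OF assms(1)] assms(2)])
  ultimately show ?thesis by (simp add: sums_unique2)
qed

lemma \<Phi>_shift_funpow:
  "bounded_cfunctional f \<Longrightarrow> z \<in> circle \<Longrightarrow> \<Phi> (\<lambda>x. f ((shift ^^ n) x)) z = z ^ n * \<Phi> f z"
proof (induction n arbitrary: f)
  case (Suc n)
  have "\<Phi> (\<lambda>x. f ((shift ^^ Suc n) x)) z = \<Phi> (\<lambda>x. (\<lambda>y. f (shift y)) ((shift ^^ n) x)) z" by simp
  also have "\<dots> = z ^ n * \<Phi> (\<lambda>y. f (shift y)) z"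
    by (rule Suc.IH[OF functional_shift[OF Suc.prems(1)] Suc.prems(2)])
  also have "\<dots> = z ^ Suc n * \<Phi> f z" using \<Phi>_shift[OF Suc.prems] by simp
  finally show ?case .
qed simp

abbreviation variance2 :: "('h \<Rightarrow> complex) \<Rightarrow> real" where
  "variance2 f \<equiv> (\<integral>z. (cmod (\<Phi> f z))\<^sup>2 \<partial>\<sigma>)"

text \<open>The characteristic functional depends on \<open>f\<close> only through the L2 norm of
  its symbol, and multiplication by z is isometric on the circle.\<close>

lemma shift_preserves_law: "measure_preserving_map law shift"
proof -
  have sm: "shift \<in> measurable law law"
    using shift_measurable measurable_cong_sets[OF sets_law sets_law] by blast
  interpret tr: trig_system borel functionals by (rule trig_system_functionals[OF separable])
  interpret law: prob_space law by (rule prob_space_law)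
  have "distr law law shift = law"
  proof (rule tr.measure_eqI_cis)
    show "prob_space (distr law law shift)" by (rule law.prob_space_distr[OF sm])
    show "prob_space law" by (rule prob_space_law)
    fix l assume "l \<in> functionals"
    then obtain f where f: "l = (\<lambda>x. Re (f x))" "bounded_cfunctional f" by (auto simp: functionals_def)
    have [measurable]: "f \<in> borel_measurable law"
      using functional_measurable[OF f(2)] measurable_cong_sets[OF sets_law refl] by blast
    have "(\<integral>x. cis (l x) \<partial>distr law law shift) = (\<integral>x. cis (Re (f (shift x))) \<partial>law)"
      unfolding f(1) by (rule integral_distr[OF sm]) measurable
    also have "\<dots> = of_real (exp (- variance2 (\<lambda>x. f (shift x)) / 2))" by (rule law_char[OF functional_shift[OF f(2)]])
    also have "variance2 (\<lambda>x. f (shift x)) = variance2 f"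
      by (rule Bochner_Integration.integral_cong) (auto simp: \<Phi>_shift[OF f(2)] norm_mult)
    also have "of_real (exp (- variance2 f / 2)) = (\<integral>x. cis (l x) \<partial>law)" unfolding f(1) by (rule law_char[OF f(2), symmetric])
    finally show "(\<integral>x. cis (l x) \<partial>distr law law shift) = (\<integral>x. cis (l x) \<partial>law)" .
  qed auto
  with sm show ?thesis by (simp add: measure_preserving_map_def)
qed

text \<open>Real and imaginary parts of \<open>f\<close> are jointly isotropic because the symbol is
  complex-linear in \<open>f\<close>: the norm for w f is |w| times that for f, whatever the
  argument of w.\<close>

lemma law_gaussian: "gaussian_measure law"
  unfolding gaussian_measure_def borel_prob_def
proof (intro conjI allI impI prob_space_law sets_law)
  fix f :: "'h \<Rightarrow> complex" assume f: "bounded_cfunctional f"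
  interpret law: prob_space law by (rule prob_space_law)
  define s where "s = sqrt (variance2 f)"
  have s: "s \<ge> 0" "s\<^sup>2 = variance2 f" by (auto simp: s_def)
  have [measurable]: "f \<in> borel_measurable law"
    using functional_measurable[OF f] measurable_cong_sets[OF sets_law refl] by blast
  have pm: "(\<lambda>x. (Re (f x), Im (f x))) \<in> borel_measurable law"
    by (intro borel_measurable_Pair) measurable
  interpret tr: trig_system borel "{\<lambda>p. u * fst p + v * snd p | u v. True} :: (real \<times> real \<Rightarrow> real) set"
    by (rule trig_system_plane)
  have "distr law borel (\<lambda>x. (Re (f x), Im (f x))) = complex_gaussian_distr s"
  proof (rule tr.measure_eqI_cis)
    show "prob_space (distr law borel (\<lambda>x. (Re (f x), Im (f x))))" by (rule law.prob_space_distr[OF pm])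
    show "prob_space (complex_gaussian_distr s)" by (rule prob_space_complex_gaussian[OF s(1)])
    show "sets (complex_gaussian_distr s) = sets borel" by (rule sets_complex_gaussian)
    fix l :: "real \<times> real \<Rightarrow> real" assume l: "l \<in> {\<lambda>p. u * fst p + v * snd p | u v. True}"
    then obtain u v where uv: "l = (\<lambda>p. u * fst p + v * snd p)" by auto
    have [measurable]: "l \<in> borel_measurable borel" by (rule tr.meas[OF l])
    \<comment> \<open>The sign makes Re (w f) = u Re f + v Im f, while |w|^2 = u^2 + v^2.\<close>
    define w where "w = Complex u (- v)"
    have "(\<integral>p. cis (l p) \<partial>distr law borel (\<lambda>x. (Re (f x), Im (f x)))) = (\<integral>x. cis (l (Re (f x), Im (f x))) \<partial>law)"
      by (rule integral_distr[OF pm]) measurable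
    also have "\<dots> = (\<integral>x. cis (Re (w * f x)) \<partial>law)"
      by (simp add: uv w_def)
    also have "\<dots> = of_real (exp (- variance2 (\<lambda>x. w * f x) / 2))"
      by (rule law_char[OF bounded_cfunctional_mult[OF f]])
    also have "variance2 (\<lambda>x. w * f x) = (\<integral>z. (cmod w)\<^sup>2 * (cmod (\<Phi> f z))\<^sup>2 \<partial>\<sigma>)"
      by (rule Bochner_Integration.integral_cong) (auto simp: \<Phi>_mult[OF f] norm_mult power_mult_distrib)
    also have "\<dots> = s\<^sup>2 * (u\<^sup>2 + v\<^sup>2)" by (simp add: s(2) w_def cmod_power2)
    also have "complex_of_real (exp (- (s\<^sup>2 * (u\<^sup>2 + v\<^sup>2)) / 2)) = (\<integral>p. cis (l p) \<partial>complex_gaussian_distr s)"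
      unfolding uv by (rule char_complex_gaussian[OF s(1), symmetric])
    finally show "(\<integral>p. cis (l p) \<partial>distr law borel (\<lambda>x. (Re (f x), Im (f x)))) = (\<integral>p. cis (l p) \<partial>complex_gaussian_distr s)" .
  qed simp
  with s(1) show "\<exists>s\<ge>0. distr law borel (\<lambda>x. (Re (f x), Im (f x))) = complex_gaussian_distr s" by blast
qed

text \<open>The covariance of two exponentials is E (exp(- Re (a n)) - 1), where \<open>a n\<close>
  is the n-th Fourier coefficient of the bounded density \<open>\<alpha> z * cnj (\<beta> z)\<close>
  against \<open>\<sigma>\<close>. It is dominated by a multiple of |a n|, whose Cesaro means vanish
  by \<open>wiener\<close>.\<close>

lemma shift_weakly_mixing: "weakly_mixing law shift"
proof -
  interpret tr: trig_system borel functionals by (rule trig_system_functionals[OF separable])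
  show ?thesis
  proof (rule tr.weakly_mixingI[OF prob_space_law sets_law shift_preserves_law])
    fix l l' :: "'h \<Rightarrow> real" assume "l \<in> functionals" "l' \<in> functionals"
    then obtain f h where f: "l = (\<lambda>x. Re (f x))" "bounded_cfunctional f"
      and h: "l' = (\<lambda>x. Re (h x))" "bounded_cfunctional h" by (auto simp: functionals_def)
    define \<alpha> where "\<alpha> = \<Phi> f"
    define \<beta> where "\<beta> = \<Phi> h"
    have c: "continuous_on circle \<alpha>" "continuous_on circle \<beta>"
      unfolding \<alpha>_def \<beta>_def using \<Phi>_continuous f(2) h(2) by auto
    have cc: "continuous_on circle (\<lambda>z. \<alpha> z * cnj (\<beta> z))" by (intro continuous_intros c)
    define a where "a n = (\<integral>z. z ^ n * (\<alpha> z * cnj (\<beta> z)) \<partial>\<sigma>)" for n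
    obtain K where K: "\<And>z. z \<in> circle \<Longrightarrow> cmod (\<alpha> z * cnj (\<beta> z)) \<le> K" "K > 0"
      using continuous_bounded[OF cc] by blast
    have aK: "cmod (a n) \<le> K" for n
    proof -
      have "cmod (a n) \<le> (\<integral>z. cmod (z ^ n * (\<alpha> z * cnj (\<beta> z))) \<partial>\<sigma>)" unfolding a_def by (rule integral_norm_bound)
      also have "\<dots> \<le> K"
        by (rule integral_le_const) (use K in \<open>auto simp: norm_mult norm_power intro!: continuous_integrable continuous_intros c AE_I2\<close>)
      finally show ?thesis .
    qed
    have var: "variance2 (\<lambda>x. f ((shift ^^ n) x) + h x) = variance2 f + variance2 h + 2 * Re (a n)" for n
    proof -
      have "variance2 (\<lambda>x. f ((shift ^^ n) x) + h x)
          = (\<integral>z. (cmod (\<alpha> z))\<^sup>2 + (cmod (\<beta> z))\<^sup>2 + 2 * Re (z ^ n * (\<alpha> z * cnj (\<beta> z))) \<partial>\<sigma>)"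
      proof (rule Bochner_Integration.integral_cong[OF refl])
        fix z assume "z \<in> space \<sigma>"
        then have z: "z \<in> circle" by simp
        have "\<Phi> (\<lambda>x. f ((shift ^^ n) x) + h x) z = z ^ n * \<alpha> z + \<beta> z"
          unfolding \<alpha>_def \<beta>_def
          by (simp only: \<Phi>_add[OF functional_shift_funpow[OF f(2)] h(2) z] \<Phi>_shift_funpow[OF f(2) z])
        moreover have "cmod (z ^ n * \<alpha> z) = cmod (\<alpha> z)" using z by (simp add: norm_mult norm_power)
        ultimately show "(cmod (\<Phi> (\<lambda>x. f ((shift ^^ n) x) + h x) z))\<^sup>2
          = (cmod (\<alpha> z))\<^sup>2 + (cmod (\<beta> z))\<^sup>2 + 2 * Re (z ^ n * (\<alpha> z * cnj (\<beta> z)))" by (simp only: cmod_add_squared mult.assoc)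
      qed
      also have "\<dots> = variance2 f + variance2 h + 2 * (\<integral>z. Re (z ^ n * (\<alpha> z * cnj (\<beta> z))) \<partial>\<sigma>)"
      proof -
        have i: "integrable \<sigma> (\<lambda>z. (cmod (\<alpha> z))\<^sup>2)" "integrable \<sigma> (\<lambda>z. (cmod (\<beta> z))\<^sup>2)"
          "integrable \<sigma> (\<lambda>z. 2 * Re (z ^ n * (\<alpha> z * cnj (\<beta> z))))"
          by (intro continuous_integrable continuous_intros c)+
        show ?thesis
          unfolding Bochner_Integration.integral_add[OF Bochner_Integration.integrable_add[OF i(1,2)] i(3)]
            Bochner_Integration.integral_add[OF i(1,2)] integral_mult_right_zero
          by (simp only: \<alpha>_def \<beta>_def)
      qed
      also have "(\<integral>z. Re (z ^ n * (\<alpha> z * cnj (\<beta> z))) \<partial>\<sigma>) = Re (a n)"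
        unfolding a_def by (rule integral_Re) (intro continuous_integrable continuous_intros c)
      finally show ?thesis .
    qed
    define E where "E = exp (- variance2 f / 2) * exp (- variance2 h / 2)"
    have E: "0 \<le> E" "E \<le> 1" unfolding E_def by (auto intro!: mult_le_one)
    have cov: "(\<integral>x. cis (l ((shift ^^ n) x)) * cis (l' x) \<partial>law) - (\<integral>x. cis (l x) \<partial>law) * (\<integral>x. cis (l' x) \<partial>law)
        = of_real (E * (exp (- Re (a n)) - 1))" for n
    proof -
      have "(\<integral>x. cis (l ((shift ^^ n) x)) * cis (l' x) \<partial>law) = (\<integral>x. cis (Re (f ((shift ^^ n) x) + h x)) \<partial>law)"
        by (simp add: f(1) h(1) cis_mult)
      also have "\<dots> = of_real (exp (- variance2 (\<lambda>x. f ((shift ^^ n) x) + h x) / 2))"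
        by (rule law_char[OF bounded_cfunctional_add[OF functional_shift_funpow[OF f(2)] h(2)]])
      also have "exp (- variance2 (\<lambda>x. f ((shift ^^ n) x) + h x) / 2) = E * exp (- Re (a n))"
        unfolding var E_def by (simp add: exp_add[symmetric] add_divide_distrib diff_divide_distrib)
      finally have 1: "(\<integral>x. cis (l ((shift ^^ n) x)) * cis (l' x) \<partial>law) = of_real (E * exp (- Re (a n)))" .
      have 2: "(\<integral>x. cis (l x) \<partial>law) * (\<integral>x. cis (l' x) \<partial>law) = of_real E"
        unfolding f(1) h(1) law_char[OF f(2)] law_char[OF h(2)] E_def by simp
      show ?thesis unfolding 1 2 by (simp add: right_diff_distrib)
    qed
    \<comment> \<open>Lipschitz bound for exp on [-K, K], an interval containing all Re (a
      n).\<close>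
    have bnd: "\<bar>exp (- y) - 1\<bar> \<le> exp K * \<bar>y\<bar>" if "\<bar>y\<bar> \<le> K" for y
    proof (cases "y \<ge> 0")
      case True
      have "1 - exp (- y) \<le> y" using exp_ge_add_one_self[of "- y"] by simp
      also have "\<dots> \<le> exp K * y" using True K(2) mult_right_mono[of 1 "exp K" y] by simp
      finally show ?thesis using True by simp
    next
      case False
      have "exp (- y) * (1 + y) \<le> exp (- y) * exp y" using exp_ge_add_one_self[of y] by (intro mult_left_mono) auto
      also have "exp (- y) * exp y = 1" by (simp flip: exp_add)
      finally have "exp (- y) - 1 \<le> exp (- y) * (- y)" by (simp add: algebra_simps)
      also have "\<dots> \<le> exp K * (- y)" using False that by (intro mult_right_mono) auto
      finally show ?thesis using False by simp
    qed
    have bd: "cmod (of_real (E * (exp (- Re (a n)) - 1))) \<le> exp K * cmod (a n)" for n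
    proof -
      have "\<bar>Re (a n)\<bar> \<le> K" using abs_Re_le_cmod[of "a n"] aK[of n] by linarith
      then have "\<bar>exp (- Re (a n)) - 1\<bar> \<le> exp K * \<bar>Re (a n)\<bar>" by (rule bnd)
      also have "\<dots> \<le> exp K * cmod (a n)" using abs_Re_le_cmod by (intro mult_left_mono) auto
      finally have "E * \<bar>exp (- Re (a n)) - 1\<bar> \<le> 1 * (exp K * cmod (a n))" using E by (intro mult_mono) auto
      then show ?thesis using E(1) by (simp only: norm_of_real abs_mult abs_of_nonneg mult_1)
    qed
    have w: "(\<lambda>N. (\<Sum>n=1..N. cmod (a n)) / real N) \<longlonglongrightarrow> 0"
      unfolding a_def by (rule wiener[OF cc])
    show "(\<lambda>N. (\<Sum>n=1..N. cmod ((\<integral>x. cis (l ((shift ^^ n) x)) * cis (l' x) \<partial>law)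
        - (\<integral>x. cis (l x) \<partial>law) * (\<integral>x. cis (l' x) \<partial>law))) / real N) \<longlonglongrightarrow> 0"
      unfolding cov by (rule cesaro_null_comparison[OF w norm_ge_zero bd])
  qed
qed

text \<open>The functional f o T^n - f has the symbol (z^n - 1) \<open>\<Phi> f\<close>, so its
  variance is at most K^2 times the integral of |z^n - 1|^2, that is, K^2 (2 - 2 Re of the n-th
  Fourier coefficient). Along \<open>nk\<close> this tends to 0.\<close>

lemma shift_rigid:
  assumes "(\<lambda>k. fourier_coeff \<sigma> (nk k)) \<longlonglongrightarrow> 1"
  shows "rigid_wrt law shift nk"
proof -
  interpret tr: trig_system borel functionals by (rule trig_system_functionals[OF separable])
  interpret law: prob_space law by (rule prob_space_law)
  show ?thesis
  proof (rule tr.rigidI[OF prob_space_law sets_law shift_preserves_law])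
    fix l :: "'h \<Rightarrow> real" assume "l \<in> functionals"
    then obtain f where f: "l = (\<lambda>x. Re (f x))" "bounded_cfunctional f" by (auto simp: functionals_def)
    obtain K where K: "\<And>z. z \<in> circle \<Longrightarrow> cmod (\<Phi> f z) \<le> K" "K > 0"
      using continuous_bounded[OF \<Phi>_continuous[OF f(2)]] by blast
    define d where "d n x = f ((shift ^^ n) x) + (- 1) * f x" for n x
    have d: "bounded_cfunctional (d n)" for n
      unfolding d_def[abs_def] by (intro bounded_cfunctional_add functional_shift_funpow bounded_cfunctional_mult f(2))
    have dm[measurable]: "d n \<in> borel_measurable law" for n
      using functional_measurable[OF d] measurable_cong_sets[OF sets_law refl] by blast
    have var_le: "variance2 (d n) \<le> K\<^sup>2 * (2 - 2 * Re (fourier_coeff \<sigma> n))" for n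
    proof -
      have "variance2 (d n) \<le> (\<integral>z. K\<^sup>2 * (2 - 2 * Re (z ^ n)) \<partial>\<sigma>)"
      proof (rule integral_mono)
        show "integrable \<sigma> (\<lambda>z. (cmod (\<Phi> (d n) z))\<^sup>2)" "integrable \<sigma> (\<lambda>z. K\<^sup>2 * (2 - 2 * Re (z ^ n)))"
          by (intro continuous_integrable continuous_intros \<Phi>_continuous d)+
        fix z assume "z \<in> space \<sigma>"
        then have z: "z \<in> circle" by simp
        have "\<Phi> (d n) z = z ^ n * \<Phi> f z + (- 1) * \<Phi> f z"
          unfolding d_def[abs_def]
          by (simp only: \<Phi>_add[OF functional_shift_funpow[OF f(2)] bounded_cfunctional_mult[OF f(2)] z]
              \<Phi>_shift_funpow[OF f(2) z] \<Phi>_mult[OF f(2) z])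
        then have "\<Phi> (d n) z = (z ^ n - 1) * \<Phi> f z" by (simp add: algebra_simps)
        then have "(cmod (\<Phi> (d n) z))\<^sup>2 = (cmod (z ^ n - 1))\<^sup>2 * (cmod (\<Phi> f z))\<^sup>2"
          by (simp add: norm_mult power_mult_distrib)
        also have "(cmod (z ^ n - 1))\<^sup>2 = 2 - 2 * Re (z ^ n)"
          using z by (simp add: cmod_minus_one_squared norm_power)
        also have "(2 - 2 * Re (z ^ n)) * (cmod (\<Phi> f z))\<^sup>2 \<le> (2 - 2 * Re (z ^ n)) * K\<^sup>2"
        proof (rule mult_left_mono)
          show "(cmod (\<Phi> f z))\<^sup>2 \<le> K\<^sup>2" using K(1)[OF z] by (rule power_mono) simp
          show "0 \<le> 2 - 2 * Re (z ^ n)" using complex_Re_le_cmod[of "z ^ n"] z by (simp add: norm_power)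
        qed
        finally show "(cmod (\<Phi> (d n) z))\<^sup>2 \<le> K\<^sup>2 * (2 - 2 * Re (z ^ n))" by (simp add: mult.commute)
      qed
      also have "\<dots> = K\<^sup>2 * (2 - 2 * Re (fourier_coeff \<sigma> n))"
      proof -
        have i: "integrable \<sigma> (\<lambda>z. z ^ n)" by (intro continuous_integrable continuous_intros)
        have "(\<integral>z. Re (z ^ n) \<partial>\<sigma>) = Re (fourier_coeff \<sigma> n)" unfolding fourier_coeff_def by (rule integral_Re[OF i])
        moreover have "(\<integral>z. 2 \<partial>\<sigma>) = (2::real)" using prob_space by simp
        ultimately show ?thesis using i prob_space
          by (simp add: Bochner_Integration.integral_diff)
      qed
      finally show ?thesis .
    qed
    have L1: "(\<integral>x. cmod (cis (l ((shift ^^ n) x)) - cis (l x)) \<partial>law) \<le> sqrt (2 - 2 * exp (- variance2 (d n) / 2))" for n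
    proof -
      define u where "u x = cmod (cis (Re (d n x)) - 1)" for x
      have [measurable]: "u \<in> borel_measurable law" unfolding u_def by measurable
      have u: "u x \<le> 2" "0 \<le> u x" for x
        unfolding u_def using norm_triangle_ineq4[of "cis (Re (d n x))" 1] by auto
      have i1: "integrable law u" by (rule law.integrable_const_bound[of _ 2]) (use u in auto)
      have "(u x)\<^sup>2 \<le> 2\<^sup>2" for x by (rule power_mono[OF u])
      then have i2: "integrable law (\<lambda>x. (u x)\<^sup>2)" by (intro law.integrable_const_bound[of _ "2\<^sup>2"]) auto
      have ic: "integrable law (\<lambda>x. cis (Re (d n x)))" by (rule law.integrable_const_bound[of _ 1]) auto
      have "(u x)\<^sup>2 = 2 - 2 * Re (cis (Re (d n x)))" for x
        unfolding u_def by (simp add: cmod_minus_one_squared)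
      then have "(\<integral>x. (u x)\<^sup>2 \<partial>law) = (\<integral>x. 2 - 2 * Re (cis (Re (d n x))) \<partial>law)" by simp
      also have "\<dots> = 2 - 2 * (\<integral>x. Re (cis (Re (d n x))) \<partial>law)"
        using integrable_Re[OF ic] law.prob_space
        by (subst Bochner_Integration.integral_diff) auto
      also have "(\<integral>x. Re (cis (Re (d n x))) \<partial>law) = exp (- variance2 (d n) / 2)"
        by (subst integral_Re[OF ic]) (simp only: law_char[OF d] Re_complex_of_real)
      finally have u2: "(\<integral>x. (u x)\<^sup>2 \<partial>law) = 2 - 2 * exp (- variance2 (d n) / 2)" .
      \<comment> \<open>Non-negative variance is used as the inequality (E u)^2 \<le> E (u^2), which
        passes from the computable second moment to the L1 norm.\<close>
      have "0 \<le> law.variance u" by (rule law.variance_positive)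
      also have "law.variance u = (\<integral>x. (u x)\<^sup>2 \<partial>law) - (\<integral>x. u x \<partial>law)\<^sup>2" by (rule law.variance_eq[OF i1 i2])
      finally have "(\<integral>x. u x \<partial>law)\<^sup>2 \<le> 2 - 2 * exp (- variance2 (d n) / 2)" by (simp add: u2)
      then have "(\<integral>x. u x \<partial>law) \<le> sqrt (2 - 2 * exp (- variance2 (d n) / 2))" by (rule real_le_rsqrt)
      moreover have "cmod (cis (l ((shift ^^ n) x)) - cis (l x)) = u x" for x
      proof -
        have "cis (l ((shift ^^ n) x)) - cis (l x) = cis (l x) * (cis (Re (d n x)) - 1)"
          by (simp add: f(1) d_def right_diff_distrib cis_mult)
        then show ?thesis by (simp add: norm_mult u_def)
      qed
      ultimately show ?thesis by simp
    qed
    have "(\<lambda>k. variance2 (d (nk k))) \<longlonglongrightarrow> 0"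
    proof (rule Lim_null_comparison)
      have "(\<lambda>k. K\<^sup>2 * (2 - 2 * Re (fourier_coeff \<sigma> (nk k)))) \<longlonglongrightarrow> K\<^sup>2 * (2 - 2 * Re 1)"
        by (intro tendsto_intros assms)
      then show "(\<lambda>k. K\<^sup>2 * (2 - 2 * Re (fourier_coeff \<sigma> (nk k)))) \<longlonglongrightarrow> 0" by simp
      show "\<forall>\<^sub>F k in sequentially. norm (variance2 (d (nk k))) \<le> K\<^sup>2 * (2 - 2 * Re (fourier_coeff \<sigma> (nk k)))"
        using var_le by simp
    qed
    then have "(\<lambda>k. sqrt (2 - 2 * exp (- variance2 (d (nk k)) / 2))) \<longlonglongrightarrow> sqrt (2 - 2 * exp (- 0 / 2))"
      by (intro tendsto_intros) auto
    then have lim: "(\<lambda>k. sqrt (2 - 2 * exp (- variance2 (d (nk k)) / 2))) \<longlonglongrightarrow> 0" by simp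
    show "(\<lambda>k. \<integral>x. cmod (cis (l ((shift ^^ nk k) x)) - cis (l x)) \<partial>law) \<longlonglongrightarrow> 0"
      by (rule Lim_null_comparison[OF _ lim]) (use L1 in simp)
  qed
qed

end

theorem theorem4p1:
  fixes nk :: "nat \<Rightarrow> nat"
  assumes "strict_mono nk" and "\<forall>k. nk k > 0"
    and "separable_type TYPE('h::complex_hilbert)"
    and "cinfinite_dim TYPE('h)"
  shows "(\<exists>\<sigma>. borel_prob_circle \<sigma> \<and> continuous_measure \<sigma> \<and>
             (\<lambda>k. fourier_coeff \<sigma> (nk k)) \<longlonglongrightarrow> 1)
     \<longleftrightarrow>
         (\<exists>(T::'h \<Rightarrow> 'h) (m::'h measure). bounded_clinear T \<and>
             gaussian_measure m \<and> non_degenerate m \<and>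
             measure_preserving_map m T \<and> weakly_mixing m T \<and> rigid_wrt m T nk)"
proof
  assume "\<exists>\<sigma>. borel_prob_circle \<sigma> \<and> continuous_measure \<sigma> \<and>
    (\<lambda>k. fourier_coeff \<sigma> (nk k)) \<longlonglongrightarrow> 1"
  then obtain \<sigma> where \<sigma>: "borel_prob_circle \<sigma>" "continuous_measure \<sigma>"
    "(\<lambda>k. fourier_coeff \<sigma> (nk k)) \<longlonglongrightarrow> 1" by blast
  interpret continuous_circle_measure \<sigma> using \<sigma> by unfold_locales
  obtain a where a: "\<And>n k. n < k \<Longrightarrow> a n k = 0"
    "\<And>N b. (\<Sum>k<N. (cmod (\<Sum>n<N. b n * a n k))\<^sup>2) = (\<integral>z. (cmod (\<Sum>n<N. b n * z ^ n))\<^sup>2 \<partial>\<sigma>)"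
    using exists_cholesky by blast
  obtain e :: "nat \<Rightarrow> 'h" where "hilbert_basis e" using exists_hilbert_basis assms(3,4) by blast
  then interpret hilbert_basis e .
  interpret gaussian_series \<sigma> e a using assms(3) a by unfold_locales
  show "\<exists>(T::'h \<Rightarrow> 'h) m. bounded_clinear T \<and> gaussian_measure m \<and> non_degenerate m \<and>
      measure_preserving_map m T \<and> weakly_mixing m T \<and> rigid_wrt m T nk"
    using shift_bounded_clinear law_gaussian law_non_degenerate shift_preserves_law
      shift_weakly_mixing shift_rigid[OF \<sigma>(3)] by blast
next
  assume "\<exists>(T::'h \<Rightarrow> 'h) m. bounded_clinear T \<and> gaussian_measure m \<and> non_degenerate m \<and>
      measure_preserving_map m T \<and> weakly_mixing m T \<and> rigid_wrt m T nk"
  then obtain T and m :: "'h measure" where m: "gaussian_measure m" "non_degenerate m"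
    "weakly_mixing m T" "rigid_wrt m T nk" by blast
  have pm: "prob_space m" and sm: "sets m = sets borel"
    using m(1) by (auto simp: gaussian_measure_def borel_prob_def)
  interpret prob_space m by fact
  have "\<exists>x::'h. x \<noteq> 0"
  proof (rule ccontr)
    assume "\<nexists>x::'h. x \<noteq> 0"
    then have "x = 0" for x :: 'h by blast
    then have "cspan {} = (UNIV :: 'h set)" by (auto simp: cspan_def)
    then show False using assms(4) unfolding cinfinite_dim_def by blast
  qed
  then obtain x :: 'h where "x \<noteq> 0" by blast
  define A where "A = ball (0::'h) (norm x / 2)"
  \<comment> \<open>A second ball, disjoint from \<open>A\<close> and of positive mass by
    non-degeneracy, keeps the mass of \<open>A\<close> below 1.\<close>
  define B where "B = ball x (norm x / 2)"
  have pos: "measure m U > 0" if "open U" "U \<noteq> {}" for U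
    using m(2) that by (auto simp: non_degenerate_def emeasure_eq_measure)
  have "A \<inter> B = {}" unfolding A_def B_def
    by (rule disjoint_ballI) (simp add: dist_norm)
  have sets: "A \<in> sets m" "B \<in> sets m" by (auto simp: sm A_def B_def)
  have "measure m A > 0" "measure m B > 0" using \<open>x \<noteq> 0\<close> by (auto intro!: pos simp: A_def B_def)
  moreover have "measure m A + measure m B \<le> 1"
    using finite_measure_Union[OF sets \<open>A \<inter> B = {}\<close>] prob_le_1[of "A \<union> B"] by simp
  ultimately show "\<exists>\<sigma>. borel_prob_circle \<sigma> \<and> continuous_measure \<sigma> \<and>
    (\<lambda>k. fourier_coeff \<sigma> (nk k)) \<longlonglongrightarrow> 1"
    by (intro weakly_mixing_rigid_imp_measure[OF pm m(3,4) sets(1)]) auto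
qed

end
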